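(* Let $d\ge 2$ and let $K\subset\mathbb{R}^d$ be a convex body with $o\in\operatorname{int}K$ which slides freely in a ball. Let $K_1=K+B^d$ and $D_K^1=\{(t,u)\in[0,\infty)\times S^{d-1}: h_K(u)\le t\le h_{K_1}(u)\}$. Let $q:[0,\infty)\times S^{d-1}\to[0,\infty)$ be a locally integrable function which (i) is concentrated on $D_K^1$, (ii) is positive and continuous at each point of the set $D_K=\{(t,u)\in[0,\infty)\times S^{d-1}: t=h_K(u)\}$ in $D_K^1$ (that is, as a function on $D_K^1$), and (iii) satisfies $\mu_q(\mathcal{H}_K)=1$. Let $\lambda:\mathbb{R}\times S^{d-1}\to[0,\infty)$ be a locally integrable function (in the sense that $V_\lambda(M)<\infty$ for all convex bodies $M$ with $o\in\operatorname{int}M$) which is continuous at each point of the set $\{(\rho(K,u),u):u\in S^{d-1}\}$. Let $K^{(n)}=\bigcap_{i=1}^nH_i^-$, where $H_1,\dots,H_n$ are independent random hyperplanes with distribution $\mu_q$ and $H_i^-$ is the closed half-space bounded by $H_i$ that contains $K$. Then $$\operatorname{Var}_{\mu_q}\bigl(V_\lambda(K^{(n)}\cap K_1)\bigr)\ll n^{-\frac{d+3}{d+1}},$$ where the implied constant depends only on $K$, $\lambda$ and $q$; that is, there is a constant $c>0$ depending only on $K$, $\lambda$ and $q$ such that $\operatorname{Var}_{\mu_q}(V_\lambda(K^{(n)}\cap K_1))\le c\,n^{-\frac{d+3}{d+1}}$ for all $n\in\mathbb{N}$.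
   Context: A convex body is a compact convex set with nonempty interior in $\mathbb{R}^d$; $o$ is the origin. $\mathcal{H}^{d-1}$ is $(d-1)$-dimensional Hausdorff measure, $B^d$ is the closed unit ball centred at $o$, $\kappa_d$ is its volume. $h_M(u)=\max_{x\in M}\langle u,x\rangle$ is the support function of $M$. For $o\in\operatorname{int}M$, $\rho(M,x)=\max\{t\ge0: tx\in M\}$, $x\ne o$, is the radial function. $K$ slides freely in a ball $B$ if for each boundary point $p$ of $B$ there is a translate $K+v$ with $p\in K+v$ and $K+v\subset B$. Weighted volume: for measurable $\lambda:\mathbb{R}\times S^{d-1}\to[0,\infty)$ and a convex body $M$ with $o\in\operatorname{int}M$, $$V_\lambda(M)=\int_{S^{d-1}}\int_0^{\rho(M,u)}t^{d-1}\lambda(t,u)\,\mathrm{d}t\,\mathcal{H}^{d-1}(\mathrm{d}u).$$ Probability model: $H(u,t)=\{y\in\mathbb{R}^d:\langle u,y\rangle=t\}$. $\mathcal{H}_K$ is the set of hyperplanes in $\mathbb{R}^d$ that intersect $K_1$ and are disjoint from the interior of $K$. A nonnegative measurable $q$ on $[0,\infty)\times S^{d-1}$ is locally integrable if $\int_{S^{d-1}}\int_Cq(t,u)\,\mathrm{d}t\,\mathcal{H}^{d-1}(\mathrm{d}u)<\infty$ for all compact $C\subset[0,\infty)$. The measure $\mu_q$ on hyperplanes is $$\mu_q=\frac{1}{d\kappa_d}\int_{S^{d-1}}\int_0^\infty\mathbf{1}\{H(u,t)\in\cdot\}\,q(t,u)\,\mathrm{d}t\,\mathcal{H}^{d-1}(\mathrm{d}u).$$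 Under (i) and (iii) it is a probability measure concentrated on $\mathcal{H}_K$. $\operatorname{Var}_{\mu_q}$ is variance when the hyperplanes are i.i.d. with distribution $\mu_q$. *)

theory Defs
  imports "HOL-Probability.Probability"
begin

section \<open>Convex bodies\<close>

definition convex_body :: "'a::euclidean_space set \<Rightarrow> bool" where
  "convex_body M \<longleftrightarrow> convex M \<and> compact M \<and> interior M \<noteq> {}"

definition support_fun :: "'a::euclidean_space set \<Rightarrow> 'a \<Rightarrow> real" where
  "support_fun M u = (SUP x\<in>M. u \<bullet> x)"

definition radial_fun :: "'a::euclidean_space set \<Rightarrow> 'a \<Rightarrow> real" where
  "radial_fun M x = Sup {t. 0 \<le> t \<and> t *\<^sub>R x \<in> M}"

definition slides_freely_in :: "'a::euclidean_space set \<Rightarrow> 'a set \<Rightarrow> bool" where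
  "slides_freely_in K B \<longleftrightarrow>
    (\<forall>p\<in>frontier B. \<exists>v. p \<in> (+) v ` K \<and> (+) v ` K \<subseteq> B)"

definition outer_parallel :: "'a::euclidean_space set \<Rightarrow> 'a set" where
  "outer_parallel K = K + cball 0 1"

definition shell_boundary :: "'a::euclidean_space set \<Rightarrow> (real \<times> 'a) set" where
  "shell_boundary K = {(t, u). 0 \<le> t \<and> u \<in> sphere 0 1 \<and> t = support_fun K u}"

definition shell :: "'a::euclidean_space set \<Rightarrow> (real \<times> 'a) set" where
  "shell K = {(t, u). 0 \<le> t \<and> u \<in> sphere 0 1 \<and>
     support_fun K u \<le> t \<and> t \<le> support_fun (outer_parallel K) u}"

section \<open>Hausdorff measure\<close>

text \<open>The normalisation is the one for which the measure of integer dimension \<open>s\<close> agrees with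
  Lebesgue measure on \<open>s\<close>-dimensional subspaces. The empty set is treated separately because
  \<open>0 ^ 0 = 1\<close>, and coverings consist of bounded sets because \<open>diameter\<close> is only meaningful for them.\<close>

definition hausdorff_weight :: "nat \<Rightarrow> 'a::metric_space set \<Rightarrow> ennreal" where
  "hausdorff_weight s C =
     (if C = {} then 0 else ennreal (unit_ball_vol (real s) * (diameter C / 2) ^ s))"

definition hausdorff_pre :: "nat \<Rightarrow> real \<Rightarrow> 'a::metric_space set \<Rightarrow> ennreal" where
  "hausdorff_pre s \<delta> A =
     (INF C\<in>{C :: nat \<Rightarrow> 'a set. A \<subseteq> (\<Union>i. C i) \<and> (\<forall>i. bounded (C i) \<and> diameter (C i) \<le> \<delta>)}.
        \<Sum>i. hausdorff_weight s (C i))"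

definition hausdorff_outer :: "nat \<Rightarrow> 'a::metric_space set \<Rightarrow> ennreal" where
  "hausdorff_outer s A = (SUP \<delta>\<in>{0<..}. hausdorff_pre s \<delta> A)"

definition hausdorff_measure :: "nat \<Rightarrow> 'a::metric_space measure" where
  "hausdorff_measure s = measure_of UNIV (sets borel) (hausdorff_outer s)"

text \<open>\<open>hausdorff_outer\<close> is a metric outer measure, so \<open>measure_of\<close> above does not degenerate:
  see \<open>emeasure_hausdorff_measure\<close> below.\<close>

lemma hausdorff_pre_le:
  assumes "A \<subseteq> (\<Union>i. C i)" "\<And>i. bounded (C i)" "\<And>i. diameter (C i) \<le> \<delta>"
  shows "hausdorff_pre s \<delta> A \<le> (\<Sum>i::nat. hausdorff_weight s (C i))"
  unfolding hausdorff_pre_def using assms by (intro INF_lower) auto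

lemma hausdorff_pre_mono: "A \<subseteq> B \<Longrightarrow> hausdorff_pre s \<delta> A \<le> hausdorff_pre s \<delta> B"
  unfolding hausdorff_pre_def by (rule INF_superset_mono) auto

lemma hausdorff_pre_antimono: "\<delta> \<le> \<epsilon> \<Longrightarrow> hausdorff_pre s \<epsilon> A \<le> hausdorff_pre s \<delta> A"
  unfolding hausdorff_pre_def by (rule INF_superset_mono) (auto intro: order_trans)

lemma hausdorff_pre_UN:
  fixes A :: "nat \<Rightarrow> 'a::metric_space set"
  assumes "\<delta> > 0"
  shows "hausdorff_pre s \<delta> (\<Union>n. A n) \<le> (\<Sum>n. hausdorff_pre s \<delta> (A n))"
proof (rule ennreal_le_epsilon)
  fix e :: real assume e: "0 < e" and fin: "(\<Sum>n. hausdorff_pre s \<delta> (A n)) < top"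
  have "\<exists>C. A n \<subseteq> (\<Union>i. C i) \<and> (\<forall>i. bounded (C i) \<and> diameter (C i) \<le> \<delta>) \<and>
      (\<Sum>i::nat. hausdorff_weight s (C i)) \<le> hausdorff_pre s \<delta> (A n) + ennreal (e * (1/2) ^ Suc n)" for n
  proof -
    have "hausdorff_pre s \<delta> (A n) < top"
      using fin by (meson ennreal_suminf_lessD)
    then have "hausdorff_pre s \<delta> (A n) < hausdorff_pre s \<delta> (A n) + ennreal (e * (1/2) ^ Suc n)"
      using e by (simp add: less_top)
    then show ?thesis
      unfolding hausdorff_pre_def[of s \<delta> "A n"]
      apply (subst (asm) (1) INF_less_iff)
      by (auto intro: less_imp_le)
  qed
  then obtain C where C: "\<And>n. A n \<subseteq> (\<Union>i. C n i)"
    "\<And>n i. bounded (C n i)" "\<And>n i. diameter (C n i) \<le> \<delta>"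
    "\<And>n. (\<Sum>i::nat. hausdorff_weight s (C n i)) \<le> hausdorff_pre s \<delta> (A n) + ennreal (e * (1/2) ^ Suc n)"
    by metis
  let ?D = "\<lambda>k. case_prod C (prod_decode k)"
  have "(\<Union>n. A n) \<subseteq> (\<Union>k. ?D k)"
  proof
    fix x assume "x \<in> (\<Union>n. A n)"
    then obtain n i where "x \<in> C n i" using C(1) by blast
    then have "x \<in> ?D (prod_encode (n, i))" by simp
    then show "x \<in> (\<Union>k. ?D k)" by (rule UN_I[OF UNIV_I])
  qed
  then have "hausdorff_pre s \<delta> (\<Union>n. A n) \<le> (\<Sum>k. hausdorff_weight s (?D k))"
    using C(2,3) by (intro hausdorff_pre_le) (simp_all add: case_prod_beta)
  also have "\<dots> = (\<Sum>n. \<Sum>i. hausdorff_weight s (C n i))"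
    using suminf_ennreal_2dimen[where f="\<lambda>(n, i). hausdorff_weight s (C n i)"]
    by (simp add: comp_def case_prod_beta)
  also have "\<dots> \<le> (\<Sum>n. hausdorff_pre s \<delta> (A n) + ennreal (e * (1/2) ^ Suc n))"
    by (intro suminf_le C(4)) auto
  also have "\<dots> = (\<Sum>n. hausdorff_pre s \<delta> (A n)) + (\<Sum>n. ennreal (e * (1/2) ^ Suc n))"
    by (rule suminf_add[symmetric]) auto
  also have "(\<Sum>n. ennreal (e * (1/2) ^ Suc n)) = ennreal e"
    using e sums_mult[OF power_half_series, of e] by (intro suminf_ennreal_eq) auto
  finally show "hausdorff_pre s \<delta> (\<Union>n. A n) \<le> (\<Sum>n. hausdorff_pre s \<delta> (A n)) + ennreal e" .
qed

lemma hausdorff_outer_mono: "A \<subseteq> B \<Longrightarrow> hausdorff_outer s A \<le> hausdorff_outer s B"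
  unfolding hausdorff_outer_def by (intro SUP_mono) (use hausdorff_pre_mono in blast)

lemma hausdorff_outer_empty: "hausdorff_outer s {} = 0"
proof -
  have "hausdorff_pre s \<delta> {} = 0" if "\<delta> > 0" for \<delta>
    using hausdorff_pre_le[of "{}" "\<lambda>_. {}" \<delta> s] that by (simp add: hausdorff_weight_def)
  then show ?thesis unfolding hausdorff_outer_def
    by (intro antisym SUP_least) auto
qed

lemma hausdorff_outer_UN:
  "hausdorff_outer s (\<Union>n. A n) \<le> (\<Sum>n::nat. hausdorff_outer s (A n))"
  unfolding hausdorff_outer_def[of s "\<Union>n. A n"]
proof (rule SUP_least)
  fix \<delta> :: real assume d: "\<delta> \<in> {0<..}"
  then have "hausdorff_pre s \<delta> (\<Union>n. A n) \<le> (\<Sum>n. hausdorff_pre s \<delta> (A n))"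
    by (intro hausdorff_pre_UN) auto
  also have "\<dots> \<le> (\<Sum>n. hausdorff_outer s (A n))"
    unfolding hausdorff_outer_def using d by (intro suminf_le SUP_upper) auto
  finally show "hausdorff_pre s \<delta> (\<Union>n. A n) \<le> (\<Sum>n. hausdorff_outer s (A n))" .
qed

lemma outer_measure_space_hausdorff:
  "outer_measure_space (Pow UNIV) (hausdorff_outer s)"
  unfolding outer_measure_space_def positive_def increasing_def countably_subadditive_def
  by (auto simp: hausdorff_outer_empty hausdorff_outer_mono intro: hausdorff_outer_UN)

lemma hausdorff_outer_Un: "hausdorff_outer s (A \<union> B) \<le> hausdorff_outer s A + hausdorff_outer s B"
proof -
  have "subadditive (Pow UNIV) (hausdorff_outer s)"
    using outer_measure_space_hausdorff[of s] unfolding outer_measure_space_def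
    by (intro ring_of_sets.countably_subadditive_subadditive[OF algebra.axioms(1)[OF algebra_Pow]]) auto
  moreover have "A \<union> B = A \<union> (B - A)" by auto
  ultimately have "hausdorff_outer s (A \<union> B) \<le> hausdorff_outer s A + hausdorff_outer s (B - A)"
    unfolding subadditive_def by (metis Diff_disjoint Pow_UNIV UNIV_I)
  also have "\<dots> \<le> hausdorff_outer s A + hausdorff_outer s B"
    by (intro add_left_mono hausdorff_outer_mono) auto
  finally show ?thesis .
qed

lemma hausdorff_pre_separated:
  assumes "\<And>x y. x \<in> A \<Longrightarrow> y \<in> B \<Longrightarrow> dist x y \<ge> r" "\<delta> < r"
  shows "hausdorff_pre s \<delta> A + hausdorff_pre s \<delta> B \<le> hausdorff_pre s \<delta> (A \<union> B)"
  unfolding hausdorff_pre_def[of s \<delta> "A \<union> B"]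
proof (rule INF_greatest, clarify)
  fix C :: "nat \<Rightarrow> 'a set"
  assume cov: "A \<union> B \<subseteq> (\<Union>i. C i)" and C: "\<forall>i. bounded (C i) \<and> diameter (C i) \<le> \<delta>"
  define P where "P = (\<lambda>A i. if C i \<inter> A \<noteq> {} then C i else {})"
  have disj: "C i \<inter> A = {} \<or> C i \<inter> B = {}" for i
  proof (rule ccontr)
    assume "\<not> ?thesis"
    then obtain x y where "x \<in> C i" "x \<in> A" "y \<in> C i" "y \<in> B" by auto
    then show False
      using assms(1)[of x y] assms(2) C[rule_format, of i] diameter_bounded_bound[of "C i" x y]
      by linarith
  qed
  have d0: "0 \<le> \<delta>" using C diameter_ge_0 order_trans by blast
  have le: "hausdorff_pre s \<delta> D \<le> (\<Sum>i. hausdorff_weight s (P D i))" if D: "D \<subseteq> A \<union> B" for D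
  proof (rule hausdorff_pre_le)
    show "D \<subseteq> (\<Union>i. P D i)"
    proof
      fix x assume x: "x \<in> D"
      then obtain i where "x \<in> C i" using D cov by blast
      then have "x \<in> P D i" using x by (auto simp: P_def)
      then show "x \<in> (\<Union>i. P D i)" by blast
    qed
  qed (use C d0 in \<open>auto simp: P_def\<close>)
  have "hausdorff_pre s \<delta> A + hausdorff_pre s \<delta> B \<le>
      (\<Sum>i. hausdorff_weight s (P A i)) + (\<Sum>i. hausdorff_weight s (P B i))"
    by (intro add_mono le) auto
  also have "\<dots> = (\<Sum>i. hausdorff_weight s (P A i) + hausdorff_weight s (P B i))"
    by (rule suminf_add) auto
  also have "\<dots> \<le> (\<Sum>i. hausdorff_weight s (C i))"
    using disj by (intro suminf_le) (auto simp: P_def hausdorff_weight_def)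
  finally show "hausdorff_pre s \<delta> A + hausdorff_pre s \<delta> B \<le> (\<Sum>i. hausdorff_weight s (C i))" .
qed

lemma hausdorff_outer_separated:
  assumes "\<And>x y. x \<in> A \<Longrightarrow> y \<in> B \<Longrightarrow> dist x y \<ge> r" "r > 0"
  shows "hausdorff_outer s A + hausdorff_outer s B \<le> hausdorff_outer s (A \<union> B)"
proof -
  have *: "hausdorff_pre s d A + hausdorff_pre s e B \<le> hausdorff_outer s (A \<union> B)"
    if "d > 0" "e > 0" for d e
  proof -
    let ?m = "min (min d e) (r/2)"
    have "hausdorff_pre s d A + hausdorff_pre s e B \<le> hausdorff_pre s ?m A + hausdorff_pre s ?m B"
      by (intro add_mono hausdorff_pre_antimono) auto
    also have "\<dots> \<le> hausdorff_pre s ?m (A \<union> B)"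
      using assms by (intro hausdorff_pre_separated[of A B r]) auto
    also have "\<dots> \<le> hausdorff_outer s (A \<union> B)"
      unfolding hausdorff_outer_def using that assms by (intro SUP_upper) auto
    finally show ?thesis .
  qed
  have "hausdorff_outer s A + hausdorff_outer s B =
      (SUP d\<in>{0<..}. hausdorff_pre s d A + hausdorff_outer s B)"
    unfolding hausdorff_outer_def[of s A] by (subst ennreal_SUP_add_left) auto
  also have "\<dots> = (SUP d\<in>{0<..}. SUP e\<in>{0<..}. hausdorff_pre s d A + hausdorff_pre s e B)"
    unfolding hausdorff_outer_def[of s B] by (subst ennreal_SUP_add_right) auto
  also have "\<dots> \<le> hausdorff_outer s (A \<union> B)"
    using * by (intro SUP_least) auto
  finally show ?thesis .
qed

lemma hausdorff_outer_separated_sum: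
  fixes R :: "nat \<Rightarrow> 'a::metric_space set"
  assumes "\<And>i j x y. i < j \<Longrightarrow> x \<in> R i \<Longrightarrow> y \<in> R j \<Longrightarrow> dist x y \<ge> r j" "\<And>j. r j > 0"
  shows "(\<Sum>i<n. hausdorff_outer s (R i)) \<le> hausdorff_outer s (\<Union>i<n. R i)"
proof (induction n)
  case (Suc n)
  have "(\<Sum>i<Suc n. hausdorff_outer s (R i)) \<le> hausdorff_outer s (\<Union>i<n. R i) + hausdorff_outer s (R n)"
    using Suc by (simp add: add_right_mono)
  also have "\<dots> \<le> hausdorff_outer s ((\<Union>i<n. R i) \<union> R n)"
    using assms by (intro hausdorff_outer_separated[of _ _ "r n"]) auto
  also have "(\<Union>i<n. R i) \<union> R n = (\<Union>i<Suc n. R i)" by (auto simp: less_Suc_eq)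
  finally show ?case .
qed simp

lemma hausdorff_outer_closed:
  fixes F X :: "'a::metric_space set"
  assumes F: "closed F"
  shows "hausdorff_outer s (X \<inter> F) + hausdorff_outer s (X - F) \<le> hausdorff_outer s X"
proof (cases "F = {} \<or> hausdorff_outer s X = top")
  case True
  then show ?thesis by (auto simp: hausdorff_outer_empty)
next
  case False
  then have ne: "F \<noteq> {}" and fin: "hausdorff_outer s X < top" by (auto simp: less_top)
  define D where "D = (\<lambda>k::nat. {x\<in>X. infdist x F \<ge> 1 / (real k + 1)})"
  define R where "R = (\<lambda>k. D (Suc k) - D k)"
  let ?\<mu> = "hausdorff_outer s"
  have sep: "dist x y \<ge> 1 / (real i + 2) - 1 / (real j + 1)" if "x \<in> R i" "y \<in> R j" for x y i j
    using that infdist_triangle[of x F y] by (auto simp: R_def D_def dist_commute add_ac)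
  have gap: "1 / (real i + 2) - 1 / (real j + 1) \<ge> 1 / (real j) - 1 / (real j + 1)" if "i + 2 \<le> j" for i j
    using that by (intro diff_right_mono divide_left_mono) auto
  have pos: "1 / (real j) - 1 / (real j + 1) > 0" if "j > 0" for j
    using that by (simp add: field_simps add_pos_pos)
  have half: "(\<Sum>i<n. ?\<mu> (R (2 * i + c))) \<le> ?\<mu> X" for n c
  proof -
    have "(\<Sum>i<n. ?\<mu> (R (2 * i + c))) \<le> ?\<mu> (\<Union>i<n. R (2 * i + c))"
    proof (rule hausdorff_outer_separated_sum[where
         r = "\<lambda>j. if j = 0 then 1 else 1 / real (2 * j + c) - 1 / (real (2 * j + c) + 1)"])
      fix i j x y assume ij: "i < j" and xy: "x \<in> R (2 * i + c)" "y \<in> R (2 * j + c)"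
      then show "(if j = 0 then 1 else 1 / real (2 * j + c) - 1 / (real (2 * j + c) + 1)) \<le> dist x y"
        using sep[OF xy] gap[of "2 * i + c" "2 * j + c"] by auto
    next
      fix j show "0 < (if j = 0 then 1 else 1 / real (2 * j + c) - 1 / (real (2 * j + c) + 1))"
        using pos[of "2 * j + c"] by auto
    qed
    also have "\<dots> \<le> ?\<mu> X" by (intro hausdorff_outer_mono) (auto simp: R_def D_def)
    finally show ?thesis .
  qed
  have split: "(\<Sum>i<2*n. f i) = (\<Sum>i<n. f (2 * i + 0)) + (\<Sum>i<n. f (2 * i + 1))" for n and f :: "nat \<Rightarrow> ennreal"
    by (induction n) (auto simp: algebra_simps)
  have part: "(\<Sum>i<n. ?\<mu> (R i)) \<le> ?\<mu> X + ?\<mu> X" for n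
  proof -
    have "(\<Sum>i<n. ?\<mu> (R i)) \<le> (\<Sum>i<2*n. ?\<mu> (R i))" by (intro sum_mono2) auto
    also have "\<dots> \<le> ?\<mu> X + ?\<mu> X" unfolding split by (intro add_mono half)
    finally show ?thesis .
  qed
  have sumfin: "(\<Sum>i. ?\<mu> (R i)) < top"
  proof -
    have "(\<Sum>i. ?\<mu> (R i)) \<le> ?\<mu> X + ?\<mu> X" by (intro suminf_le_const part) auto
    also have "\<dots> < top" using fin by simp
    finally show ?thesis .
  qed
  define g where "g = (\<lambda>i. enn2real (?\<mu> (R i)))"
  have g: "?\<mu> (R i) = ennreal (g i)" for i
    unfolding g_def using ennreal_suminf_lessD[OF sumfin, of i] by simp
  have g0: "g i \<ge> 0" for i unfolding g_def by simp
  have summ: "summable g"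
    using sumfin g0 unfolding g by (intro summable_suminf_not_top) (auto simp: less_top)
  show ?thesis
  proof (rule ennreal_le_epsilon)
    fix e :: real assume e: "0 < e"
    obtain N where N: "norm (\<Sum>i. g (i + N)) < e" using suminf_exist_split[OF e summ] by blast
    have "X - F \<subseteq> D N \<union> (\<Union>i. R (i + N))"
    proof
      fix x assume x: "x \<in> X - F"
      then have "infdist x F > 0"
        using F ne by (simp add: infdist_pos_not_in_closed)
      then obtain k where "1 / (real k + 1) < infdist x F"
        by (metis nat_approx_posE of_nat_Suc add.commute)
      then have k: "x \<in> D k" using x by (auto simp: D_def)
      show "x \<in> D N \<union> (\<Union>i. R (i + N))"
      proof (cases "x \<in> D N")
        case False
        define m where "m = (LEAST m. x \<in> D m)"
        have m: "x \<in> D m" unfolding m_def using k by (rule LeastI)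
        have mono: "x \<in> D b" if "x \<in> D a" "a \<le> b" for a b
        proof -
          have "1 / (real b + 1) \<le> 1 / (real a + 1)" using that by (intro divide_left_mono) auto
          then show ?thesis using that by (auto simp: D_def)
        qed
        have Nm: "N < m" using False m mono by (meson not_le)
        then obtain j where j: "m = Suc j" by (cases m) auto
        have "x \<notin> D j" using not_less_Least[of j "\<lambda>m. x \<in> D m"] j unfolding m_def by auto
        then have "x \<in> R j" using m j by (auto simp: R_def)
        moreover have "j = (j - N) + N" using Nm j by auto
        ultimately show ?thesis by (metis UN_I UnI2 UNIV_I)
      qed simp
    qed
    then have "?\<mu> (X - F) \<le> ?\<mu> (D N \<union> (\<Union>i. R (i + N)))" by (rule hausdorff_outer_mono)
    also have "\<dots> \<le> ?\<mu> (D N) + ?\<mu> (\<Union>i. R (i + N))" by (rule hausdorff_outer_Un)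
    also have "?\<mu> (\<Union>i. R (i + N)) \<le> (\<Sum>i. ?\<mu> (R (i + N)))" by (rule hausdorff_outer_UN)
    also have "(\<Sum>i. ?\<mu> (R (i + N))) = ennreal (\<Sum>i. g (i + N))"
      unfolding g using summ g0 by (intro suminf_ennreal2) (auto simp: summable_iff_shift)
    also have "\<dots> \<le> ennreal e" using N by (intro ennreal_leI) auto
    finally have 1: "?\<mu> (X - F) \<le> ?\<mu> (D N) + ennreal e" by (simp add: add_left_mono)
    have "?\<mu> (X \<inter> F) + ?\<mu> (D N) \<le> ?\<mu> ((X \<inter> F) \<union> D N)"
    proof (rule hausdorff_outer_separated[of _ _ "1 / (real N + 1)"])
      fix x y assume "x \<in> X \<inter> F" "y \<in> D N"
      then show "1 / (real N + 1) \<le> dist x y"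
        using infdist_le[of x F y] by (auto simp: D_def dist_commute)
    qed simp
    also have "\<dots> \<le> ?\<mu> X" by (intro hausdorff_outer_mono) (auto simp: D_def)
    finally have 2: "?\<mu> (X \<inter> F) + ?\<mu> (D N) \<le> ?\<mu> X" .
    have "?\<mu> (X \<inter> F) + ?\<mu> (X - F) \<le> ?\<mu> (X \<inter> F) + (?\<mu> (D N) + ennreal e)"
      using 1 by (rule add_left_mono)
    also have "\<dots> \<le> ?\<mu> X + ennreal e"
      using add_right_mono[OF 2, of "ennreal e"] by (simp add: add.assoc)
    finally show "?\<mu> (X \<inter> F) + ?\<mu> (X - F) \<le> ?\<mu> X + ennreal e" .
  qed
qed

lemma measure_space_hausdorff:
  "measure_space UNIV (sets borel) (hausdorff_outer s :: 'a::metric_space set \<Rightarrow> ennreal)"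
proof -
  interpret P: sigma_algebra "UNIV :: 'a set" "Pow UNIV" by (rule sigma_algebra_Pow)
  let ?L = "lambda_system UNIV (Pow UNIV) (hausdorff_outer s :: 'a set \<Rightarrow> ennreal)"
  have ms: "measure_space UNIV ?L (hausdorff_outer s :: 'a set \<Rightarrow> ennreal)"
    by (rule P.caratheodory_lemma[OF outer_measure_space_hausdorff])
  have "Collect closed \<subseteq> ?L"
  proof
    fix F :: "'a set" assume "F \<in> Collect closed"
    then have F: "closed F" by simp
    show "F \<in> ?L"
      unfolding P.lambda_system_eq
    proof (safe)
      fix X :: "'a set"
      have "hausdorff_outer s X = hausdorff_outer s ((X \<inter> F) \<union> (X - F))" by (simp add: Int_Diff_Un)
      also have "\<dots> \<le> hausdorff_outer s (X \<inter> F) + hausdorff_outer s (X - F)" by (rule hausdorff_outer_Un)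
      finally show "hausdorff_outer s (X \<inter> F) + hausdorff_outer s (X - F) = hausdorff_outer s X"
        using hausdorff_outer_closed[OF F, of s X] by (intro antisym)
    qed auto
  qed
  then have "sigma_sets UNIV (Collect closed) \<subseteq> ?L"
    using ms unfolding measure_space_def by (intro sigma_algebra.sigma_sets_subset) auto
  moreover have "sets (borel :: 'a measure) = sigma_sets UNIV (Collect closed)"
    by (simp add: borel_eq_closed)
  ultimately have "sets (borel :: 'a measure) \<subseteq> ?L" by simp
  then show ?thesis
    using ms sets.sigma_algebra_axioms[of "borel :: 'a measure"]
    by (intro measure_down[OF ms]) auto
qed

lemma sets_hausdorff_measure [measurable_cong, simp]: "sets (hausdorff_measure s) = sets borel"
  unfolding hausdorff_measure_def
  using sets.sigma_sets_eq[of "borel :: 'a measure"] by (simp add: sets_measure_of_conv)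

lemma space_hausdorff_measure [simp]: "space (hausdorff_measure s) = UNIV"
  by (simp add: hausdorff_measure_def space_measure_of_conv)

lemma emeasure_hausdorff_measure:
  "A \<in> sets borel \<Longrightarrow> emeasure (hausdorff_measure s) A = hausdorff_outer s A"
  using measure_space_hausdorff[of s]
  by (subst emeasure_measure_of[OF hausdorff_measure_def])
     (auto simp: measure_space_def)

definition sphere_measure :: "'a::euclidean_space measure" where
  "sphere_measure = restrict_space (hausdorff_measure (DIM('a) - 1)) (sphere 0 1)"

lemma sets_sphere_measure [measurable_cong]:
  "sets (sphere_measure :: 'a::euclidean_space measure) = sets (restrict_space borel (sphere 0 1))"
  unfolding sphere_measure_def by (intro sets_restrict_space_cong) simp

lemma space_sphere_measure [simp]: "space sphere_measure = sphere 0 1"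
  by (simp add: sphere_measure_def space_restrict_space)

section \<open>Weighted volume\<close>

definition weighted_volume :: "(real \<times> 'a::euclidean_space \<Rightarrow> real) \<Rightarrow> 'a set \<Rightarrow> ennreal" where
  "weighted_volume lam M =
     (\<integral>\<^sup>+u. (\<integral>\<^sup>+t\<in>{0..radial_fun M u}. ennreal (t ^ (DIM('a) - 1) * lam (t, u)) \<partial>lborel)
        \<partial>sphere_measure)"

section \<open>Random hyperplanes\<close>

definition hyperplane :: "'a::euclidean_space \<Rightarrow> real \<Rightarrow> 'a set" where
  "hyperplane u t = {y. u \<bullet> y = t}"

text \<open>The Borel sets of the Fell topology: they are generated by the families of hyperplanes
  hitting a given compact set.\<close>

definition hyperplane_space :: "'a::euclidean_space set measure" where
  "hyperplane_space =
     (let \<A> = {hyperplane u t | u t. u \<in> sphere 0 1}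
      in sigma \<A> {{H \<in> \<A>. H \<inter> C \<noteq> {}} | C. compact C})"

lemma space_hyperplane_space: "space hyperplane_space = {hyperplane u t | u t. u \<in> sphere 0 1}"
  by (auto simp: hyperplane_space_def Let_def space_measure_of_conv)

lemma measurable_hyperplane:
  "(\<lambda>(u, t). hyperplane u t) \<in>
     measurable (sphere_measure \<Otimes>\<^sub>M restrict_space lborel {0..}) (hyperplane_space :: 'a::euclidean_space set measure)"
  unfolding hyperplane_space_def Let_def
proof (rule measurable_measure_of)
  let ?M = "sphere_measure \<Otimes>\<^sub>M restrict_space lborel {0..} :: ('a \<times> real) measure"
  show "(\<lambda>(u, t). hyperplane u t) \<in> space ?M \<rightarrow> {hyperplane u t | u t. u \<in> sphere 0 1}"
    by (auto simp: space_pair_measure)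
  fix Y :: "'a set set"
  assume "Y \<in> {{H \<in> {hyperplane u t | u t. u \<in> sphere 0 1}. H \<inter> C \<noteq> {}} | C. compact C}"
  then obtain C where C: "compact C" and Y: "Y = {H \<in> {hyperplane u t | u t. u \<in> sphere 0 1}. H \<inter> C \<noteq> {}}"
    by blast
  define Z where "Z = {(u, t) | u t. \<exists>y\<in>C. u \<bullet> y = (t::real)}"
  have "closed {z. \<exists>y. y \<in> C \<and> (y, z) \<in> {w. fst (snd w) \<bullet> fst w = (snd (snd w) :: real)}}"
    by (intro closed_compact_projection[OF C] closed_Collect_eq continuous_intros)
  also have "{z. \<exists>y. y \<in> C \<and> (y, z) \<in> {w. fst (snd w) \<bullet> fst w = (snd (snd w) :: real)}} = Z"
    by (auto simp: Z_def)
  finally have Z: "Z \<in> sets borel" by simp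
  have "(\<lambda>(u, t). hyperplane u t) -` Y \<inter> space ?M = (\<lambda>z. z) -` Z \<inter> space ?M"
    by (auto simp: Y Z_def hyperplane_def space_pair_measure)
  also have "\<dots> \<in> sets ?M"
  proof (rule measurable_sets[OF _ Z])
    have "fst \<in> borel_measurable ?M"
      by (rule measurable_compose[OF measurable_fst])
         (auto simp: sphere_measure_def intro!: measurable_restrict_space1)
    moreover have "snd \<in> borel_measurable ?M"
      by (rule measurable_compose[OF measurable_snd]) (auto intro: measurable_restrict_space1)
    ultimately have "(\<lambda>z. (fst z, snd z)) \<in> borel_measurable ?M" by (rule borel_measurable_Pair)
    then show "(\<lambda>z. z) \<in> borel_measurable ?M" by simp
  qed
  finally show "(\<lambda>(u, t). hyperplane u t) -` Y \<inter> space ?M \<in> sets ?M" .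
qed auto

definition hyperplane_measure :: "(real \<times> 'a::euclidean_space \<Rightarrow> real) \<Rightarrow> 'a set measure" where
  "hyperplane_measure q =
     scale_measure (ennreal (1 / (real DIM('a) * measure lborel (cball (0::'a) 1))))
       (distr
         (density (sphere_measure \<Otimes>\<^sub>M restrict_space lborel {0..}) (\<lambda>(u, t). ennreal (q (t, u))))
         hyperplane_space (\<lambda>(u, t). hyperplane u t))"

lemma emeasure_hyperplane_measure:
  fixes q :: "real \<times> 'a::euclidean_space \<Rightarrow> real"
  assumes q: "q \<in> borel_measurable (restrict_space borel ({0..} \<times> sphere 0 1))"
    and A: "A \<in> sets hyperplane_space"
  shows "emeasure (hyperplane_measure q) A =
    ennreal (1 / (real DIM('a) * measure lborel (cball (0::'a) 1))) *
      (\<integral>\<^sup>+u. (\<integral>\<^sup>+t\<in>{0..}. indicator A (hyperplane u t) * ennreal (q (t, u)) \<partial>lborel) \<partial>sphere_measure)"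
proof -
  let ?M = "sphere_measure \<Otimes>\<^sub>M restrict_space lborel {0..} :: ('a \<times> real) measure"
  interpret L: sigma_finite_measure "restrict_space lborel {0::real..}"
    by (rule sigma_finite_measure_restrict_space) (auto intro: lborel.sigma_finite_measure_axioms)
  have qm: "(\<lambda>(u, t). q (t, u)) \<in> borel_measurable ?M"
  proof -
    have "(\<lambda>z. (snd z, fst z)) \<in> measurable ?M (restrict_space borel ({0..} \<times> sphere 0 1))"
    proof (rule measurable_restrict_space2)
      have "fst \<in> borel_measurable ?M"
        by (rule measurable_compose[OF measurable_fst])
           (auto simp: sphere_measure_def intro!: measurable_restrict_space1)
      moreover have "snd \<in> borel_measurable ?M"
        by (rule measurable_compose[OF measurable_snd]) (auto intro: measurable_restrict_space1)
      ultimately show "(\<lambda>z. (snd z, fst z)) \<in> borel_measurable ?M" by (intro borel_measurable_Pair)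
    qed (auto simp: space_pair_measure)
    from measurable_compose[OF this q] show ?thesis by (simp add: case_prod_beta)
  qed
  have pm: "(\<lambda>z. indicator A (hyperplane (fst z) (snd z)) * ennreal (q (snd z, fst z))) \<in> borel_measurable ?M"
    using qm measurable_compose[OF measurable_hyperplane borel_measurable_indicator[OF A]]
    by (intro borel_measurable_times_ennreal measurable_compose[OF _ measurable_ennreal])
       (simp_all add: case_prod_beta)
  have hm: "(\<lambda>(u, t). hyperplane u t) \<in> measurable (density ?M (\<lambda>(u, t). ennreal (q (t, u)))) hyperplane_space"
    using measurable_hyperplane by simp
  have "emeasure (distr (density ?M (\<lambda>(u, t). ennreal (q (t, u)))) hyperplane_space (\<lambda>(u, t). hyperplane u t)) A
      = (\<integral>\<^sup>+z. indicator A (hyperplane (fst z) (snd z)) * ennreal (q (snd z, fst z)) \<partial>?M)"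
    using qm measurable_sets[OF measurable_hyperplane A]
    by (subst emeasure_distr[OF hm A], subst emeasure_density)
       (auto intro!: nn_integral_cong simp: case_prod_beta indicator_def split: if_splits)
  also have "\<dots> = (\<integral>\<^sup>+u. (\<integral>\<^sup>+t. indicator A (hyperplane u t) * ennreal (q (t, u)) \<partial>restrict_space lborel {0..}) \<partial>sphere_measure)"
    using L.nn_integral_fst[OF pm] by simp
  finally show ?thesis
    unfolding hyperplane_measure_def by (simp add: emeasure_scale_measure nn_integral_restrict_space)
qed

definition admissible_hyperplanes :: "'a::euclidean_space set \<Rightarrow> 'a set set" where
  "admissible_hyperplanes K =
     {H \<in> space hyperplane_space. H \<inter> outer_parallel K \<noteq> {} \<and> H \<inter> interior K = {}}"

text \<open>If \<open>H\<close> does not meet the interior of the convex body \<open>K\<close>, exactly one closed half-space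
  bounded by \<open>H\<close> contains \<open>K\<close>. Writing it as an intersection assigns the whole space
  to the remaining hyperplanes, so that functionals of the random polyhedron stay
  measurable on the corresponding null event.\<close>

definition halfspace_containing :: "'a::euclidean_space set \<Rightarrow> 'a set \<Rightarrow> 'a set" where
  "halfspace_containing K H =
     \<Inter> {{y. a \<bullet> y \<le> b} | a b. a \<noteq> 0 \<and> H = {y. a \<bullet> y = b} \<and> K \<subseteq> {y. a \<bullet> y \<le> b}}"

definition random_polyhedron :: "'a::euclidean_space set \<Rightarrow> nat \<Rightarrow> (nat \<Rightarrow> 'a set) \<Rightarrow> 'a set" where
  "random_polyhedron K n H = (\<Inter>i<n. halfspace_containing K (H i))"

definition hyperplane_variance ::
    "(real \<times> 'a::euclidean_space \<Rightarrow> real) \<Rightarrow> nat \<Rightarrow> ((nat \<Rightarrow> 'a set) \<Rightarrow> real) \<Rightarrow> real" where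
  "hyperplane_variance q n X =
     prob_space.variance (Pi\<^sub>M {..<n} (\<lambda>_. hyperplane_measure q)) X"

section \<open>Local integrability\<close>

definition locally_integrable_density :: "(real \<times> 'a::euclidean_space \<Rightarrow> real) \<Rightarrow> bool" where
  "locally_integrable_density q \<longleftrightarrow>
     (\<forall>C. compact C \<and> C \<subseteq> {0..} \<longrightarrow>
        (\<integral>\<^sup>+u. (\<integral>\<^sup>+t\<in>C. ennreal (q (t, u)) \<partial>lborel) \<partial>sphere_measure) < \<infinity>)"

definition locally_integrable_weight :: "(real \<times> 'a::euclidean_space \<Rightarrow> real) \<Rightarrow> bool" where
  "locally_integrable_weight lam \<longleftrightarrow>
     (\<forall>M :: 'a set. convex_body M \<and> 0 \<in> interior M \<longrightarrow> weighted_volume lam M < \<infinity>)"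

end

theory Submission
  imports Defs
begin

text \<open>A point \<open>s v\<close> outside \<open>K\<close> (with \<open>v\<close> a unit vector) survives in \<open>K\<^sup>(\<^sup>n\<^sup>)\<close> iff none of the hyperplanes
  cuts it off.
  Writing the weighted volume as an integral over such points, its variance becomes a double integral
  over pairs \<open>z, z'\<close>, which is at most that of \<open>n j (1 - max m m')\<^sup>n\<^sup>-\<^sup>1\<close>; here \<open>m, m', j\<close> are the
  probabilities that one random hyperplane cuts off \<open>z\<close>, \<open>z'\<close>, or both. Let \<open>\<tau>\<close> be the radial distance of \<open>z\<close> from \<open>K\<close>.
  Since \<open>K\<close> slides freely in a ball, every support point of \<open>K\<close> has an enclosing ball of fixed radius touching there. This gives
  both \<open>m \<ge> c \<tau>\<^sup>p\<close> with \<open>p = (d + 1) / 2\<close>, and that a hyperplane cutting off two points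
  of radial distance at most \<open>\<tau>\<close> forces their directions to be within \<open>O(\<surd>\<tau>)\<close>, so that the points \<open>z'\<close> with
  \<open>j > 0\<close> that are not farther from \<open>K\<close> than \<open>z\<close> have measure \<open>O(\<tau>\<^sup>p)\<close>. As \<open>n m (1 - m)\<^sup>n\<^sup>-\<^sup>1 = O(exp (- n m / 2))\<close>, the variance is
  \<open>O(\<integral> \<tau>\<^sup>p exp (- c n \<tau>\<^sup>p) d\<tau>)\<close>, which is of order \<open>n\<close> to the power \<open>- (1 + 1 / p) = - (d + 3) / (d + 1)\<close>.\<close>

section \<open>Spherical caps\<close>

text \<open>One inequality carries the geometry: if \<open>x\<close> is the support point of
  \<open>K\<close> in direction \<open>u\<close>, then |y - x|^2 <= 2 R (h(u) - u.y) for all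
  \<open>y\<close> in \<open>K\<close>. Read directly, it keeps points whose support deficit is
  O(\<tau>) within O(sqrt \<tau>) of \<open>x\<close>; this yields the closeness of directions. Read
  dually, it says that \<open>h\<close> exceeds its supporting linear function at \<open>u0\<close>
  by at most (R/2) |u - u0|^2, so that normals within a small multiple of sqrt \<tau> of
  \<open>u0\<close> still cut. Both times a cap of radius of order sqrt \<tau> meets a layer of
  thickness of order \<tau>, and \<tau> * sqrt(\<tau>)^(d-1) = \<tau>^p.

  The obstacle is that pointwise control of \<open>q\<close> and \<open>lam\<close> is given only at
  the boundary of \<open>K\<close>. Compactness spreads it to a thin layer. Beyond the layer \<tau>
  is replaced by a fixed threshold: survival is then exponentially unlikely, and the finite weighted
  volume of \<open>outer_parallel K\<close> bounds the mass of such points. Since the measure on the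
  sphere is defined by coverings, the order of the measure of caps has to be established
  first.\<close>

text \<open>The volume of the cone over a cap of radius \<open>r\<close> is of order \<open>r\<close> to the power \<open>d - 1\<close>. Comparing the cone
  over a cap with the cones over the members of a covering bounds the Hausdorff measure of the cap from
  below; comparing it with the disjoint cones over a maximal separated set bounds it from above.\<close>

definition cap_cone :: "'a::euclidean_space \<Rightarrow> real \<Rightarrow> 'a set" where
  "cap_cone u r = {z. z \<noteq> 0 \<and> norm z \<le> 1 \<and> norm (z - norm z *\<^sub>R u) \<le> r * norm z}"

text \<open>Comparing with \<open>r * norm z\<close> instead of dividing by \<open>norm z\<close>
  keeps the condition closed. The apex is then removed from a compact set; without it, cones over
  disjoint caps are disjoint.\<close>

lemma cap_cone_lmeasurable [simp]: "cap_cone u r \<in> lmeasurable"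
proof -
  have "closed {z :: 'a. norm z \<le> 1 \<and> norm (z - norm z *\<^sub>R u) \<le> r * norm z}"
    by (intro closed_Collect_conj closed_Collect_le continuous_intros)
  moreover have "bounded {z :: 'a. norm z \<le> 1 \<and> norm (z - norm z *\<^sub>R u) \<le> r * norm z}"
    by (rule boundedI[of _ 1]) auto
  ultimately have "{z :: 'a. norm z \<le> 1 \<and> norm (z - norm z *\<^sub>R u) \<le> r * norm z} \<in> lmeasurable"
    by (intro lmeasurable_compact) (simp add: compact_eq_bounded_closed)
  then have "{z :: 'a. norm z \<le> 1 \<and> norm (z - norm z *\<^sub>R u) \<le> r * norm z} - {0} \<in> lmeasurable"
    by (rule fmeasurable_Diff) auto
  also have "{z :: 'a. norm z \<le> 1 \<and> norm (z - norm z *\<^sub>R u) \<le> r * norm z} - {0} = cap_cone u r"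
    by (auto simp: cap_cone_def)
  finally show ?thesis .
qed

lemma cap_cone_iff:
  assumes "z \<noteq> 0" "norm z \<le> 1"
  shows "z \<in> cap_cone u r \<longleftrightarrow> dist (z /\<^sub>R norm z) u \<le> r"
proof -
  have "z - norm z *\<^sub>R u = norm z *\<^sub>R (z /\<^sub>R norm z - u)"
    using assms by (simp add: algebra_simps)
  then have "norm (z - norm z *\<^sub>R u) = norm z * dist (z /\<^sub>R norm z) u"
    by (simp add: dist_norm)
  then show ?thesis using assms by (simp add: cap_cone_def mult.commute)
qed

text \<open>The cone stays within distance \<open>r\<close> of the segment from 0 to
  \<open>u\<close>, so about \<open>1 / r\<close> balls of radius \<open>2 * r\<close> with centres
  spaced \<open>r\<close> apart cover it. The range up to 3 leaves room for the enlarged caps of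
  radius \<open>r + \<delta> / 3\<close> that occur later with \<open>r \<le> 2\<close>.\<close>

lemma measure_cap_cone_upper:
  fixes u :: "'a::euclidean_space"
  assumes u: "norm u = 1" and r: "0 < r" "r \<le> 3"
  shows "measure lebesgue (cap_cone u r) \<le>
    4 * 2 ^ DIM('a) * unit_ball_vol DIM('a) * r ^ (DIM('a) - 1)"
proof -
  define N where "N = nat \<lfloor>1 / r\<rfloor>"
  have sub: "cap_cone u r \<subseteq> (\<Union>k\<le>N. cball ((real k * r) *\<^sub>R u) (2 * r))"
  proof
    fix z assume z: "z \<in> cap_cone u r"
    define k where "k = nat \<lfloor>norm z / r\<rfloor>"
    have k1: "real k \<le> norm z / r" "norm z / r < real k + 1"
      using r by (auto simp: k_def)
    have kN: "k \<le> N"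
      unfolding k_def N_def using z r by (intro nat_mono floor_mono divide_right_mono) (auto simp: cap_cone_def)
    have "\<bar>norm z - real k * r\<bar> \<le> r"
      using k1 r by (auto simp: field_simps abs_le_iff)
    moreover have "norm (norm z *\<^sub>R u - (real k * r) *\<^sub>R u) = \<bar>norm z - real k * r\<bar>"
      using u by (simp flip: scaleR_left_diff_distrib)
    moreover have "norm (z - norm z *\<^sub>R u) \<le> r"
    proof -
      have "r * norm z \<le> r * 1" using z r by (intro mult_left_mono) (auto simp: cap_cone_def)
      then show ?thesis using z by (auto simp: cap_cone_def)
    qed
    ultimately have "norm (z - (real k * r) *\<^sub>R u) \<le> 2 * r"
      using norm_triangle_ineq[of "z - norm z *\<^sub>R u" "norm z *\<^sub>R u - (real k * r) *\<^sub>R u"] by simp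
    then show "z \<in> (\<Union>k\<le>N. cball ((real k * r) *\<^sub>R u) (2 * r))"
      using kN by (auto simp: dist_norm norm_minus_commute intro!: bexI[of _ k])
  qed
  have "measure lebesgue (cap_cone u r) \<le> measure lebesgue (\<Union>k\<le>N. cball ((real k * r) *\<^sub>R u) (2 * r))"
    by (intro measure_mono_fmeasurable sub fmeasurableD[OF cap_cone_lmeasurable] lmeasurable_compact compact_UN) auto
  also have "\<dots> \<le> (\<Sum>k\<le>N. measure lebesgue (cball ((real k * r) *\<^sub>R u) (2 * r)))"
    by (intro measure_UNION_le) auto
  also have "\<dots> = (real N + 1) * (unit_ball_vol DIM('a) * (2 * r) ^ DIM('a))"
    using r by (simp add: content_cball)
  also have "\<dots> \<le> (4 / r) * (unit_ball_vol DIM('a) * (2 * r) ^ DIM('a))"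
  proof (rule mult_right_mono)
    have "real N \<le> 1 / r" using r by (simp add: N_def)
    also have "1 / r + 1 \<le> 4 / r" using r by (simp add: field_simps)
    finally show "real N + 1 \<le> 4 / r" by simp
  qed (use r in auto)
  also have "\<dots> = 4 * 2 ^ DIM('a) * unit_ball_vol DIM('a) * r ^ (DIM('a) - 1)"
    using r by (simp add: power_mult_distrib power_eq_if[of r "DIM('a)"])
  finally show ?thesis .
qed

lemma measure_cap_cone_lower:
  fixes u :: "'a::euclidean_space"
  assumes u: "norm u = 1" and r: "0 < r" "r \<le> 1"
  shows "unit_ball_vol DIM('a) / (2 * 8 ^ DIM('a)) * r ^ (DIM('a) - 1) \<le> measure lebesgue (cap_cone u r)"
proof -
  define N where "N = nat \<lfloor>1 / r\<rfloor>"
  have N: "real N \<le> 1 / r" "1 / (2 * r) \<le> real N"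
  proof -
    show "real N \<le> 1 / r" using r by (simp add: N_def)
    have "1 \<le> N" using r by (simp add: N_def le_nat_iff)
    then have "1 \<le> real N" by simp
    moreover have "1 / r < real N + 1" using r by (simp add: N_def)
    moreover have "1 / (2 * r) = 1 / r / 2" by simp
    ultimately show "1 / (2 * r) \<le> real N" by linarith
  qed
  \<comment> \<open>The centres run from 1/2 to at most 3/4 along \<open>u\<close>: inside the unit
    ball, yet far enough from the apex for the cone to contain balls of radius \<open>r / 8\<close>.
    The spacing \<open>r / 4\<close> is twice that radius and makes the balls disjoint.\<close>
  define c where "c = (\<lambda>k::nat. (1 / 2 + r / 4 * real k) *\<^sub>R u)"
  have sub: "(\<Union>k<N. ball (c k) (r / 8)) \<subseteq> cap_cone u r"
  proof safe
    fix k z assume k: "k < N" and z: "z \<in> ball (c k) (r / 8)"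
    let ?s = "1 / 2 + r / 4 * real k"
    have "real k + 1 \<le> 1 / r" using k N by linarith
    then have s: "1 / 2 \<le> ?s" "?s \<le> 3 / 4" using r by (simp_all add: field_simps)
    have d: "norm (z - ?s *\<^sub>R u) < r / 8"
      using z by (simp add: c_def dist_norm norm_minus_commute)
    have "norm (?s *\<^sub>R u) = ?s" using u s r by simp
    then have ns: "\<bar>norm z - ?s\<bar> < r / 8"
      using d norm_triangle_ineq3[of z "?s *\<^sub>R u"] by linarith
    have nz: "3 / 8 \<le> norm z" "norm z \<le> 1" using ns s r by linarith+
    have "norm (z - norm z *\<^sub>R u) \<le> norm (z - ?s *\<^sub>R u) + norm (?s *\<^sub>R u - norm z *\<^sub>R u)"
      using norm_triangle_ineq[of "z - ?s *\<^sub>R u" "?s *\<^sub>R u - norm z *\<^sub>R u"] by simp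
    also have "norm (?s *\<^sub>R u - norm z *\<^sub>R u) = \<bar>norm z - ?s\<bar>"
      using u by (simp add: abs_minus_commute flip: scaleR_left_diff_distrib)
    also have "norm (z - ?s *\<^sub>R u) + \<bar>norm z - ?s\<bar> \<le> r * (3 / 8)" using d ns r by linarith
    also have "\<dots> \<le> r * norm z" using nz r by (intro mult_left_mono) auto
    finally show "z \<in> cap_cone u r" using nz by (auto simp: cap_cone_def)
  qed
  have disj: "disjoint_family_on (\<lambda>k. ball (c k) (r / 8)) {..<N}"
  unfolding disjoint_family_on_def
  proof (intro ballI impI)
    fix i j :: nat assume "i \<noteq> j"
    have "c i - c j = (r / 4 * (real i - real j)) *\<^sub>R u"
      by (simp add: c_def right_diff_distrib flip: scaleR_left_diff_distrib)
    then have "dist (c i) (c j) = r / 4 * \<bar>real i - real j\<bar>"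
      using u r by (simp add: dist_norm abs_mult)
    also have "\<dots> \<ge> r / 4 * 1" using \<open>i \<noteq> j\<close> r by (intro mult_left_mono) auto
    finally have "r / 8 + r / 8 \<le> dist (c i) (c j)" by simp
    then show "ball (c i) (r / 8) \<inter> ball (c j) (r / 8) = {}" by (simp add: disjoint_ballI)
  qed
  have fin: "emeasure lebesgue (ball (c k) (r / 8)) \<noteq> \<infinity>" for k
    using emeasure_lborel_ball_finite[of "c k" "r / 8"] by auto
  have "unit_ball_vol DIM('a) / (2 * 8 ^ DIM('a)) * r ^ (DIM('a) - 1) =
      1 / (2 * r) * (unit_ball_vol DIM('a) * (r / 8) ^ DIM('a))"
    using r by (simp add: power_divide power_eq_if[of r "DIM('a)"])
  also have "\<dots> \<le> real N * (unit_ball_vol DIM('a) * (r / 8) ^ DIM('a))"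
    using N r by (intro mult_right_mono) auto
  also have "\<dots> = (\<Sum>k<N. measure lebesgue (ball (c k) (r / 8)))"
    using r by (simp add: content_ball)
  also have "\<dots> = measure lebesgue (\<Union>k<N. ball (c k) (r / 8))"
    by (intro measure_finite_Union[symmetric] disj fin) auto
  also have "\<dots> \<le> measure lebesgue (cap_cone u r)"
    by (intro measure_mono_fmeasurable sub) (auto intro!: sets.finite_UN)
  finally show ?thesis .
qed

section \<open>From cone volumes to the Hausdorff measure of caps\<close>

definition sphere_cap :: "'a::euclidean_space \<Rightarrow> real \<Rightarrow> 'a set" where
  "sphere_cap u r = sphere 0 1 \<inter> cball u r"

lemma sphere_cap_sets [measurable]: "sphere_cap u r \<in> sets sphere_measure"
  unfolding sets_sphere_measure sets_restrict_space sphere_cap_def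
  by (intro image_eqI[of _ _ "cball u r"]) auto

lemma emeasure_sphere_cap:
  "emeasure sphere_measure (sphere_cap (u :: 'a::euclidean_space) r) = hausdorff_outer (DIM('a) - 1) (sphere_cap u r)"
  unfolding sphere_measure_def
  by (subst emeasure_restrict_space) (auto simp: sphere_cap_def emeasure_hausdorff_measure)

lemma measure_cap_cone_upper_ge0:
  fixes u :: "'a::euclidean_space"
  assumes d: "DIM('a) \<ge> 2" and u: "norm u = 1" and r: "0 \<le> r" "r \<le> 3"
  shows "measure lebesgue (cap_cone u r) \<le>
    4 * 2 ^ DIM('a) * unit_ball_vol DIM('a) * r ^ (DIM('a) - 1)"
proof (cases "r = 0")
  case True
  have "measure lebesgue (cap_cone u 0) \<le> 4 * 2 ^ DIM('a) * unit_ball_vol DIM('a) * 0 ^ (DIM('a) - 1)"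
  proof (rule tendsto_lowerbound[of "\<lambda>r. 4 * 2 ^ DIM('a) * unit_ball_vol DIM('a) * r ^ (DIM('a) - 1)" _ "at_right 0"])
    show "((\<lambda>r::real. 4 * 2 ^ DIM('a) * unit_ball_vol DIM('a) * r ^ (DIM('a) - 1)) \<longlongrightarrow>
        4 * 2 ^ DIM('a) * unit_ball_vol DIM('a) * 0 ^ (DIM('a) - 1)) (at_right 0)"
      by (intro tendsto_intros)
    have "\<forall>\<^sub>F r::real in at_right 0. 0 < r \<and> r < 3"
      by (intro eventually_conj eventually_at_right_less eventually_at_rightI[of 0 3]) auto
    then show "\<forall>\<^sub>F r in at_right 0. measure lebesgue (cap_cone u 0) \<le>
        4 * 2 ^ DIM('a) * unit_ball_vol DIM('a) * r ^ (DIM('a) - 1)"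
    proof eventually_elim
      case (elim r)
      have "measure lebesgue (cap_cone u 0) \<le> measure lebesgue (cap_cone u r)"
        using elim by (intro measure_mono_fmeasurable fmeasurableD[OF cap_cone_lmeasurable] cap_cone_lmeasurable)
            (auto simp: cap_cone_def)
      also have "\<dots> \<le> 4 * 2 ^ DIM('a) * unit_ball_vol DIM('a) * r ^ (DIM('a) - 1)"
        using elim u by (intro measure_cap_cone_upper) auto
      finally show ?case .
    qed
  qed simp
  then show ?thesis using True by simp
qed (use assms measure_cap_cone_upper[of u r] in auto)

lemma emeasure_sphere_cap_lower:
  fixes u :: "'a::euclidean_space"
  assumes d: "DIM('a) \<ge> 2"
  obtains c where "c > 0"
    "\<And>(u::'a) r. norm u = 1 \<Longrightarrow> 0 < r \<Longrightarrow> r \<le> 1 \<Longrightarrow>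
      ennreal (c * r ^ (DIM('a) - 1)) \<le> emeasure sphere_measure (sphere_cap u r)"
proof -
  let ?k = "DIM('a) - 1"
  define C where "C = 4 * 2 ^ DIM('a) * unit_ball_vol (real DIM('a))"
  define b where "b = unit_ball_vol (real DIM('a)) / (2 * 8 ^ DIM('a))"
  \<comment> \<open>Converts cone volume into Hausdorff weight: \<open>C * x ^ ?k\<close> is
    \<open>a\<close> times the weight of a set of diameter \<open>x\<close>.\<close>
  define a where "a = C * 2 ^ ?k / unit_ball_vol (real ?k)"
  have pos: "C > 0" "b > 0" "a > 0" by (auto simp: C_def b_def a_def)
  have "ennreal (b / a * r ^ ?k) \<le> emeasure sphere_measure (sphere_cap u r)"
    if u: "norm u = 1" and r: "0 < r" "r \<le> 1" for u :: 'a and r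
  proof -
    \<comment> \<open>Mesh 1 suffices because \<open>hausdorff_outer\<close> is a supremum over all
      meshes, and it keeps the radii of the cones within the range of the volume bound.\<close>
    have "ennreal (b / a * r ^ ?k) \<le> hausdorff_pre ?k 1 (sphere_cap u r)"
      unfolding hausdorff_pre_def
    proof (rule INF_greatest, clarify)
      fix D :: "nat \<Rightarrow> 'a set"
      assume cov: "sphere_cap u r \<subseteq> (\<Union>i. D i)" and D: "\<forall>i. bounded (D i) \<and> diameter (D i) \<le> 1"
      \<comment> \<open>The cone belonging to \<open>D i\<close> is centred at a point of
        \<open>D i\<close> on the sphere, so that the radius \<open>diameter (D i)\<close> reaches
        all the rest. A set that misses the sphere covers nothing and gets the empty cone.\<close>
      define y where "y = (\<lambda>i. SOME y. y \<in> D i \<inter> sphere 0 1)"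
      define E where "E = (\<lambda>i. if D i \<inter> sphere 0 1 = {} then {} else cap_cone (y i) (diameter (D i)))"
      have y: "y i \<in> D i" "norm (y i) = 1" if "D i \<inter> sphere 0 1 \<noteq> {}" for i
        using some_in_eq[of "D i \<inter> sphere 0 1"] that unfolding y_def by auto
      have sub: "cap_cone u r \<subseteq> (\<Union>i. E i)"
      proof
        fix z assume z: "z \<in> cap_cone u r"
        then have z0: "z \<noteq> 0" "norm z \<le> 1" by (auto simp: cap_cone_def)
        let ?z = "z /\<^sub>R norm z"
        have "?z \<in> sphere_cap u r"
          using z z0 cap_cone_iff[OF z0] by (auto simp: sphere_cap_def dist_commute)
        then obtain i where i: "?z \<in> D i" using cov by blast
        then have ne: "D i \<inter> sphere 0 1 \<noteq> {}" using z0 by force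
        have "dist ?z (y i) \<le> diameter (D i)"
          using i y(1)[OF ne] D by (intro diameter_bounded_bound) auto
        then have "z \<in> E i" using ne z0 by (simp add: E_def cap_cone_iff)
        then show "z \<in> (\<Union>i. E i)" by blast
      qed
      have Em: "E i \<in> sets lebesgue" for i by (auto simp: E_def fmeasurableD)
      have Ei: "emeasure lebesgue (E i) \<le> ennreal a * hausdorff_weight ?k (D i)" for i
      proof (cases "D i \<inter> sphere 0 1 = {}")
        case False
        then have "D i \<noteq> {}" by auto
        have "emeasure lebesgue (E i) = ennreal (measure lebesgue (cap_cone (y i) (diameter (D i))))"
          using False by (simp add: E_def emeasure_eq_measure2 fmeasurableD2)
        also have "\<dots> \<le> ennreal (C * diameter (D i) ^ ?k)"
          unfolding C_def using y[OF False] D[rule_format, of i] d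
          by (intro ennreal_leI measure_cap_cone_upper_ge0) (auto simp: diameter_ge_0)
        also have "C * diameter (D i) ^ ?k = a * (unit_ball_vol (real ?k) * (diameter (D i) / 2) ^ ?k)"
        proof -
          have eq: "C * x ^ ?k = C * 2 ^ ?k / w * (w * (x / 2) ^ ?k)" if "0 < w" for w x :: real
            using that by (simp add: power_divide)
          then show ?thesis unfolding a_def by (intro eq) simp
        qed
        finally show ?thesis
          using \<open>D i \<noteq> {}\<close> pos D by (simp add: hausdorff_weight_def ennreal_mult diameter_ge_0)
      qed (simp add: E_def)
      have "ennreal (b * r ^ ?k) \<le> ennreal (measure lebesgue (cap_cone u r))"
        unfolding b_def using u r by (intro ennreal_leI measure_cap_cone_lower) auto
      also have "\<dots> = emeasure lebesgue (cap_cone u r)"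
        by (simp add: emeasure_eq_measure2 fmeasurableD2)
      also have "\<dots> \<le> emeasure lebesgue (\<Union>i. E i)"
        using Em by (intro emeasure_mono sub) auto
      also have "\<dots> \<le> (\<Sum>i. emeasure lebesgue (E i))"
        using Em by (intro emeasure_subadditive_countably) auto
      also have "\<dots> \<le> (\<Sum>i. ennreal a * hausdorff_weight ?k (D i))"
        by (intro suminf_le Ei) auto
      also have "\<dots> = ennreal a * (\<Sum>i. hausdorff_weight ?k (D i))" by simp
      finally have "ennreal (1 / a) * ennreal (b * r ^ ?k) \<le>
          ennreal (1 / a) * (ennreal a * (\<Sum>i. hausdorff_weight ?k (D i)))"
        by (intro mult_left_mono) auto
      then show "ennreal (b / a * r ^ ?k) \<le> (\<Sum>i. hausdorff_weight ?k (D i))"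
        using pos r by (simp flip: ennreal_mult ennreal_mult' mult.assoc)
    qed
    also have "\<dots> \<le> hausdorff_outer ?k (sphere_cap u r)"
      unfolding hausdorff_outer_def by (intro SUP_upper) auto
    finally show ?thesis by (simp add: emeasure_sphere_cap)
  qed
  then show ?thesis using pos by (intro that[of "b / a"]) auto
qed

text \<open>Bounded cardinalities give a separated set of largest cardinality; a point outside all
  its balls could be added to it.\<close>

lemma ex_maximal_separated_subset:
  fixes S :: "'a::metric_space set"
  assumes "0 \<le> \<delta>"
  assumes bd: "\<And>T. finite T \<Longrightarrow> T \<subseteq> S \<Longrightarrow> (\<And>x y. x \<in> T \<Longrightarrow> y \<in> T \<Longrightarrow> x \<noteq> y \<Longrightarrow> \<delta> < dist x y) \<Longrightarrow> real (card T) \<le> b"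
  obtains T where "finite T" "T \<subseteq> S" "S \<subseteq> (\<Union>y\<in>T. cball y \<delta>)" "real (card T) \<le> b"
proof -
  define Q where "Q = (\<lambda>T. finite T \<and> T \<subseteq> S \<and> (\<forall>x\<in>T. \<forall>y\<in>T. x \<noteq> y \<longrightarrow> \<delta> < dist x y))"
  have "Q {}" by (simp add: Q_def)
  moreover have bdQ: "real (card T) \<le> b" if "Q T" for T using that bd[of T] by (auto simp: Q_def)
  then have "\<forall>T. Q T \<longrightarrow> card T < Suc (nat \<lfloor>b\<rfloor>)"
    by (auto simp: less_Suc_eq_le le_nat_floor)
  ultimately obtain T where T: "Q T" "\<And>T'. Q T' \<Longrightarrow> card T' \<le> card T"
    using ex_has_greatest_nat[of Q "{}" card "Suc (nat \<lfloor>b\<rfloor>)"] by (metis less_imp_le)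
  have "S \<subseteq> (\<Union>y\<in>T. cball y \<delta>)"
  proof (rule ccontr)
    assume "\<not> ?thesis"
    then obtain x where x: "x \<in> S" "\<forall>y\<in>T. \<delta> < dist y x" by force
    show False
    proof (cases "x \<in> T")
      case True
      then show False using x assms(1) by force
    next
      case False
      then have "Q (insert x T)" using x T(1) by (auto simp: Q_def dist_commute)
      from T(2)[OF this] False T(1) show False by (simp add: Q_def)
    qed
  qed
  then show ?thesis using that T bdQ by (auto simp: Q_def)
qed

lemma emeasure_sphere_cap_upper:
  assumes d: "DIM('a::euclidean_space) \<ge> 2"
  obtains C where "C > 0"
    "\<And>(u::'a) r. norm u = 1 \<Longrightarrow> 0 < r \<Longrightarrow>
      emeasure sphere_measure (sphere_cap u r) \<le> ennreal (C * r ^ (DIM('a) - 1))"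
proof -
  let ?k = "DIM('a) - 1"
  define C where "C = 4 * 2 ^ DIM('a) * unit_ball_vol (real DIM('a))"
  define b where "b = unit_ball_vol (real DIM('a)) / (2 * 8 ^ DIM('a))"
  \<comment> \<open>\<open>C * 6 ^ ?k / b\<close> is the packing constant: the volume of a cone of
    radius at most \<open>2 * r\<close> against that of cones of radius \<open>\<delta> / 3\<close>.
    The last factor is the weight of a ball of radius \<delta> divided by
    \<open>\<delta> ^ ?k\<close>, so that \<delta> cancels.\<close>
  define A where "A = C * 6 ^ ?k / b * unit_ball_vol (real ?k)"
  have pos: "C > 0" "b > 0" "A > 0"
    using unit_ball_vol_pos[of "real DIM('a)"] unit_ball_vol_pos[of "real ?k"]
    by (auto simp: C_def b_def A_def simp del: unit_ball_vol_pos)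
  have small: "emeasure sphere_measure (sphere_cap u r) \<le> ennreal (A * r ^ ?k)"
    if u: "norm u = 1" and r: "0 < r" "r \<le> 2" for u :: 'a and r
  proof -
    have pre: "hausdorff_pre ?k (2 * \<delta>) (sphere_cap u r) \<le> ennreal (A * r ^ ?k)"
      if \<delta>: "0 < \<delta>" "\<delta> \<le> 1" "\<delta> \<le> r" for \<delta>
    proof -
      obtain T where T: "finite T" "T \<subseteq> sphere_cap u r" "sphere_cap u r \<subseteq> (\<Union>y\<in>T. cball y \<delta>)"
        "real (card T) \<le> C * 6 ^ ?k / b * (r / \<delta>) ^ ?k"
      proof (rule ex_maximal_separated_subset[of \<delta> "sphere_cap u r" "C * 6 ^ ?k / b * (r / \<delta>) ^ ?k"])
        fix T :: "'a set"
        assume T: "finite T" "T \<subseteq> sphere_cap u r" "\<And>x y. x \<in> T \<Longrightarrow> y \<in> T \<Longrightarrow> x \<noteq> y \<Longrightarrow> \<delta> < dist x y"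
        have disj: "disjoint_family_on (\<lambda>y. cap_cone y (\<delta> / 3)) T"
          unfolding disjoint_family_on_def
        proof (intro ballI impI equals0I)
          fix x y z assume xy: "x \<in> T" "y \<in> T" "x \<noteq> y" and z: "z \<in> cap_cone x (\<delta> / 3) \<inter> cap_cone y (\<delta> / 3)"
          then have "z \<noteq> 0" "norm z \<le> 1" by (auto simp: cap_cone_def)
          with z have "dist (z /\<^sub>R norm z) x \<le> \<delta> / 3" "dist (z /\<^sub>R norm z) y \<le> \<delta> / 3"
            by (auto simp: cap_cone_iff)
          then have "dist x y \<le> \<delta> / 3 + \<delta> / 3"
            using dist_triangle3[of x y "z /\<^sub>R norm z"] by linarith
          then show False using T(3)[OF xy] \<delta> by simp
        qed
        have sub: "(\<Union>y\<in>T. cap_cone y (\<delta> / 3)) \<subseteq> cap_cone u (r + \<delta> / 3)"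
        proof safe
          fix y z assume y: "y \<in> T" and z: "z \<in> cap_cone y (\<delta> / 3)"
          then have z0: "z \<noteq> 0" "norm z \<le> 1" by (auto simp: cap_cone_def)
          have "dist (z /\<^sub>R norm z) u \<le> dist (z /\<^sub>R norm z) y + dist y u" by (rule dist_triangle)
          also have "\<dots> \<le> \<delta> / 3 + r"
            using y T(2) z cap_cone_iff[OF z0] by (intro add_mono) (auto simp: sphere_cap_def dist_commute)
          finally show "z \<in> cap_cone u (r + \<delta> / 3)" using z0 by (simp add: cap_cone_iff add.commute)
        qed
        have "real (card T) * (b * (\<delta> / 3) ^ ?k) = (\<Sum>y\<in>T. b * (\<delta> / 3) ^ ?k)" by simp
        also have "\<dots> \<le> (\<Sum>y\<in>T. measure lebesgue (cap_cone y (\<delta> / 3)))"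
          unfolding b_def using T(2) \<delta>
          by (intro sum_mono measure_cap_cone_lower) (auto simp: sphere_cap_def)
        also have "\<dots> = measure lebesgue (\<Union>y\<in>T. cap_cone y (\<delta> / 3))"
          unfolding infinity_ennreal_def
          by (intro measure_finite_Union[symmetric, unfolded infinity_ennreal_def] T disj
              fmeasurableD2[OF cap_cone_lmeasurable] image_subsetI fmeasurableD[OF cap_cone_lmeasurable])
        also have "\<dots> \<le> measure lebesgue (cap_cone u (r + \<delta> / 3))"
          using T(1) by (intro measure_mono_fmeasurable sub cap_cone_lmeasurable sets.finite_UN fmeasurableD[OF cap_cone_lmeasurable])
        also have "\<dots> \<le> C * (r + \<delta> / 3) ^ ?k"
          unfolding C_def using u r \<delta> by (intro measure_cap_cone_upper) auto
        also have "\<dots> \<le> C * (2 * r) ^ ?k"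
          using r \<delta> pos by (intro mult_left_mono power_mono) auto
        finally have "real (card T) \<le> C * (2 * r) ^ ?k / (b * (\<delta> / 3) ^ ?k)"
          using pos \<delta> by (simp add: pos_le_divide_eq)
        also have "(2 * r) ^ ?k = (6 * (r / \<delta>) * (\<delta> / 3)) ^ ?k"
          using \<delta> by simp
        also have "C * (6 * (r / \<delta>) * (\<delta> / 3)) ^ ?k / (b * (\<delta> / 3) ^ ?k) = C * 6 ^ ?k / b * (r / \<delta>) ^ ?k"
          unfolding power_mult_distrib using \<delta> by simp
        finally show "real (card T) \<le> C * 6 ^ ?k / b * (r / \<delta>) ^ ?k" .
      qed (use \<delta> in auto)
      obtain f where f: "bij_betw f {..<card T} T"
        using ex_bij_betw_nat_finite[OF T(1)] by (auto simp: atLeast0LessThan)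
      define D where "D = (\<lambda>i. if i < card T then cball (f i) \<delta> else {})"
      have "sphere_cap u r \<subseteq> (\<Union>i. D i)"
      proof
        fix x assume "x \<in> sphere_cap u r"
        then have "x \<in> (\<Union>y\<in>f ` {..<card T}. cball y \<delta>)"
          using T(3) unfolding bij_betw_imp_surj_on[OF f] by (rule subsetD[rotated])
        then obtain i where "i < card T" "x \<in> cball (f i) \<delta>" by auto
        then have "x \<in> D i" by (simp add: D_def)
        then show "x \<in> (\<Union>i. D i)" by blast
      qed
      then have "hausdorff_pre ?k (2 * \<delta>) (sphere_cap u r) \<le> (\<Sum>i. hausdorff_weight ?k (D i))"
        using \<delta> by (intro hausdorff_pre_le) (auto simp: D_def)
      also have "\<dots> = (\<Sum>i<card T. hausdorff_weight ?k (D i))"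
        by (intro suminf_finite) (auto simp: D_def hausdorff_weight_def)
      also have "\<dots> = (\<Sum>i<card T. ennreal (unit_ball_vol (real ?k) * \<delta> ^ ?k))"
        using \<delta> by (intro sum.cong) (auto simp: D_def hausdorff_weight_def)
      also have "\<dots> = ennreal (real (card T) * (unit_ball_vol (real ?k) * \<delta> ^ ?k))"
        using \<delta> by (simp add: ennreal_mult ennreal_of_nat_eq_real_of_nat)
      also have "\<dots> \<le> ennreal ((C * 6 ^ ?k / b * (r / \<delta>) ^ ?k) * (unit_ball_vol (real ?k) * \<delta> ^ ?k))"
        using \<delta> T(4) by (intro ennreal_leI mult_right_mono) auto
      also have "(C * 6 ^ ?k / b * (r / \<delta>) ^ ?k) * (unit_ball_vol (real ?k) * \<delta> ^ ?k) = A * r ^ ?k"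
        using \<delta> by (simp add: A_def power_divide)
      finally show ?thesis .
    qed
    have "hausdorff_outer ?k (sphere_cap u r) \<le> ennreal (A * r ^ ?k)"
      unfolding hausdorff_outer_def
    proof (rule SUP_least)
      fix \<epsilon> :: real assume "\<epsilon> \<in> {0<..}"
      \<comment> \<open>A ball of radius \<delta> has diameter \<open>2 * \<delta>\<close>, hence
        half the mesh.\<close>
      then show "hausdorff_pre ?k \<epsilon> (sphere_cap u r) \<le> ennreal (A * r ^ ?k)"
        using r pre[of "min (min 1 r) (\<epsilon> / 2)"]
        by (intro order_trans[OF hausdorff_pre_antimono pre[of "min (min 1 r) (\<epsilon> / 2)"]]) auto
    qed
    then show ?thesis by (simp add: emeasure_sphere_cap)
  qed
  show ?thesis
  proof (rule that[OF pos(3)])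
    fix u :: 'a and r :: real assume u: "norm u = 1" and r: "0 < r"
    \<comment> \<open>Distances on the unit sphere are at most 2, so radii beyond 2 do not enlarge
      the cap.\<close>
    have "norm (u - x) \<le> 2" if "norm x = 1" for x
      using norm_triangle_ineq4[of u x] u that by simp
    then have "sphere_cap u r \<subseteq> sphere_cap u (min r 2)"
      unfolding sphere_cap_def by (auto simp: dist_norm)
    then have "emeasure sphere_measure (sphere_cap u r) \<le> emeasure sphere_measure (sphere_cap u (min r 2))"
      by (intro emeasure_mono sphere_cap_sets)
    also have "\<dots> \<le> ennreal (A * min r 2 ^ ?k)" using u r by (intro small) auto
    also have "\<dots> \<le> ennreal (A * r ^ ?k)" using pos r by (intro ennreal_leI mult_left_mono power_mono) auto
    finally show "emeasure sphere_measure (sphere_cap u r) \<le> ennreal (A * r ^ ?k)" .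
  qed
qed

lemma finite_measure_sphere_measure:
  assumes "DIM('a::euclidean_space) \<ge> 2"
  shows "finite_measure (sphere_measure :: 'a measure)"
proof
  obtain C where "C > 0" and C: "\<And>(u::'a) r. norm u = 1 \<Longrightarrow> 0 < r \<Longrightarrow>
      emeasure sphere_measure (sphere_cap u r) \<le> ennreal (C * r ^ (DIM('a) - 1))"
    using emeasure_sphere_cap_upper[OF assms] by blast
  obtain u :: 'a where u: "norm u = 1" using norm_Basis SOME_Basis by blast
  have "norm (u - x) \<le> 2" if "norm x = 1" for x
    using norm_triangle_ineq4[of u x] u that by simp
  then have "sphere_cap u 2 = space sphere_measure"
    unfolding sphere_cap_def by (auto simp: dist_norm)
  then show "emeasure (sphere_measure :: 'a measure) (space sphere_measure) \<noteq> \<infinity>"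
    using C[OF u, of 2] by (auto simp: top_unique)
qed

section \<open>The variance of the measure of the points that are not hit\<close>

lemma power_diff_le_mult:
  fixes x y :: real
  assumes "0 \<le> y" "y \<le> x" "x \<le> c"
  shows "x ^ n - y ^ n \<le> real n * (x - y) * c ^ (n - 1)"
proof (cases "n = 0")
  case False
  have "x ^ n - y ^ n = (x - y) * (\<Sum>i<n. y ^ (n - Suc i) * x ^ i)"
    by (rule power_diff_sumr2)
  also have "\<dots> \<le> (x - y) * (\<Sum>i<n. c ^ (n - 1))"
  proof (intro mult_left_mono sum_mono)
    fix i assume i: "i \<in> {..<n}"
    have "y ^ (n - Suc i) * x ^ i \<le> c ^ (n - Suc i) * c ^ i"
      using assms by (intro mult_mono power_mono) auto
    also have "\<dots> = c ^ (n - 1)" using i by (simp flip: power_add)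
    finally show "y ^ (n - Suc i) * x ^ i \<le> c ^ (n - 1)" .
  qed (use assms in auto)
  finally show ?thesis by (simp add: mult_ac)
qed simp

text \<open>Expanding the square of \<open>X\<close> as a double integral turns the variance into a double integral of
  \<open>(1 - a - b + j) ^ n - (1 - a) ^ n * (1 - b) ^ n\<close>, where \<open>a\<close>, \<open>b\<close> are the probabilities of \<open>z\<close>, \<open>z'\<close>
  being hit and \<open>j\<close> that of both being hit. This replaces the Efron-Stein inequality.\<close>

lemma variance_measure_not_hit_le:
  fixes P :: "'p measure" and \<nu> :: "'z measure" and B :: "('p \<times> 'z) set" and n :: nat
  defines "X \<equiv> (\<lambda>\<omega>. measure \<nu> {z \<in> space \<nu>. \<forall>i<n. (\<omega> i, z) \<notin> B})"
  defines "m \<equiv> (\<lambda>z. measure P {p \<in> space P. (p, z) \<in> B})"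
  defines "j \<equiv> (\<lambda>z z'. measure P {p \<in> space P. (p, z) \<in> B \<and> (p, z') \<in> B})"
  assumes P: "prob_space P" and \<nu>: "finite_measure \<nu>" and B[measurable]: "B \<in> sets (P \<Otimes>\<^sub>M \<nu>)"
  shows "X \<in> borel_measurable (Pi\<^sub>M {..<n} (\<lambda>_. P))"
    and "ennreal (prob_space.variance (Pi\<^sub>M {..<n} (\<lambda>_. P)) X) \<le>
      (\<integral>\<^sup>+z. \<integral>\<^sup>+z'. ennreal (real n * j z z' * (1 - max (m z) (m z')) ^ (n - 1)) \<partial>\<nu> \<partial>\<nu>)"
proof -
  interpret P: prob_space P by fact
  interpret nu: finite_measure \<nu> by fact
  let ?\<Pi> = "Pi\<^sub>M {..<n} (\<lambda>_. P)"
  interpret PP: product_sigma_finite "\<lambda>_::nat. P"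
    by (intro product_sigma_finite.intro P.sigma_finite_measure_axioms)
  interpret Pi: prob_space ?\<Pi> by (intro prob_space_PiM P)
  interpret pr: pair_sigma_finite ?\<Pi> \<nu>
    by (intro pair_sigma_finite.intro Pi.sigma_finite_measure_axioms nu.sigma_finite_measure_axioms)
  \<comment> \<open>With values in \<open>ennreal\<close>, every exchange of integrals below is an
    instance of Tonelli without integrability conditions.\<close>
  define ok where "ok = (\<lambda>p z. indicator (space (P \<Otimes>\<^sub>M \<nu>) - B) (p, z) :: ennreal)"
  have ok[measurable]: "(\<lambda>(p, z). ok p z) \<in> borel_measurable (P \<Otimes>\<^sub>M \<nu>)"
    unfolding ok_def case_prod_eta by measurable
  have m_eq: "(\<integral>\<^sup>+p. ok p z \<partial>P) = ennreal (1 - m z)" if z: "z \<in> space \<nu>" for z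
  proof -
    have [measurable]: "{p \<in> space P. (p, z) \<in> B} \<in> sets P" using z by measurable
    have "(\<integral>\<^sup>+p. ok p z \<partial>P) = (\<integral>\<^sup>+p. indicator (space P - {p \<in> space P. (p, z) \<in> B}) p \<partial>P)"
      using z by (intro nn_integral_cong) (auto simp: ok_def space_pair_measure split: split_indicator)
    also have "\<dots> = ennreal (measure P (space P - {p \<in> space P. (p, z) \<in> B}))"
      by (simp add: P.emeasure_eq_measure)
    also have "\<dots> = ennreal (1 - m z)" by (simp add: P.prob_compl m_def)
    finally show ?thesis .
  qed
  have un_eq: "measure P ({p \<in> space P. (p, z) \<in> B} \<union> {p \<in> space P. (p, z') \<in> B}) = m z + m z' - j z z'"
    (is "measure P (?A \<union> ?B) = _")
    if [measurable]: "z \<in> space \<nu>" "z' \<in> space \<nu>" for z z'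
  proof -
    have [measurable]: "?A \<in> sets P" "?B \<in> sets P" by measurable
    have "measure P (?A \<union> ?B) = m z + m z' - measure P (?A \<inter> ?B)"
      unfolding m_def by (intro measure_Un3) (auto simp: P.emeasure_eq_measure fmeasurableI)
    also have "?A \<inter> ?B = {p \<in> space P. (p, z) \<in> B \<and> (p, z') \<in> B}" by auto
    finally show ?thesis by (simp add: j_def)
  qed
  have bounds: "0 \<le> j z z'" "j z z' \<le> m z" "j z z' \<le> m z'" "m z + m z' - j z z' \<le> 1"
    if [measurable]: "z \<in> space \<nu>" "z' \<in> space \<nu>" for z z'
  proof -
    show "m z + m z' - j z z' \<le> 1" by (subst un_eq[symmetric]) (use that in simp_all)
    show "j z z' \<le> m z" "j z z' \<le> m z'"
      unfolding m_def j_def by (auto intro!: P.finite_measure_mono)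
  qed (simp add: j_def)
  have j_eq: "(\<integral>\<^sup>+p. ok p z * ok p z' \<partial>P) = ennreal (1 - (m z + m z' - j z z'))"
    if z[measurable]: "z \<in> space \<nu>" and z'[measurable]: "z' \<in> space \<nu>" for z z'
  proof -
    let ?A = "{p \<in> space P. (p, z) \<in> B}" and ?B = "{p \<in> space P. (p, z') \<in> B}"
    have [measurable]: "?A \<in> sets P" "?B \<in> sets P" by measurable
    have "(\<integral>\<^sup>+p. ok p z * ok p z' \<partial>P) = (\<integral>\<^sup>+p. indicator (space P - (?A \<union> ?B)) p \<partial>P)"
      using z z' by (intro nn_integral_cong) (auto simp: ok_def space_pair_measure split: split_indicator)
    also have "\<dots> = ennreal (measure P (space P - (?A \<union> ?B)))"
      by (simp add: P.emeasure_eq_measure)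
    also have "measure P (space P - (?A \<union> ?B)) = 1 - measure P (?A \<union> ?B)"
      by (intro P.prob_compl) auto
    finally show ?thesis by (simp only: un_eq[OF z z'])
  qed
  have m_meas[measurable]: "m \<in> borel_measurable \<nu>"
  proof -
    have "(\<lambda>z. 1 - enn2real (\<integral>\<^sup>+p. ok p z \<partial>P)) \<in> borel_measurable \<nu>" by measurable
    also have "?this \<longleftrightarrow> ?thesis"
      by (intro measurable_cong) (simp add: m_eq, simp add: m_def)
    finally show ?thesis .
  qed
  have j_meas[measurable]: "case_prod j \<in> borel_measurable (\<nu> \<Otimes>\<^sub>M \<nu>)"
  proof -
    have "(\<lambda>(z, z'). enn2real (\<integral>\<^sup>+p. ok p z * ok p z' \<partial>P) - 1 + (m z + m z')) \<in> borel_measurable (\<nu> \<Otimes>\<^sub>M \<nu>)"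
      by measurable
    also have "?this \<longleftrightarrow> ?thesis"
      using bounds(4) by (intro measurable_cong) (auto simp: j_eq space_pair_measure)
    finally show ?thesis .
  qed
  have X_eq: "ennreal (X \<omega>) = (\<integral>\<^sup>+z. (\<Prod>i<n. ok (\<omega> i) z) \<partial>\<nu>)" if w: "\<omega> \<in> space ?\<Pi>" for \<omega>
  proof -
    have wi[measurable]: "\<omega> i \<in> space P" if "i < n" for i using w that by (auto simp: space_PiM)
    let ?S = "{z \<in> space \<nu>. \<forall>i<n. (\<omega> i, z) \<notin> B}"
    have "?S = space \<nu> - (\<Union>i<n. {z \<in> space \<nu>. (\<omega> i, z) \<in> B})" by auto
    also have "\<dots> \<in> sets \<nu>"
      using wi by (intro sets.Diff sets.finite_UN) measurable
    finally have S: "?S \<in> sets \<nu>" .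
    have "ennreal (X \<omega>) = (\<integral>\<^sup>+z. indicator ?S z \<partial>\<nu>)"
      using S by (simp add: X_def nu.emeasure_eq_measure)
    also have "\<dots> = (\<integral>\<^sup>+z. (\<Prod>i<n. ok (\<omega> i) z) \<partial>\<nu>)"
    proof (intro nn_integral_cong)
      fix z assume z: "z \<in> space \<nu>"
      show "indicator ?S z = (\<Prod>i<n. ok (\<omega> i) z)"
      proof (cases "z \<in> ?S")
        case True
        then show ?thesis using wi by (auto simp: ok_def space_pair_measure intro!: prod.neutral[symmetric])
      next
        case False
        then obtain i where "i < n" "(\<omega> i, z) \<in> B" using z by auto
        then have "(\<Prod>i<n. ok (\<omega> i) z) = 0"
          by (intro prod_zero bexI[of _ i]) (auto simp: ok_def)
        then show ?thesis using False by simp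
      qed
    qed
    finally show ?thesis .
  qed
  have X0: "X \<omega> \<ge> 0" for \<omega> by (simp add: X_def)
  have "(\<lambda>\<omega>. enn2real (\<integral>\<^sup>+z. (\<Prod>i<n. ok (\<omega> i) z) \<partial>\<nu>)) \<in> borel_measurable ?\<Pi>"
    by measurable
  also have "?this \<longleftrightarrow> X \<in> borel_measurable ?\<Pi>"
    by (intro measurable_cong) (simp flip: X_eq add: X0)
  finally show X[measurable]: "X \<in> borel_measurable ?\<Pi>" .
  have "(\<integral>\<^sup>+\<omega>. X \<omega> \<partial>?\<Pi>) = (\<integral>\<^sup>+\<omega>. \<integral>\<^sup>+z. (\<Prod>i<n. ok (\<omega> i) z) \<partial>\<nu> \<partial>?\<Pi>)"
    by (intro nn_integral_cong X_eq)
  also have "\<dots> = (\<integral>\<^sup>+z. \<integral>\<^sup>+\<omega>. (\<Prod>i<n. ok (\<omega> i) z) \<partial>?\<Pi> \<partial>\<nu>)"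
    by (rule pr.Fubini'[symmetric]) measurable
  also have "\<dots> = (\<integral>\<^sup>+z. ennreal ((1 - m z) ^ n) \<partial>\<nu>)"
  proof (intro nn_integral_cong)
    fix z assume z[measurable]: "z \<in> space \<nu>"
    have "(\<integral>\<^sup>+\<omega>. (\<Prod>i<n. ok (\<omega> i) z) \<partial>?\<Pi>) = (\<Prod>i<n. \<integral>\<^sup>+p. ok p z \<partial>P)"
      by (intro PP.product_nn_integral_prod) measurable
    then show "(\<integral>\<^sup>+\<omega>. (\<Prod>i<n. ok (\<omega> i) z) \<partial>?\<Pi>) = ennreal ((1 - m z) ^ n)"
      using m_eq[OF z] by (simp add: m_def ennreal_power)
  qed
  finally have EX: "(\<integral>\<^sup>+\<omega>. X \<omega> \<partial>?\<Pi>) = (\<integral>\<^sup>+z. ennreal ((1 - m z) ^ n) \<partial>\<nu>)" .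
  have "(\<integral>\<^sup>+\<omega>. (X \<omega>)\<^sup>2 \<partial>?\<Pi>) =
      (\<integral>\<^sup>+\<omega>. \<integral>\<^sup>+z. \<integral>\<^sup>+z'. (\<Prod>i<n. ok (\<omega> i) z * ok (\<omega> i) z') \<partial>\<nu> \<partial>\<nu> \<partial>?\<Pi>)"
  proof (intro nn_integral_cong)
    fix \<omega> assume w: "\<omega> \<in> space ?\<Pi>"
    then have wi[measurable]: "\<omega> i \<in> space P" if "i < n" for i using that by (auto simp: space_PiM)
    have [measurable]: "(\<lambda>z. (\<Prod>i<n. ok (\<omega> i) z)) \<in> borel_measurable \<nu>"
      using wi by (intro borel_measurable_prod_ennreal) measurable
    have "ennreal ((X \<omega>)\<^sup>2) = ennreal (X \<omega>) * ennreal (X \<omega>)"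
      using X0 by (simp add: power2_eq_square ennreal_mult)
    also have "\<dots> = (\<integral>\<^sup>+z. (\<Prod>i<n. ok (\<omega> i) z) * ennreal (X \<omega>) \<partial>\<nu>)"
      unfolding X_eq[OF w] by (rule nn_integral_multc[symmetric]) measurable
    also have "\<dots> = (\<integral>\<^sup>+z. \<integral>\<^sup>+z'. (\<Prod>i<n. ok (\<omega> i) z) * (\<Prod>i<n. ok (\<omega> i) z') \<partial>\<nu> \<partial>\<nu>)"
      unfolding X_eq[OF w] by (intro nn_integral_cong nn_integral_cmult[symmetric]) measurable
    finally show "ennreal ((X \<omega>)\<^sup>2) =
        (\<integral>\<^sup>+z. \<integral>\<^sup>+z'. (\<Prod>i<n. ok (\<omega> i) z * ok (\<omega> i) z') \<partial>\<nu> \<partial>\<nu>)"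
      by (simp add: prod.distrib)
  qed
  also have "\<dots> = (\<integral>\<^sup>+z. \<integral>\<^sup>+\<omega>. \<integral>\<^sup>+z'. (\<Prod>i<n. ok (\<omega> i) z * ok (\<omega> i) z') \<partial>\<nu> \<partial>?\<Pi> \<partial>\<nu>)"
    by (rule pr.Fubini'[symmetric]) measurable
  also have "\<dots> = (\<integral>\<^sup>+z. \<integral>\<^sup>+z'. \<integral>\<^sup>+\<omega>. (\<Prod>i<n. ok (\<omega> i) z * ok (\<omega> i) z') \<partial>?\<Pi> \<partial>\<nu> \<partial>\<nu>)"
  proof (intro nn_integral_cong)
    fix z assume [measurable]: "z \<in> space \<nu>"
    show "(\<integral>\<^sup>+\<omega>. \<integral>\<^sup>+z'. (\<Prod>i<n. ok (\<omega> i) z * ok (\<omega> i) z') \<partial>\<nu> \<partial>?\<Pi>) =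
        (\<integral>\<^sup>+z'. \<integral>\<^sup>+\<omega>. (\<Prod>i<n. ok (\<omega> i) z * ok (\<omega> i) z') \<partial>?\<Pi> \<partial>\<nu>)"
      by (rule pr.Fubini'[symmetric]) measurable
  qed
  also have "\<dots> = (\<integral>\<^sup>+z. \<integral>\<^sup>+z'. ennreal ((1 - (m z + m z' - j z z')) ^ n) \<partial>\<nu> \<partial>\<nu>)"
  proof (intro nn_integral_cong)
    fix z z' assume z[measurable]: "z \<in> space \<nu>" and z'[measurable]: "z' \<in> space \<nu>"
    have "(\<integral>\<^sup>+\<omega>. (\<Prod>i<n. ok (\<omega> i) z * ok (\<omega> i) z') \<partial>?\<Pi>) = (\<Prod>i<n. \<integral>\<^sup>+p. ok p z * ok p z' \<partial>P)"
      by (intro PP.product_nn_integral_prod) measurable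
    moreover have "0 \<le> 1 - (m z + m z' - j z z')" using bounds(4)[OF z z'] by simp
    ultimately show "(\<integral>\<^sup>+\<omega>. (\<Prod>i<n. ok (\<omega> i) z * ok (\<omega> i) z') \<partial>?\<Pi>) =
        ennreal ((1 - (m z + m z' - j z z')) ^ n)"
      using j_eq[OF z z'] by (simp add: ennreal_power)
  qed
  finally have EX2: "(\<integral>\<^sup>+\<omega>. (X \<omega>)\<^sup>2 \<partial>?\<Pi>) =
      (\<integral>\<^sup>+z. \<integral>\<^sup>+z'. ennreal ((1 - (m z + m z' - j z z')) ^ n) \<partial>\<nu> \<partial>\<nu>)" .
  let ?R = "\<lambda>z z'. ennreal (real n * j z z' * (1 - max (m z) (m z')) ^ (n - 1))"
  have pt: "ennreal ((1 - (m z + m z' - j z z')) ^ n) \<le>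
      ennreal ((1 - m z) ^ n) * ennreal ((1 - m z') ^ n) + ?R z z'"
    if z: "z \<in> space \<nu>" "z' \<in> space \<nu>" for z z'
  proof -
    let ?a = "m z" and ?b = "m z'" and ?j = "j z z'"
    note bd = bounds[OF z]
    have m1: "?a \<le> 1" "?b \<le> 1" "0 \<le> ?a" "0 \<le> ?b" by (simp_all add: m_def)
    \<comment> \<open>For a single draw the covariance of the two events is
      \<open>?j - ?a * ?b\<close>. If it is not positive, monotonicity of powers suffices. Otherwise
      both bases are at most \<open>1 - max ?a ?b\<close>, since \<open>?j\<close> is at most
      \<open>?a\<close> and \<open>?b\<close>, and they differ by at most \<open>?j\<close>.\<close>
    have "(1 - (?a + ?b - ?j)) ^ n \<le> ((1 - ?a) * (1 - ?b)) ^ n + real n * ?j * (1 - max ?a ?b) ^ (n - 1)"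
    proof (cases "?j \<le> ?a * ?b")
      case True
      then have "(1 - (?a + ?b - ?j)) ^ n \<le> ((1 - ?a) * (1 - ?b)) ^ n"
        using bd by (intro power_mono) (auto simp: algebra_simps)
      moreover have "0 \<le> real n * ?j * (1 - max ?a ?b) ^ (n - 1)"
        using bd m1 by (intro mult_nonneg_nonneg zero_le_power) auto
      ultimately show ?thesis by linarith
    next
      case False
      let ?x = "1 - (?a + ?b - ?j)" and ?y = "(1 - ?a) * (1 - ?b)" and ?c = "1 - max ?a ?b"
      have diff: "?x - ?y = ?j - ?a * ?b" by (simp add: algebra_simps)
      have "?x ^ n - ?y ^ n \<le> real n * (?x - ?y) * ?c ^ (n - 1)"
        using False bd m1 diff by (intro power_diff_le_mult) auto
      also have "\<dots> \<le> real n * ?j * ?c ^ (n - 1)"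
        unfolding diff using m1 by (intro mult_right_mono mult_left_mono) auto
      finally show ?thesis by simp
    qed
    also have "((1 - ?a) * (1 - ?b)) ^ n = (1 - ?a) ^ n * (1 - ?b) ^ n" by (rule power_mult_distrib)
    finally have "ennreal ((1 - (?a + ?b - ?j)) ^ n) \<le>
        ennreal ((1 - ?a) ^ n * (1 - ?b) ^ n + real n * ?j * (1 - max ?a ?b) ^ (n - 1))"
      by (rule ennreal_leI)
    also have "\<dots> = ennreal ((1 - ?a) ^ n) * ennreal ((1 - ?b) ^ n) + ?R z z'"
      using m1 bd by (subst ennreal_plus) (auto simp: ennreal_mult)
    finally show ?thesis .
  qed
  have "(\<integral>\<^sup>+\<omega>. (X \<omega>)\<^sup>2 \<partial>?\<Pi>) \<le>
      (\<integral>\<^sup>+z. \<integral>\<^sup>+z'. ennreal ((1 - m z) ^ n) * ennreal ((1 - m z') ^ n) + ?R z z' \<partial>\<nu> \<partial>\<nu>)"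
    unfolding EX2 by (intro nn_integral_mono pt)
  also have "\<dots> = (\<integral>\<^sup>+z. ennreal ((1 - m z) ^ n) * (\<integral>\<^sup>+z'. ennreal ((1 - m z') ^ n) \<partial>\<nu>) + (\<integral>\<^sup>+z'. ?R z z' \<partial>\<nu>) \<partial>\<nu>)"
    by (intro nn_integral_cong) (simp add: nn_integral_add nn_integral_cmult)
  also have "\<dots> = (\<integral>\<^sup>+\<omega>. X \<omega> \<partial>?\<Pi>)\<^sup>2 + (\<integral>\<^sup>+z. \<integral>\<^sup>+z'. ?R z z' \<partial>\<nu> \<partial>\<nu>)"
    by (subst nn_integral_add) (simp_all add: nn_integral_multc EX power2_eq_square)
  finally have le: "(\<integral>\<^sup>+\<omega>. (X \<omega>)\<^sup>2 \<partial>?\<Pi>) \<le>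
      (\<integral>\<^sup>+\<omega>. X \<omega> \<partial>?\<Pi>)\<^sup>2 + (\<integral>\<^sup>+z. \<integral>\<^sup>+z'. ?R z z' \<partial>\<nu> \<partial>\<nu>)" .
  \<comment> \<open>Boundedness by the total mass makes both moments finite, so that the squared
    mean can be subtracted in \<open>le\<close>.\<close>
  have Xb: "X \<omega> \<le> measure \<nu> (space \<nu>)" for \<omega>
    unfolding X_def by (intro nu.finite_measure_mono) auto
  have int: "integrable ?\<Pi> X"
    using Xb X0 by (auto intro!: Pi.integrable_const_bound[where B = "measure \<nu> (space \<nu>)"])
  have int2: "integrable ?\<Pi> (\<lambda>\<omega>. (X \<omega>)\<^sup>2)"
  proof (rule Pi.integrable_const_bound[where B = "(measure \<nu> (space \<nu>))\<^sup>2"])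
    show "AE \<omega> in ?\<Pi>. norm ((X \<omega>)\<^sup>2) \<le> (measure \<nu> (space \<nu>))\<^sup>2"
      using power_mono[OF Xb X0, where n = 2] by simp
  qed simp
  have "ennreal (Pi.variance X) = ennreal (Pi.expectation (\<lambda>\<omega>. (X \<omega>)\<^sup>2)) - ennreal ((Pi.expectation X)\<^sup>2)"
    by (simp add: Pi.variance_eq[OF int int2] ennreal_minus)
  also have "\<dots> = (\<integral>\<^sup>+\<omega>. (X \<omega>)\<^sup>2 \<partial>?\<Pi>) - (\<integral>\<^sup>+\<omega>. X \<omega> \<partial>?\<Pi>)\<^sup>2"
    using int int2 X0 by (simp add: nn_integral_eq_integral ennreal_power)
  also have "\<dots> \<le> (\<integral>\<^sup>+z. \<integral>\<^sup>+z'. ?R z z' \<partial>\<nu> \<partial>\<nu>)"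
    using le int int2 X0 by (auto simp: nn_integral_eq_integral ennreal_power ennreal_minus_le_iff add.commute)
  finally show "ennreal (Pi.variance X) \<le> (\<integral>\<^sup>+z. \<integral>\<^sup>+z'. ?R z z' \<partial>\<nu> \<partial>\<nu>)" .
qed

section \<open>Convex bodies that slide freely in a ball\<close>

text \<open>Compactness makes the supremum a maximum; convexity and \<open>0 \<in> M\<close> put the
  segment below it into \<open>M\<close>. This exchanges the inner integration range of the weighted
  volume for membership in \<open>M\<close>.\<close>

lemma radial_fun_iff:
  fixes M :: "'a::euclidean_space set"
  assumes M: "compact M" "convex M" "0 \<in> M" and u: "norm u = 1"
  shows "0 \<le> t \<and> t \<le> radial_fun M u \<longleftrightarrow> 0 \<le> t \<and> t *\<^sub>R u \<in> M"
proof -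
  define T where "T = {t. 0 \<le> t \<and> t *\<^sub>R u \<in> M}"
  have "closed {t. t *\<^sub>R u \<in> M}"
    using M(1) by (intro continuous_closed_vimage[of M "\<lambda>t. t *\<^sub>R u", unfolded vimage_def])
       (auto simp: compact_imp_closed intro!: continuous_intros)
  then have "closed T" unfolding T_def by (intro closed_Collect_conj closed_Collect_le) (auto intro!: continuous_intros)
  obtain b where b: "\<And>y. y \<in> M \<Longrightarrow> norm y \<le> b" using M(1) by (meson bounded_iff compact_imp_bounded)
  then have bdd: "bdd_above T" using u by (intro bdd_aboveI[of _ b]) (force simp: T_def)
  have "0 \<in> T" using M(3) by (simp add: T_def)
  then have sup: "Sup T \<in> T" using closed_contains_Sup[OF _ bdd \<open>closed T\<close>] by blast
  have "t \<in> T" if "0 \<le> t" "t \<le> Sup T"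
  proof (cases "t = 0")
    case False
    have "(t / Sup T) *\<^sub>R (Sup T *\<^sub>R u) + (1 - t / Sup T) *\<^sub>R 0 \<in> M"
      using that sup False M(2,3) by (intro convexD) (auto simp: T_def field_simps)
    then show ?thesis using that False by (simp add: T_def)
  qed (use \<open>0 \<in> T\<close> in simp)
  moreover have "t \<le> Sup T" if "t \<in> T" using that bdd by (rule cSup_upper)
  ultimately show ?thesis unfolding radial_fun_def T_def[symmetric] by (auto simp: T_def)
qed

lemma support_fun_upper: "compact M \<Longrightarrow> y \<in> M \<Longrightarrow> u \<bullet> y \<le> support_fun M u"
  unfolding support_fun_def
  by (intro cSUP_upper bounded_imp_bdd_above compact_imp_bounded compact_continuous_image)
     (auto intro!: continuous_intros)

lemma support_fun_attained:
  assumes "compact M" "M \<noteq> {}"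
  obtains x where "x \<in> M" "u \<bullet> x = support_fun M u"
proof -
  obtain x where x: "x \<in> M" "\<And>y. y \<in> M \<Longrightarrow> u \<bullet> y \<le> u \<bullet> x"
    using continuous_attains_sup[OF assms, of "\<lambda>y. u \<bullet> y"]
    by (auto simp: continuous_on_inner)
  then have "support_fun M u \<le> u \<bullet> x"
    unfolding support_fun_def using assms(2) by (intro cSUP_least) auto
  then show ?thesis using that[OF x(1)] support_fun_upper[OF assms(1) x(1), of u] by force
qed

lemma compact_outer_parallel: "compact (K :: 'a::euclidean_space set) \<Longrightarrow> compact (outer_parallel K)"
proof -
  assume "compact K"
  then have "compact {x + y | x y. x \<in> K \<and> y \<in> cball (0::'a) 1}"
    by (intro compact_sums compact_cball)
  also have "{x + y | x y. x \<in> K \<and> y \<in> cball (0::'a) 1} = outer_parallel K"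
    unfolding outer_parallel_def set_plus_def by blast
  finally show ?thesis .
qed

lemma convex_outer_parallel: "convex K \<Longrightarrow> convex (outer_parallel K)"
  unfolding outer_parallel_def by (intro convex_set_plus) auto

lemma subset_outer_parallel: "K \<subseteq> outer_parallel K"
  unfolding outer_parallel_def set_plus_def by force

text \<open>The last assumption is free sliding with the sliding undone: for each normal
  \<open>u\<close>, a ball of radius \<open>R\<close> encloses \<open>K\<close> and has the point
  \<open>x\<close> of \<open>K\<close> on its boundary with outer normal \<open>u\<close>. That
  \<open>x\<close> is the support point in direction \<open>u\<close> is derived in
  \<open>enclosing_ball\<close>.\<close>

locale ball_convex_body =
  fixes K :: "'a::euclidean_space set" and r0 R1 R :: real
  assumes convex: "convex K" and compact: "compact K"
    and r0: "0 < r0" "cball 0 r0 \<subseteq> K"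
    and R1: "K \<subseteq> cball 0 R1"
    and R: "0 < R" "\<And>u. norm u = 1 \<Longrightarrow> \<exists>x\<in>K. K \<subseteq> cball (x - R *\<^sub>R u) R"
begin

abbreviation h where "h \<equiv> support_fun K"
abbreviation \<rho> where "\<rho> \<equiv> radial_fun K"

lemma zero_mem: "0 \<in> K" using r0 by auto

lemma rho_iff: "norm v = 1 \<Longrightarrow> 0 \<le> t \<and> t \<le> \<rho> v \<longleftrightarrow> 0 \<le> t \<and> t *\<^sub>R v \<in> K"
  by (rule radial_fun_iff[OF compact convex zero_mem])

lemma rho_bounds: "r0 \<le> \<rho> v" "\<rho> v \<le> R1" "\<rho> v *\<^sub>R v \<in> K" if "norm v = 1"
proof -
  show "r0 \<le> \<rho> v" using rho_iff[OF that, of r0] r0 that by (auto simp: subset_iff)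
  then show *: "\<rho> v *\<^sub>R v \<in> K" using rho_iff[OF that, of "\<rho> v"] r0 by auto
  with R1 have "norm (\<rho> v *\<^sub>R v) \<le> R1" by auto
  then show "\<rho> v \<le> R1" using that by simp
qed

lemma h_bounds: "r0 \<le> h u" "h u \<le> R1" if "norm u = 1"
proof -
  have "r0 *\<^sub>R u \<in> K" using r0 that by auto
  from support_fun_upper[OF compact this, of u] show "r0 \<le> h u"
    using that by (simp add: dot_square_norm)
  obtain x where x: "x \<in> K" "u \<bullet> x = h u" using support_fun_attained[OF compact] zero_mem by blast
  have "u \<bullet> x \<le> norm u * norm x" by (rule norm_cauchy_schwarz)
  then show "h u \<le> R1" using x R1 that by auto
qed

lemma r0_le_R1: "r0 \<le> R1"
proof -
  obtain u :: 'a where "norm u = 1" using norm_Basis SOME_Basis by blast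
  from h_bounds[OF this] show ?thesis by simp
qed

section \<open>Quadratic estimates from the enclosing balls\<close>

text \<open>Expanding |w - z + R u|^2 <= R^2 gives the inequality for the touching point
  \<open>z\<close>. Applied to the support point \<open>x\<close> its right side is at most 0, so
  \<open>x = z\<close>: the support point in each direction is unique.\<close>

lemma enclosing_ball:
  assumes u: "norm u = 1" and x: "x \<in> K" "u \<bullet> x = h u" and y: "y \<in> K"
  shows "(norm (y - x))\<^sup>2 \<le> 2 * R * (h u - u \<bullet> y)"
proof -
  obtain z where z: "z \<in> K" "K \<subseteq> cball (z - R *\<^sub>R u) R" using R(2)[OF u] by blast
  have *: "(norm (w - z))\<^sup>2 \<le> 2 * R * (u \<bullet> z - u \<bullet> w)" if "w \<in> K" for w
  proof -
    have "norm ((w - z) + R *\<^sub>R u) \<le> R"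
      using z(2) that by (auto simp: dist_norm norm_minus_commute algebra_simps subset_iff)
    then have "(norm ((w - z) + R *\<^sub>R u))\<^sup>2 \<le> R\<^sup>2" using R by (intro power_mono) auto
    moreover have "(norm ((w - z) + R *\<^sub>R u))\<^sup>2 = (norm (w - z))\<^sup>2 + 2 * R * ((w - z) \<bullet> u) + R\<^sup>2"
      using u dot_norm[of "w - z" "R *\<^sub>R u"] by (simp only: norm_scaleR power_mult_distrib inner_scaleR_right power2_abs) (simp add: field_simps)
    ultimately show ?thesis by (simp add: inner_diff_left inner_diff_right inner_commute algebra_simps)
  qed
  have "2 * R * (u \<bullet> z - u \<bullet> x) \<le> 0"
    using support_fun_upper[OF compact z(1), of u] x R by (simp add: mult_nonneg_nonpos)
  then have "(norm (x - z))\<^sup>2 \<le> 0" using *[OF x(1)] by linarith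
  then have "x = z" by simp
  then show ?thesis using *[OF y] x by simp
qed

text \<open>The dual of \<open>enclosing_ball\<close>. The support point \<open>y\<close> for
  \<open>u\<close> loses at least |y - x|^2 / (2 R) in direction \<open>u0\<close>, and this loss
  absorbs part of the cross term (u - u0).(y - x) by Young's inequality.\<close>

lemma support_upper:
  assumes u0: "norm u0 = 1" and x: "x \<in> K" "u0 \<bullet> x = h u0" and u: "norm u = 1"
  shows "h u \<le> u \<bullet> x + R / 2 * (norm (u - u0))\<^sup>2"
proof -
  obtain y where y: "y \<in> K" "u \<bullet> y = h u" using support_fun_attained[OF compact] zero_mem by blast
  have "(norm (y - x))\<^sup>2 \<le> 2 * R * (u0 \<bullet> x - u0 \<bullet> y)"
    using enclosing_ball[OF u0 x y(1)] x by simp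
  then have 1: "(norm (y - x))\<^sup>2 / (2 * R) \<le> u0 \<bullet> x - u0 \<bullet> y" using R by (simp add: field_simps)
  have "(u - u0) \<bullet> (y - x) \<le> norm (u - u0) * norm (y - x)" by (rule norm_cauchy_schwarz)
  also have "\<dots> \<le> R / 2 * (norm (u - u0))\<^sup>2 + (norm (y - x))\<^sup>2 / (2 * R)"
  proof -
    have "0 \<le> (R * norm (u - u0) - norm (y - x))\<^sup>2 / (2 * R)" using R by simp
    then show ?thesis using R by (simp add: field_simps power2_eq_square)
  qed
  finally show ?thesis using 1 y by (simp add: inner_diff_left inner_diff_right)
qed

lemma rho_not_interior:
  assumes v: "norm v = 1"
  shows "\<rho> v *\<^sub>R v \<notin> interior K"
proof
  let ?x = "\<rho> v *\<^sub>R v"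
  assume "?x \<in> interior K"
  then obtain e where e: "e > 0" "cball ?x e \<subseteq> K" by (auto simp: mem_interior_cball)
  have "(\<rho> v + e) *\<^sub>R v \<in> cball ?x e" using v e by (simp add: dist_norm algebra_simps)
  then have "(\<rho> v + e) *\<^sub>R v \<in> K" using e by blast
  then show False using rho_iff[OF v, of "\<rho> v + e"] rho_bounds[OF v] e r0 by auto
qed

text \<open>Shrinking a point of \<open>K\<close> towards the interior point 0 moves it into the
  interior, so each ray meets the frontier only once. \<open>continuous_rho\<close> rests on
  this.\<close>

lemma rho_frontier_iff:
  assumes v: "norm v = 1" and k: "0 < k"
  shows "k *\<^sub>R v \<in> frontier K \<longleftrightarrow> k = \<rho> v"
proof
  assume kv: "k *\<^sub>R v \<in> frontier K"
  then have "k \<le> \<rho> v" using rho_iff[OF v, of k] k compact by (simp add: frontier_def compact_imp_closed)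
  moreover have "\<not> k < \<rho> v"
  proof
    assume less: "k < \<rho> v"
    have "0 \<in> interior K" using r0 by (auto simp: mem_interior_cball)
    then have "\<rho> v *\<^sub>R v - (1 - k / \<rho> v) *\<^sub>R (\<rho> v *\<^sub>R v - 0) \<in> interior K"
      using less k by (intro mem_interior_convex_shrink convex rho_bounds v) auto
    then show False using kv k less by (simp add: frontier_def algebra_simps)
  qed
  ultimately show "k = \<rho> v" by simp
next
  assume "k = \<rho> v"
  then show "k *\<^sub>R v \<in> frontier K"
    using rho_not_interior[OF v] rho_bounds(3)[OF v] compact by (simp add: frontier_def compact_imp_closed)
qed

lemma rho_frontier_normal:
  assumes v: "norm v = 1"
  obtains u0 where "norm u0 = 1" "u0 \<bullet> (\<rho> v *\<^sub>R v) = h u0"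
proof -
  let ?x = "\<rho> v *\<^sub>R v"
  have "interior K \<noteq> {}" using r0 interior_mono[OF r0(2)] by auto
  then have "?x \<notin> rel_interior K" using rho_not_interior[OF v] by (simp add: rel_interior_nonempty_interior)
  then obtain a where a: "a \<noteq> 0" "\<And>y. y \<in> K \<Longrightarrow> a \<bullet> ?x \<le> a \<bullet> y"
    using supporting_hyperplane_rel_boundary[OF convex rho_bounds(3)[OF v]] by metis
  \<comment> \<open>The supporting hyperplane comes with an inner normal, hence the sign.\<close>
  define u0 where "u0 = - (a /\<^sub>R norm a)"
  have "norm u0 = 1" using a by (simp add: u0_def)
  obtain y where y: "y \<in> K" "u0 \<bullet> y = h u0" using support_fun_attained[OF compact] zero_mem by blast
  have "u0 \<bullet> y \<le> u0 \<bullet> ?x"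
    using a(2)[OF y(1)] a(1) by (simp add: u0_def divide_right_mono flip: divide_inverse_commute)
  moreover have "u0 \<bullet> ?x \<le> h u0" by (rule support_fun_upper[OF compact rho_bounds(3)[OF v]])
  ultimately show ?thesis using that[OF \<open>norm u0 = 1\<close>] y by simp
qed

text \<open>Half of \<open>r0 / R1\<close>, which bounds from below the cosine of the angle between
  \<open>v\<close> and an outer normal at \<open>\<rho> v *\<^sub>R v\<close>. The other half allows
  the normal to be tilted by \<beta>.\<close>

definition \<beta> where "\<beta> = r0 / (2 * R1)"

lemma beta: "0 < \<beta>" "\<beta> \<le> 1 / 2"
  using r0 r0_le_R1 by (auto simp: \<beta>_def field_simps)

text \<open>Moving outward from the boundary point by \<tau> gains at least
  \<open>\<tau> * \<beta>\<close> in direction \<open>u\<close>, while by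
  \<open>support_upper\<close> the tilt from \<open>u0\<close> to \<open>u\<close> costs at most
  half of this. Every height in the remaining gap cuts the point off.\<close>

lemma separating_gap:
  assumes v: "norm v = 1" and \<tau>: "0 \<le> \<tau>"
    and u0: "norm u0 = 1" "u0 \<bullet> (\<rho> v *\<^sub>R v) = h u0"
    and u: "norm u = 1" "norm (u - u0) \<le> \<beta>" "(norm (u - u0))\<^sup>2 \<le> \<beta> * \<tau> / R"
  shows "h u + \<tau> * \<beta> / 2 \<le> u \<bullet> ((\<rho> v + \<tau>) *\<^sub>R v)"
proof -
  let ?x = "\<rho> v *\<^sub>R v"
  have "h u \<le> u \<bullet> ?x + R / 2 * (norm (u - u0))\<^sup>2"
    by (rule support_upper[OF u0(1) rho_bounds(3)[OF v] u0(2) u(1)])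
  also have "R / 2 * (norm (u - u0))\<^sup>2 \<le> R / 2 * (\<beta> * \<tau> / R)"
    using R u by (intro mult_left_mono) auto
  finally have 1: "h u \<le> u \<bullet> ?x + \<beta> * \<tau> / 2" using R by simp
  have "r0 \<le> \<rho> v * (u0 \<bullet> v)" using h_bounds[OF u0(1)] u0(2) by simp
  then have "r0 / R1 \<le> u0 \<bullet> v"
  proof -
    have "0 \<le> u0 \<bullet> v"
      using \<open>r0 \<le> \<rho> v * (u0 \<bullet> v)\<close> rho_bounds(1)[OF v] r0
      by (meson less_le_trans linorder_not_le mult_pos_neg not_less_iff_gr_or_eq order_less_imp_le)
    then have "\<rho> v * (u0 \<bullet> v) \<le> R1 * (u0 \<bullet> v)" using rho_bounds[OF v] by (intro mult_right_mono)
    then show ?thesis using \<open>r0 \<le> \<rho> v * (u0 \<bullet> v)\<close> r0 r0_le_R1 by (simp add: field_simps)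
  qed
  moreover have "\<bar>(u - u0) \<bullet> v\<bar> \<le> norm (u - u0) * norm v" by (rule Cauchy_Schwarz_ineq2)
  ultimately have "r0 / R1 - \<beta> \<le> u \<bullet> v" using u(2) v by (simp add: inner_diff_left)
  then have "\<beta> \<le> u \<bullet> v" by (simp add: \<beta>_def)
  then have "\<tau> * \<beta> \<le> \<tau> * (u \<bullet> v)" using \<tau> by (rule mult_left_mono)
  then show ?thesis using 1 by (simp add: inner_add_right scaleR_left_distrib mult.commute)
qed

text \<open>Dividing both points by \<open>1 + \<tau> / r0\<close> brings them into
  \<open>K\<close>, at the price of a support deficit of at most \<open>R1 * \<tau> / r0\<close> in
  direction \<open>u\<close>. By \<open>enclosing_ball\<close> both are then within O(sqrt \<tau>)
  of the same support point. The factor 8 collects two distances to that point, the passage from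
  points to directions, and the lower bound \<open>r0 / 2\<close> for the length of the first
  point.\<close>

lemma common_separation_close:
  assumes v: "norm v = 1" "norm v' = 1" and \<tau>: "0 < \<tau>'" "\<tau>' \<le> \<tau>" "\<tau> \<le> r0"
    and u: "norm u = 1" "h u \<le> u \<bullet> ((\<rho> v + \<tau>) *\<^sub>R v)" "h u \<le> u \<bullet> ((\<rho> v' + \<tau>') *\<^sub>R v')"
  shows "norm (v - v') \<le> 8 * sqrt (2 * R * R1 / r0) / r0 * sqrt \<tau>"
proof -
  define \<alpha> where "\<alpha> = \<tau> / r0"
  have \<alpha>: "0 < \<alpha>" "\<alpha> \<le> 1" using \<tau> r0 by (auto simp: \<alpha>_def)
  obtain x where x: "x \<in> K" "u \<bullet> x = h u" using support_fun_attained[OF compact] zero_mem by blast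
  define E where "E = sqrt (2 * R * R1 / r0)"
  have close: "norm (((\<rho> w + s) / (1 + \<alpha>)) *\<^sub>R w - x) \<le> E * sqrt \<tau>"
    if w: "norm w = 1" and s: "0 < s" "s \<le> \<tau>" and uw: "h u \<le> u \<bullet> ((\<rho> w + s) *\<^sub>R w)" for w s
  proof -
    let ?a = "(\<rho> w + s) / (1 + \<alpha>)"
    let ?p = "?a *\<^sub>R w"
    have "\<tau> = r0 * \<alpha>" using r0 by (simp add: \<alpha>_def)
    also have "\<dots> \<le> \<rho> w * \<alpha>" using rho_bounds[OF w] \<alpha> by (intro mult_right_mono) auto
    finally have "\<rho> w + s \<le> \<rho> w * (1 + \<alpha>)" using s by (simp add: algebra_simps)
    then have "?a \<le> \<rho> w" using \<alpha> by (simp add: field_simps)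
    moreover have "0 \<le> ?a" using s rho_bounds(1)[OF w] r0 \<alpha> by simp
    ultimately have p: "?p \<in> K" using rho_iff[OF w, of ?a] by blast
    have "h u / (1 + \<alpha>) \<le> (u \<bullet> ((\<rho> w + s) *\<^sub>R w)) / (1 + \<alpha>)"
      using uw \<alpha> by (intro divide_right_mono) auto
    also have "\<dots> = u \<bullet> ?p" by simp
    finally have "h u - u \<bullet> ?p \<le> h u - h u / (1 + \<alpha>)" by simp
    also have "\<dots> = h u * \<alpha> / (1 + \<alpha>)" using \<alpha> by (simp add: field_simps)
    also have "\<dots> \<le> h u * \<alpha> / 1"
      using \<alpha> h_bounds(1)[OF u(1)] r0 by (intro divide_left_mono) auto
    also have "\<dots> \<le> R1 * \<alpha>" using h_bounds[OF u(1)] \<alpha> by simp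
    finally have "2 * R * (h u - u \<bullet> ?p) \<le> 2 * R * (R1 * \<alpha>)" using R by (intro mult_left_mono) auto
    then have "(norm (?p - x))\<^sup>2 \<le> 2 * R * R1 / r0 * \<tau>"
      using enclosing_ball[OF u(1) x p] by (simp add: \<alpha>_def)
    then have "norm (?p - x) \<le> sqrt (2 * R * R1 / r0 * \<tau>)" by (rule real_le_rsqrt)
    then show ?thesis by (simp only: E_def real_sqrt_mult)
  qed
  let ?a = "(\<rho> v + \<tau>) / (1 + \<alpha>)" and ?b = "(\<rho> v' + \<tau>') / (1 + \<alpha>)"
  have ab: "r0 / 2 \<le> ?a" "0 < ?b"
  proof -
    have "r0 / 2 \<le> \<rho> v / 2" using rho_bounds[OF v(1)] by simp
    also have "\<dots> \<le> (\<rho> v + \<tau>) / (1 + \<alpha>)"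
      using \<alpha> \<tau> rho_bounds(1)[OF v(1)] r0 by (intro frac_le) auto
    finally show "r0 / 2 \<le> ?a" .
    show "0 < ?b" using \<alpha> \<tau> rho_bounds(1)[OF v(2)] r0 by (intro divide_pos_pos) auto
  qed
  have "norm (?a *\<^sub>R v - ?b *\<^sub>R v') \<le> 2 * (E * sqrt \<tau>)"
    using close[OF v(1) _ _ u(2)] close[OF v(2) \<tau>(1,2) u(3)] \<tau>
      norm_triangle_ineq4[of "?a *\<^sub>R v - x" "?b *\<^sub>R v' - x"] by simp
  \<comment> \<open>The lengths of two vectors differ by at most their distance, so equalising the
    lengths at most doubles it.\<close>
  moreover have "?a * norm (v - v') \<le> 2 * norm (?a *\<^sub>R v - ?b *\<^sub>R v')"
  proof -
    have "\<bar>?a\<bar> = ?a" using ab r0 by linarith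
    then have "?a * norm (v - v') = norm (?a *\<^sub>R v - ?a *\<^sub>R v')"
      by (simp only: norm_scaleR flip: scaleR_right_diff_distrib)
    also have "\<dots> \<le> norm (?a *\<^sub>R v - ?b *\<^sub>R v') + norm (?b *\<^sub>R v' - ?a *\<^sub>R v')"
      using norm_triangle_ineq[of "?a *\<^sub>R v - ?b *\<^sub>R v'" "?b *\<^sub>R v' - ?a *\<^sub>R v'"] by simp
    also have "norm (?b *\<^sub>R v' - ?a *\<^sub>R v') = \<bar>norm (?b *\<^sub>R v') - norm (?a *\<^sub>R v)\<bar>"
    proof -
      have "\<bar>?a\<bar> = ?a" "\<bar>?b\<bar> = ?b" using ab r0 by linarith+
      then show ?thesis using v by (simp only: norm_scaleR mult_1_right flip: scaleR_left_diff_distrib)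
    qed
    also have "\<dots> \<le> norm (?a *\<^sub>R v - ?b *\<^sub>R v')"
      by (metis norm_minus_commute norm_triangle_ineq3)
    finally show ?thesis by simp
  qed
  moreover have "r0 / 2 * norm (v - v') \<le> ?a * norm (v - v')"
    using ab by (intro mult_right_mono) auto
  ultimately have "r0 / 2 * norm (v - v') \<le> 4 * (E * sqrt \<tau>)" by linarith
  then show ?thesis using r0 unfolding E_def by (simp add: field_simps)
qed

lemma continuous_support: "continuous_on (sphere 0 1) h"
proof (rule continuous_on_compose2[of UNIV _ _ id, simplified])
  have "R1-lipschitz_on UNIV h"
  proof (rule lipschitz_onI)
    have le: "h u - h v \<le> R1 * dist u v" for u v
    proof -
      obtain x where x: "x \<in> K" "u \<bullet> x = h u" using support_fun_attained[OF compact] zero_mem by blast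
      have "h u - h v \<le> (u - v) \<bullet> x"
        using x support_fun_upper[OF compact x(1), of v] by (simp add: inner_diff_left)
      also have "\<dots> \<le> norm (u - v) * norm x" by (rule norm_cauchy_schwarz)
      also have "\<dots> \<le> norm (u - v) * R1" using x R1 by (intro mult_left_mono) auto
      finally show ?thesis by (simp add: dist_norm mult.commute)
    qed
    show "dist (h u) (h v) \<le> R1 * dist u v" for u v
      using le[of u v] le[of v u] by (simp add: dist_real_def dist_commute abs_le_iff)
  qed (use r0 r0_le_R1 in simp)
  then show "continuous_on UNIV h" by (rule lipschitz_on_continuous_on)
qed

text \<open>The projection along rays onto a compact surface that meets every ray exactly once is
  continuous; on the unit sphere \<rho> is the norm of this projection.\<close>

lemma continuous_rho: "continuous_on (sphere 0 1) \<rho>"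
proof -
  have "continuous_on (UNIV - {0}) (\<lambda>x. (\<rho> (x /\<^sub>R norm x) / norm x) *\<^sub>R x)"
  proof (rule continuous_on_compact_surface_projection[where S = "frontier K" and V = UNIV])
    show "compact (frontier K)" using compact by (rule compact_frontier)
    have "0 \<in> interior K" using r0 by (auto simp: mem_interior_cball)
    then show "frontier K \<subseteq> UNIV - {0}" by (auto simp: frontier_def)
    fix x :: 'a and k assume x: "x \<in> UNIV - {0}"
    let ?v = "x /\<^sub>R norm x"
    have v: "norm ?v = 1" using x by simp
    have "0 < k \<and> k *\<^sub>R x \<in> frontier K \<longleftrightarrow> 0 < k \<and> (k * norm x) *\<^sub>R ?v \<in> frontier K"
    proof -
      have "(k * norm x) *\<^sub>R ?v = k *\<^sub>R x" using x by (simp add: mult.assoc)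
      then show ?thesis by (simp only:)
    qed
    also have "\<dots> \<longleftrightarrow> 0 < k \<and> k * norm x = \<rho> ?v"
    proof (cases "0 < k")
      case True
      then have "0 < k * norm x" using x by simp
      from rho_frontier_iff[OF v this] show ?thesis by (simp only:)
    qed simp
    also have "\<dots> \<longleftrightarrow> \<rho> ?v / norm x = k"
    proof -
      have "0 < \<rho> ?v / norm x" using rho_bounds(1)[OF v] r0 x by simp
      then show ?thesis using x by (auto simp: field_simps zero_less_mult_iff)
    qed
    finally show "0 < k \<and> k *\<^sub>R x \<in> frontier K \<longleftrightarrow> \<rho> ?v / norm x = k" .
  qed (simp add: cone_def)
  then have "continuous_on (sphere 0 1) (\<lambda>x. norm ((\<rho> (x /\<^sub>R norm x) / norm x) *\<^sub>R x))"
    by (intro continuous_on_norm) (auto elim: continuous_on_subset)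
  also have "?this \<longleftrightarrow> ?thesis"
    using rho_bounds(1) r0 by (intro continuous_on_cong) (auto, smt (verit))
  finally show ?thesis .
qed

end

section \<open>Compactness and one-dimensional estimates\<close>

text \<open>The graph is compact, and monotonicity in \<open>b\<close> lets the largest of finitely
  many local constants serve everywhere. It is used with \<open>1 / b \<le> q z\<close> as well as
  with \<open>lam z \<le> b\<close>. The filter \<open>at\<close> omits the point itself, which is
  why \<open>pt\<close> is a separate premise.\<close>

lemma uniform_bound_near_graph:
  fixes g :: "'a::euclidean_space \<Rightarrow> real" and Q :: "real \<Rightarrow> real \<times> 'a \<Rightarrow> bool"
  assumes g: "continuous_on S g" and S: "compact S"
    and mono: "\<And>b b' z. b \<le> b' \<Longrightarrow> 0 < b \<Longrightarrow> Q b z \<Longrightarrow> Q b' z"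
    and loc: "\<And>u. u \<in> S \<Longrightarrow> \<exists>b>0. \<forall>\<^sub>F z in at (g u, u) within T. Q b z"
    and pt: "\<And>u. u \<in> S \<Longrightarrow> \<exists>b>0. Q b (g u, u)"
  obtains b \<epsilon> where "b > 0" "\<epsilon> > 0"
    "\<And>t u. u \<in> S \<Longrightarrow> (t, u) \<in> T \<Longrightarrow> \<bar>t - g u\<bar> < \<epsilon> \<Longrightarrow> Q b (t, u)"
proof -
  have "\<exists>b \<delta>. b > 0 \<and> \<delta> > 0 \<and> (\<forall>z\<in>T. dist z (g u, u) < \<delta> \<longrightarrow> Q b z)" if u: "u \<in> S" for u
  proof -
    obtain b where b: "b > 0" "\<forall>\<^sub>F z in at (g u, u) within T. Q b z" using loc[OF u] by blast
    obtain b' where b': "b' > 0" "Q b' (g u, u)" using pt[OF u] by blast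
    obtain \<delta> where \<delta>: "\<delta> > 0" "\<And>z. z \<in> T \<Longrightarrow> z \<noteq> (g u, u) \<Longrightarrow> dist z (g u, u) < \<delta> \<Longrightarrow> Q b z"
      using b(2) unfolding eventually_at by blast
    have "Q (max b b') z" if "z \<in> T" "dist z (g u, u) < \<delta>" for z
    proof (cases "z = (g u, u)")
      case True
      then show ?thesis using mono[OF _ b'(1), of "max b b'" z] b'(2) by simp
    next
      case False
      then show ?thesis using mono[OF _ b(1), of "max b b'" z] \<delta>(2)[OF that(1)] that by simp
    qed
    then show ?thesis using b \<delta> by (intro exI[of _ "max b b'"] exI[of _ \<delta>]) auto
  qed
  then obtain b \<delta> where bd: "\<And>u. u \<in> S \<Longrightarrow> b u > 0" "\<And>u. u \<in> S \<Longrightarrow> \<delta> u > 0"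
    "\<And>u z. u \<in> S \<Longrightarrow> z \<in> T \<Longrightarrow> dist z (g u, u) < \<delta> u \<Longrightarrow> Q (b u) z" by metis
  have "compact ((\<lambda>u. (g u, u)) ` S)"
    by (intro compact_continuous_image continuous_intros g S)
  then obtain F where F: "F \<subseteq> S" "finite F" "(\<lambda>u. (g u, u)) ` S \<subseteq> (\<Union>u\<in>F. ball (g u, u) (\<delta> u / 2))"
    by (rule compactE_image[where C = S and f = "\<lambda>u. ball (g u, u) (\<delta> u / 2)"])
       (use bd(2) in \<open>auto intro!: bexI\<close>)
  define B where "B = Max (insert 1 (b ` F))"
  define \<epsilon> where "\<epsilon> = Min (insert 1 ((\<lambda>u. \<delta> u / 2) ` F))"
  have B: "B > 0" "\<And>u. u \<in> F \<Longrightarrow> b u \<le> B"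
    using F(2) unfolding B_def by (auto simp: Max_ge_iff Max_gr_iff)
  have \<epsilon>: "\<epsilon> > 0"
    using F(1,2) bd(2) unfolding \<epsilon>_def by (subst Min_gr_iff) auto
  have \<epsilon>_le: "\<epsilon> \<le> \<delta> u / 2" if "u \<in> F" for u
    unfolding \<epsilon>_def by (rule Min.coboundedI) (use F(2) that in auto)
  show ?thesis
  proof (rule that[OF B(1) \<epsilon>])
    fix t u assume u: "u \<in> S" "(t, u) \<in> T" "\<bar>t - g u\<bar> < \<epsilon>"
    then obtain w where w: "w \<in> F" "dist (g u, u) (g w, w) < \<delta> w / 2" using F(3) by (force simp: dist_commute)
    have "dist (t, u) (g w, w) \<le> dist (t, u) (g u, u) + dist (g u, u) (g w, w)" by (rule dist_triangle)
    also have "dist (t, u) (g u, u) < \<delta> w / 2"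
      using u(3) \<epsilon>_le[OF w(1)] by (simp add: dist_Pair_Pair dist_real_def)
    finally have "dist (t, u) (g w, w) < \<delta> w" using w(2) by simp
    then have "Q (b w) (t, u)" using bd(3)[of w "(t, u)"] w(1) F(1) u(2) by auto
    then show "Q B (t, u)" using mono[OF B(2)[OF w(1)]] bd(1) w(1) F(1) by auto
  qed
qed

text \<open>Substituting \<open>n powr (- (1 / p)) * x\<close> for \<open>x\<close> turns n x^p into
  x^p; the factor x^p contributes 1/n and dx contributes n^(-1/p). One finite integral remains,
  bounded through y <= (2/c) exp(c y / 2) and x^p >= x - 1. The last factor of \<open>A\<close> is
  the integral of exp(-c x / 2) over the half-line.\<close>

lemma nn_integral_powr_exp_scaling:
  fixes p c :: real
  assumes p: "p \<ge> 1" and c: "c > 0"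
  obtains A where "A > 0" "\<And>n. n > 0 \<Longrightarrow>
    (\<integral>\<^sup>+x\<in>{0<..}. ennreal (x powr p * exp (- n * c * x powr p)) \<partial>lborel) \<le> ennreal (A * n powr (- (1 + 1 / p)))"
proof -
  define A where "A = 2 / c * exp (c / 2) * (2 / c)"
  have bound: "(\<integral>\<^sup>+x\<in>{0<..}. ennreal (x powr p * exp (- c * x powr p)) \<partial>lborel) \<le> ennreal A"
  proof -
    have "x powr p * exp (- c * x powr p) \<le> 2 / c * exp (c / 2) * exp (- (c / 2) * x)" if x: "x > 0" for x
    proof -
      let ?y = "x powr p"
      have "c * ?y / 2 \<le> exp (c * ?y / 2)" using exp_ge_add_one_self[of "c * ?y / 2"] by linarith
      then have "?y \<le> 2 / c * exp (c * ?y / 2)" using c by (simp add: field_simps)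
      then have "?y * exp (- c * ?y) \<le> 2 / c * exp (c * ?y / 2) * exp (- c * ?y)"
        by (rule mult_right_mono) simp
      also have "\<dots> = 2 / c * exp (- (c / 2) * ?y)" by (simp flip: exp_add add: mult.assoc)
      also have "\<dots> \<le> 2 / c * exp (c / 2 + - (c / 2) * x)"
      proof -
        have "x - 1 \<le> ?y"
        proof (cases "x \<le> 1")
          case True
          then show ?thesis using powr_ge_zero[of x p] by linarith
        next
          case False
          then have "x powr 1 \<le> ?y" using p by (intro powr_mono) auto
          then show ?thesis using x by simp
        qed
        then have "c / 2 * (x - 1) \<le> c / 2 * ?y" using c by (intro mult_left_mono) auto
        then show ?thesis using c by (intro mult_left_mono) (auto simp: algebra_simps)
      qed
      also have "\<dots> = 2 / c * exp (c / 2) * exp (- (c / 2) * x)" unfolding exp_add by simp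
      finally show ?thesis .
    qed
    then have "(\<integral>\<^sup>+x\<in>{0<..}. ennreal (x powr p * exp (- c * x powr p)) \<partial>lborel) \<le>
        (\<integral>\<^sup>+x. ennreal (2 / c * exp (c / 2) * exp (- (c / 2) * x)) * indicator {0..} x \<partial>lborel)"
      by (intro nn_integral_mono) (auto split: split_indicator intro: ennreal_leI)
    also have "\<dots> = ennreal (0 - (- (2 / c) * (2 / c * exp (c / 2)) * exp (- (c / 2) * 0)))"
    proof (rule nn_integral_FTC_atLeast)
      show "((\<lambda>x. - (2 / c) * (2 / c * exp (c / 2)) * exp (- (c / 2) * x)) \<longlongrightarrow> 0) at_top"
      proof -
        have "((\<lambda>x. exp (- (c / 2) * x)) \<longlongrightarrow> 0) at_top"
          using c by (intro filterlim_compose[OF exp_at_bot] filterlim_tendsto_neg_mult_at_bot[OF tendsto_const])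
            (auto simp: filterlim_ident)
        from tendsto_mult_left[OF this, of "- (2 / c) * (2 / c * exp (c / 2))"] show ?thesis
          by (simp only: mult_zero_right)
      qed
    qed (use c in \<open>auto intro!: derivative_eq_intros\<close>)
    finally show ?thesis by (simp add: A_def mult_ac)
  qed
  have "(\<integral>\<^sup>+x\<in>{0<..}. ennreal (x powr p * exp (- n * c * x powr p)) \<partial>lborel) \<le> ennreal (A * n powr (- (1 + 1 / p)))"
    if n: "n > 0" for n
  proof -
    define a where "a = n powr (- (1 / p))"
    have a: "a > 0" using n by (simp add: a_def)
    have ap: "(a * x) powr p = x powr p / n" if "x > 0" for x
      using that n p a by (simp add: powr_mult a_def powr_powr powr_minus_divide powr_divide)
    have "(\<integral>\<^sup>+x\<in>{0<..}. ennreal (x powr p * exp (- n * c * x powr p)) \<partial>lborel) =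
        ennreal \<bar>a\<bar> * (\<integral>\<^sup>+x. ennreal ((0 + a * x) powr p * exp (- n * c * (0 + a * x) powr p)) * indicator {0<..} (0 + a * x) \<partial>lborel)"
      using a by (intro nn_integral_real_affine) auto
    also have "(\<integral>\<^sup>+x. ennreal ((0 + a * x) powr p * exp (- n * c * (0 + a * x) powr p)) * indicator {0<..} (0 + a * x) \<partial>lborel) =
        (\<integral>\<^sup>+x. ennreal (1 / n) * (ennreal (x powr p * exp (- c * x powr p)) * indicator {0<..} x) \<partial>lborel)"
      using a n by (intro nn_integral_cong)
        (auto split: split_indicator simp: ap zero_less_mult_iff simp flip: ennreal_mult')
    also have "\<dots> = ennreal (1 / n) * (\<integral>\<^sup>+x\<in>{0<..}. ennreal (x powr p * exp (- c * x powr p)) \<partial>lborel)"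
      by (rule nn_integral_cmult) measurable
    also have "ennreal \<bar>a\<bar> * \<dots> \<le> ennreal \<bar>a\<bar> * (ennreal (1 / n) * ennreal A)"
      by (intro mult_left_mono bound) auto
    also have "\<dots> = ennreal (a * (1 / n) * A)"
      using a n c by (simp add: ennreal_mult A_def flip: ennreal_mult' mult.assoc)
    also have "a * (1 / n) * A = A * n powr (- (1 + 1 / p))"
    proof -
      have "n powr (- (1 + 1 / p)) = n powr (- 1) * n powr (- (1 / p))"
        unfolding powr_add[symmetric] by (rule arg_cong) simp
      also have "n powr (- 1) = 1 / n" using n by (simp add: powr_minus_divide)
      finally show ?thesis by (simp add: a_def)
    qed
    finally show ?thesis .
  qed
  moreover have "A > 0" using c by (simp add: A_def)
  ultimately show ?thesis by (rule that[rotated])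
qed

text \<open>The factor n m is absorbed at the cost of half the exponent, by n m <= 2 exp(n m / 2 -
  1). The exponent \<open>n - 1\<close> instead of \<open>n\<close> costs a factor of at most e,
  which cancels against exp(-1).\<close>

lemma times_power_one_minus_le:
  fixes m :: real
  assumes m: "0 \<le> m" "m \<le> 1" and n: "n \<ge> 1"
  shows "real n * m * (1 - m) ^ (n - 1) \<le> 3 * exp (- real n * (m / 2))"
proof -
  have "(1 - m) ^ (n - 1) \<le> exp (- m) ^ (n - 1)"
    using m exp_ge_add_one_self[of "- m"] by (intro power_mono) auto
  also have "\<dots> = exp (- real (n - 1) * m)" by (simp flip: exp_of_nat_mult)
  also have "\<dots> = exp m * exp (- real n * m)" using n by (simp flip: exp_add add: of_nat_diff algebra_simps)
  also have "\<dots> \<le> exp 1 * exp (- real n * m)" using m by (intro mult_right_mono) auto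
  finally have "real n * m * (1 - m) ^ (n - 1) \<le> real n * m * (exp 1 * exp (- real n * m))"
    using m by (intro mult_left_mono) auto
  also have "\<dots> \<le> 2 * exp (real n * m / 2 - 1) * (exp 1 * exp (- real n * m))"
    using exp_ge_add_one_self[of "real n * m / 2 - 1"] by (intro mult_right_mono) auto
  also have "\<dots> = 2 * exp (- real n * (m / 2))"
    by (simp flip: exp_add add: mult.assoc)
  also have "\<dots> \<le> 3 * exp (- real n * (m / 2))" by simp
  finally show ?thesis .
qed

section \<open>Random hyperplanes in polar coordinates\<close>

definition polar_base :: "('a::euclidean_space \<times> real) measure" where
  "polar_base = sphere_measure \<Otimes>\<^sub>M restrict_space lborel {0..}"

lemma space_polar_base: "space polar_base = sphere 0 1 \<times> {0..}"
  by (simp add: polar_base_def space_pair_measure)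

lemma sets_polar_base_top [simp]: "sphere 0 1 \<times> {0..} \<in> sets polar_base"
  by (metis sets.top space_polar_base)

lemma fst_polar_base [measurable]: "fst \<in> borel_measurable polar_base"
  unfolding polar_base_def
  by (rule measurable_compose[OF measurable_fst])
     (auto simp: sphere_measure_def intro!: measurable_restrict_space1)

lemma snd_polar_base [measurable]: "snd \<in> borel_measurable polar_base"
  unfolding polar_base_def
  by (rule measurable_compose[OF measurable_snd]) (auto intro: measurable_restrict_space1)

lemma measurable_polar_base_swap:
  assumes "f \<in> borel_measurable (restrict_space borel (T \<times> sphere 0 1))" "{0..} \<subseteq> T"
  shows "(\<lambda>z. f (snd z, fst z)) \<in> borel_measurable (polar_base :: ('a::euclidean_space \<times> real) measure)"
proof (rule measurable_compose[OF measurable_restrict_space2 assms(1)])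
  show "(\<lambda>z. (snd z, fst z)) \<in> borel_measurable (polar_base :: ('a \<times> real) measure)"
    by (intro borel_measurable_Pair snd_polar_base fst_polar_base)
qed (use assms(2) in \<open>auto simp: space_polar_base\<close>)

lemma measurable_polar_base_fst:
  assumes "f \<in> borel_measurable (restrict_space borel (sphere 0 1))"
  shows "(\<lambda>z. f (fst z)) \<in> borel_measurable (polar_base :: ('a::euclidean_space \<times> real) measure)"
  by (rule measurable_compose[OF measurable_restrict_space2 assms])
     (auto simp: space_polar_base)

lemma nn_integral_polar_base:
  assumes "f \<in> borel_measurable (polar_base :: ('a::euclidean_space \<times> real) measure)"
  shows "(\<integral>\<^sup>+z. f z \<partial>polar_base) = (\<integral>\<^sup>+u. (\<integral>\<^sup>+t\<in>{0..}. f (u, t) \<partial>lborel) \<partial>sphere_measure)"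
proof -
  interpret L: sigma_finite_measure "restrict_space lborel {0::real..}"
    by (rule sigma_finite_measure_restrict_space) (auto intro: lborel.sigma_finite_measure_axioms)
  show ?thesis
    using L.nn_integral_fst[of f sphere_measure] assms
    by (simp add: polar_base_def nn_integral_restrict_space)
qed

text \<open>A hyperplane is encoded as \<open>(u, t)\<close> and a point \<open>s v\<close> as \<open>(v, s)\<close>, direction first, whereas the
  arguments of \<open>q\<close> and \<open>lam\<close> have the direction second.\<close>

definition cuts :: "('a::euclidean_space \<times> real) \<Rightarrow> ('a \<times> real) \<Rightarrow> bool" where
  "cuts p z \<longleftrightarrow> snd p < snd z * (fst p \<bullet> fst z)"

locale circumscribed_model = ball_convex_body K r0 R1 R
  for K :: "'a::euclidean_space set" and r0 R1 R +
  fixes q lam :: "real \<times> 'a \<Rightarrow> real"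
  assumes dim: "DIM('a) \<ge> 2"
    and q_meas: "q \<in> borel_measurable (restrict_space borel ({0..} \<times> sphere 0 1))"
    and q_concentrated:
      "AE (u, t) in sphere_measure \<Otimes>\<^sub>M restrict_space lborel {0..}. (t, u) \<notin> shell K \<longrightarrow> q (t, u) = 0"
    and q_pos_cont:
      "\<And>t u. (t, u) \<in> shell_boundary K \<Longrightarrow> q (t, u) > 0 \<and> continuous (at (t, u) within shell K) q"
    and q_prob: "emeasure (hyperplane_measure q) (admissible_hyperplanes K) = 1"
    and lam_meas: "lam \<in> borel_measurable (restrict_space borel (UNIV \<times> sphere 0 1))"
    and lam_nonneg: "\<And>t u. u \<in> sphere 0 1 \<Longrightarrow> lam (t, u) \<ge> 0"
    and lam_finite: "weighted_volume lam (outer_parallel K) < \<infinity>"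
    and lam_cont:
      "\<And>u. u \<in> sphere 0 1 \<Longrightarrow> continuous (at (radial_fun K u, u) within UNIV \<times> sphere 0 1) lam"
begin

abbreviation K1 where "K1 \<equiv> outer_parallel K"

section \<open>The law of the parameters and the weighted measure of points\<close>

definition cq where "cq = 1 / (real DIM('a) * measure lborel (cball (0::'a) 1))"

text \<open>The law of the pair (u, t) instead of the hyperplane, so that measurability is checked
  in a product of Borel spaces.\<close>

definition P :: "('a \<times> real) measure" where
  "P = density polar_base (\<lambda>(u, t). ennreal (cq * q (t, u)))"

text \<open>The polar integrand of the weighted volume, cut off outside \<open>K1\<close>. The
  cut-off makes the measure finite and builds the intersection with \<open>K1\<close> into
  it.\<close>

definition nu :: "('a \<times> real) measure" where
  "nu = density polar_base (\<lambda>(v, s). ennreal (indicator K1 (s *\<^sub>R v) * (s ^ (DIM('a) - 1) * lam (s, v))))"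

lemma cq_pos: "cq > 0"
  unfolding cq_def by (simp add: content_cball)

lemma q_meas' [measurable]: "(\<lambda>z. q (snd z, fst z)) \<in> borel_measurable polar_base"
  by (rule measurable_polar_base_swap[OF q_meas]) auto

lemma lam_meas' [measurable]: "(\<lambda>z. lam (snd z, fst z)) \<in> borel_measurable polar_base"
  by (rule measurable_polar_base_swap[OF lam_meas]) auto

lemma K1_meas [measurable]: "K1 \<in> sets borel"
  using compact_outer_parallel[OF compact] by (intro borel_closed compact_imp_closed)

lemma sets_P [measurable_cong, simp]: "sets P = sets polar_base"
  and space_P [simp]: "space P = sphere 0 1 \<times> {0..}"
  and sets_nu [measurable_cong, simp]: "sets nu = sets polar_base"
  and space_nu [simp]: "space nu = sphere 0 1 \<times> {0..}"
  by (simp_all add: P_def nu_def space_polar_base)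

lemma density_nu_meas [measurable]:
  "(\<lambda>(v, s). ennreal (indicator K1 (s *\<^sub>R v) * (s ^ (DIM('a) - 1) * lam (s, v)))) \<in> borel_measurable polar_base"
  unfolding case_prod_beta by measurable

lemma AE_P_shell: "AE p in P. (snd p, fst p) \<in> shell K"
  unfolding P_def
proof (subst AE_density)
  show "AE x in polar_base. 0 < (case x of (u, t) \<Rightarrow> ennreal (cq * q (t, u))) \<longrightarrow> (snd x, fst x) \<in> shell K"
    using q_concentrated unfolding polar_base_def by eventually_elim auto
qed measurable

lemma hyperplane_measure_eq: "hyperplane_measure q = distr P hyperplane_space (\<lambda>(u, t). hyperplane u t)"
proof (rule measure_eqI)
  fix A assume "A \<in> sets (hyperplane_measure q)"
  then have A: "A \<in> sets hyperplane_space" by (simp add: hyperplane_measure_def)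
  let ?f = "\<lambda>(u, t). hyperplane u t :: 'a set"
  have m: "?f \<in> measurable polar_base hyperplane_space"
    unfolding polar_base_def by (rule measurable_hyperplane)
  then have mP: "?f \<in> measurable P hyperplane_space" by simp
  let ?X = "?f -` A \<inter> space polar_base"
  have X [measurable]: "?X \<in> sets polar_base" by (rule measurable_sets[OF m A])
  have q1: "(\<lambda>(u, t). ennreal (q (t, u))) \<in> borel_measurable polar_base"
    unfolding case_prod_beta by measurable
  have "emeasure (distr P hyperplane_space ?f) A = emeasure P ?X"
    by (subst emeasure_distr[OF mP A]) (simp add: space_polar_base)
  also have "\<dots> = (\<integral>\<^sup>+z. (case z of (u, t) \<Rightarrow> ennreal (cq * q (t, u))) * indicator ?X z \<partial>polar_base)"
    unfolding P_def by (intro emeasure_density) measurable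
  also have "\<dots> = (\<integral>\<^sup>+z. ennreal cq * ((case z of (u, t) \<Rightarrow> ennreal (q (t, u))) * indicator ?X z) \<partial>polar_base)"
    using cq_pos by (intro nn_integral_cong) (auto simp: ennreal_mult' split: split_indicator)
  also have "\<dots> = ennreal cq * (\<integral>\<^sup>+z. (case z of (u, t) \<Rightarrow> ennreal (q (t, u))) * indicator ?X z \<partial>polar_base)"
    using q1 by (intro nn_integral_cmult) measurable
  also have "(\<integral>\<^sup>+z. (case z of (u, t) \<Rightarrow> ennreal (q (t, u))) * indicator ?X z \<partial>polar_base) =
      emeasure (density polar_base (\<lambda>(u, t). ennreal (q (t, u)))) ?X"
    using q1 by (intro emeasure_density[symmetric]) measurable
  also have "\<dots> = emeasure (distr (density polar_base (\<lambda>(u, t). ennreal (q (t, u)))) hyperplane_space ?f) A"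
    using m A by (subst emeasure_distr) (simp_all)
  finally show "emeasure (hyperplane_measure q) A = emeasure (distr P hyperplane_space ?f) A"
    by (simp add: hyperplane_measure_def emeasure_scale_measure cq_def polar_base_def)
qed (simp add: hyperplane_measure_def)

lemma measurable_hyperplane_P: "(\<lambda>(u, t). hyperplane u t) \<in> measurable P hyperplane_space"
  by (subst measurable_cong_sets[OF sets_P refl]) (unfold polar_base_def, rule measurable_hyperplane)

lemma shell_admissible:
  assumes tu: "(t, u) \<in> shell K"
  shows "hyperplane u t \<in> admissible_hyperplanes K"
proof -
  have u: "norm u = 1" and t: "0 \<le> t" "h u \<le> t" "t \<le> support_fun K1 u"
    using tu by (auto simp: shell_def)
  obtain y where y: "y \<in> K1" "u \<bullet> y = support_fun K1 u"
    using support_fun_attained[OF compact_outer_parallel[OF compact]] subset_outer_parallel[of K] zero_mem by blast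
  let ?H = "support_fun K1 u"
  have H: "0 < ?H" using t h_bounds[OF u] r0 by linarith
  have "(t / ?H) *\<^sub>R y + (1 - t / ?H) *\<^sub>R 0 \<in> K1"
    using t H y zero_mem subset_outer_parallel[of K]
    by (intro convexD[OF convex_outer_parallel[OF convex]]) auto
  then have "hyperplane u t \<inter> K1 \<noteq> {}" using y H by (force simp: hyperplane_def)
  moreover have "hyperplane u t \<inter> interior K = {}"
  proof (rule ccontr)
    assume "\<not> ?thesis"
    then obtain x where x: "u \<bullet> x = t" "x \<in> interior K" by (auto simp: hyperplane_def)
    then obtain e where e: "e > 0" "cball x e \<subseteq> K" by (auto simp: mem_interior_cball)
    have "x + e *\<^sub>R u \<in> K" using e u by (auto simp: dist_norm intro!: subsetD[OF e(2)])
    from support_fun_upper[OF compact this, of u] show False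
      using x e t u by (simp add: inner_add_right dot_square_norm)
  qed
  ultimately show ?thesis using u by (auto simp: admissible_hyperplanes_def space_hyperplane_space)
qed

text \<open>The total mass is prescribed only for the admissible hyperplanes. By concentration on
  the shell and \<open>shell_admissible\<close>, almost every parameter pair gives such a
  hyperplane.\<close>

lemma prob_space_P: "prob_space P"
proof
  \<comment> \<open>A nonmeasurable set would have measure 0, not 1.\<close>
  have A: "admissible_hyperplanes K \<in> sets (hyperplane_measure q)"
    using q_prob emeasure_notin_sets by fastforce
  then have A: "admissible_hyperplanes K \<in> sets hyperplane_space" by (simp add: hyperplane_measure_def)
  have "emeasure P (space P) = emeasure P ((\<lambda>(u, t). hyperplane u t) -` admissible_hyperplanes K \<inter> space P)"
  proof (rule emeasure_eq_AE)
    show "AE p in P. p \<in> space P \<longleftrightarrow> p \<in> (\<lambda>(u, t). hyperplane u t) -` admissible_hyperplanes K \<inter> space P"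
      using AE_P_shell by eventually_elim (auto dest: shell_admissible)
  qed (use measurable_sets[OF measurable_hyperplane_P A] in auto)
  also have "\<dots> = 1"
    using q_prob emeasure_distr[OF measurable_hyperplane_P A] by (simp add: hyperplane_measure_eq)
  finally show "emeasure P (space P) = 1" .
qed

text \<open>All representations (a, b) in the defining intersection give the same half-space:
  \<open>t > 0\<close> keeps 0 off the hyperplane and 0 lies in \<open>K\<close>, so
  \<open>b > 0\<close> and (a, b) is a positive multiple of (u, t).\<close>

lemma halfspace_containing_shell:
  assumes tu: "(t, u) \<in> shell K"
  shows "halfspace_containing K (hyperplane u t) = {y. u \<bullet> y \<le> t}"
proof -
  have u: "norm u = 1" and t: "h u \<le> t" using tu by (auto simp: shell_def)
  then have t0: "0 < t" using h_bounds[OF u] r0 by linarith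
  have same: "{y. a \<bullet> y \<le> b} = {y. u \<bullet> y \<le> t}"
    if a: "hyperplane u t = {y. a \<bullet> y = b}" "K \<subseteq> {y. a \<bullet> y \<le> b}" for a b
  proof -
    have tu': "t *\<^sub>R u \<in> hyperplane u t" using u by (simp add: hyperplane_def dot_square_norm)
    have "b \<ge> 0" using a(2) zero_mem by auto
    have "0 \<notin> hyperplane u t" using t0 by (simp add: hyperplane_def)
    then have "b > 0" using a(1) \<open>b \<ge> 0\<close> by (cases "b = 0") auto
    have "a \<bullet> y = b / t * (u \<bullet> y)" for y
    proof -
      \<comment> \<open>Pushing \<open>y\<close> along \<open>u\<close> onto the hyperplane
        determines \<open>a\<close> on the whole space.\<close>
      have "y + ((t - u \<bullet> y) *\<^sub>R u) \<in> hyperplane u t"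
        using u by (simp add: hyperplane_def inner_add_right dot_square_norm)
      then have "a \<bullet> y + (t - u \<bullet> y) * (a \<bullet> u) = b" using a(1) by (auto simp: inner_add_right)
      moreover have "t * (a \<bullet> u) = b" using tu' a(1) by auto
      ultimately show ?thesis using t0 by (simp add: field_simps)
    qed
    then have eq: "t * (a \<bullet> y) = t * (b / t * (u \<bullet> y))" for y by metis
    have eq: "t * (a \<bullet> y) = b * (u \<bullet> y)" for y unfolding eq using t0 by simp
    have "a \<bullet> y \<le> b \<longleftrightarrow> u \<bullet> y \<le> t" for y
    proof -
      have "a \<bullet> y \<le> b \<longleftrightarrow> t * (a \<bullet> y) \<le> t * b" using t0 by simp
      also have "\<dots> \<longleftrightarrow> b * (u \<bullet> y) \<le> b * t" unfolding eq mult.commute[of t b] ..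
      also have "\<dots> \<longleftrightarrow> u \<bullet> y \<le> t" using \<open>b > 0\<close> by simp
      finally show ?thesis .
    qed
    then show ?thesis by simp
  qed
  have "K \<subseteq> {y. u \<bullet> y \<le> t}" using support_fun_upper[OF compact, of _ u] t by force
  then have "{y. u \<bullet> y \<le> t} \<in> {{y. a \<bullet> y \<le> b} | a b. a \<noteq> 0 \<and> hyperplane u t = {y. a \<bullet> y = b} \<and> K \<subseteq> {y. a \<bullet> y \<le> b}}"
    using u by (intro CollectI exI[of _ u] exI[of _ t]) (auto simp: hyperplane_def)
  moreover have "X = {y. u \<bullet> y \<le> t}"
    if "X \<in> {{y. a \<bullet> y \<le> b} | a b. a \<noteq> 0 \<and> hyperplane u t = {y. a \<bullet> y = b} \<and> K \<subseteq> {y. a \<bullet> y \<le> b}}" for X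
    using that same by blast
  ultimately show ?thesis unfolding halfspace_containing_def by blast
qed

lemma weighted_volume_eq:
  assumes M: "convex M" "compact M" "0 \<in> M" "M \<subseteq> K1"
  shows "weighted_volume lam M = emeasure nu {z \<in> space nu. snd z *\<^sub>R fst z \<in> M}"
proof -
  have [measurable]: "M \<in> sets borel" using M by (intro borel_closed compact_imp_closed)
  have S: "{z \<in> space nu. snd z *\<^sub>R fst z \<in> M} \<in> sets polar_base"
    unfolding space_nu space_polar_base[symmetric] by measurable
  have meas: "(\<lambda>z. ennreal (snd z ^ (DIM('a) - 1) * lam (snd z, fst z)) * indicator M (snd z *\<^sub>R fst z))
      \<in> borel_measurable polar_base"
    by measurable
  have "emeasure nu {z \<in> space nu. snd z *\<^sub>R fst z \<in> M} =
      (\<integral>\<^sup>+z. (case z of (v, s) \<Rightarrow> ennreal (indicator K1 (s *\<^sub>R v) * (s ^ (DIM('a) - 1) * lam (s, v)))) *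
        indicator {z \<in> space nu. snd z *\<^sub>R fst z \<in> M} z \<partial>polar_base)"
    using S unfolding nu_def by (intro emeasure_density) auto
  also have "\<dots> = (\<integral>\<^sup>+z. ennreal (snd z ^ (DIM('a) - 1) * lam (snd z, fst z)) * indicator M (snd z *\<^sub>R fst z) \<partial>polar_base)"
    using M(4) by (intro nn_integral_cong) (auto simp: space_polar_base split: split_indicator)
  also have "\<dots> = (\<integral>\<^sup>+u. (\<integral>\<^sup>+t\<in>{0..}. ennreal (t ^ (DIM('a) - 1) * lam (t, u)) * indicator M (t *\<^sub>R u) \<partial>lborel) \<partial>sphere_measure)"
    unfolding nn_integral_polar_base[OF meas] by (simp only: fst_conv snd_conv)
  also have "\<dots> = weighted_volume lam M"
    unfolding weighted_volume_def
  proof (intro nn_integral_cong)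
    fix u :: 'a and t :: real assume "u \<in> space sphere_measure"
    then have "norm u = 1" by simp
    from radial_fun_iff[OF M(2,1,3) this, of t]
    show "ennreal (t ^ (DIM('a) - 1) * lam (t, u)) * indicator M (t *\<^sub>R u) * indicator {0..} t =
        ennreal (t ^ (DIM('a) - 1) * lam (t, u)) * indicator {0..radial_fun M u} t"
      by (auto simp: indicator_def)
  qed
  finally show ?thesis ..
qed

lemma AE_nu_K1: "AE z in nu. snd z *\<^sub>R fst z \<in> K1"
  unfolding nu_def AE_density[OF density_nu_meas]
  by (rule AE_I2) (auto split: split_indicator split_indicator_asm)

lemma finite_measure_nu: "finite_measure nu"
proof
  have "emeasure nu (space nu) = emeasure nu {z \<in> space nu. snd z *\<^sub>R fst z \<in> K1}"
  proof (rule emeasure_eq_AE)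
    show "AE z in nu. z \<in> space nu \<longleftrightarrow> z \<in> {z \<in> space nu. snd z *\<^sub>R fst z \<in> K1}"
      using AE_nu_K1 by eventually_elim auto
    show "{z \<in> space nu. snd z *\<^sub>R fst z \<in> K1} \<in> sets nu" by measurable
  qed simp
  also have "\<dots> = weighted_volume lam K1"
    using convex_outer_parallel[OF convex] compact_outer_parallel[OF compact] subset_outer_parallel[of K] zero_mem
    by (intro weighted_volume_eq[symmetric]) auto
  finally show "emeasure nu (space nu) \<noteq> \<infinity>" using lam_finite by simp
qed


section \<open>Hitting probabilities and the layer around the body\<close>

definition hit where "hit z = measure P {p \<in> space P. cuts p z}"
definition joint where "joint z z' = measure P {p \<in> space P. cuts p z \<and> cuts p z'}"
definition tau where "tau z = snd z - \<rho> (fst z)"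
definition pw where "pw = (real DIM('a) + 1) / 2"

lemma cuts_meas [measurable]: "Measurable.pred polar_base (\<lambda>p. cuts p z)"
  unfolding cuts_def by measurable

lemma rho_meas [measurable]: "(\<lambda>z. \<rho> (fst z)) \<in> borel_measurable polar_base"
  by (intro measurable_polar_base_fst borel_measurable_continuous_on_restrict continuous_rho)

lemma h_meas [measurable]: "(\<lambda>z. h (fst z)) \<in> borel_measurable polar_base"
  by (intro measurable_polar_base_fst borel_measurable_continuous_on_restrict continuous_support)

lemma tau_meas [measurable]: "tau \<in> borel_measurable polar_base"
  unfolding tau_def by measurable

lemma pw: "pw \<ge> 1" using dim by (simp add: pw_def)

text \<open>The origin of \<open>pw\<close>: thickness \<open>x\<close> over a cap of radius sqrt x
  gives the exponent 1 + (d - 1) / 2.\<close>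

lemma times_sqrt_power: "x * sqrt x ^ (DIM('a) - 1) = x powr pw" if "x > 0" for x
proof -
  have "sqrt x ^ (DIM('a) - 1) = x powr (real (DIM('a) - 1) / 2)"
    using that by (simp add: powr_half_sqrt[symmetric] powr_realpow[symmetric] powr_powr)
  then have "x * sqrt x ^ (DIM('a) - 1) = x powr (1 + real (DIM('a) - 1) / 2)"
    using that by (simp add: powr_add)
  also have "1 + real (DIM('a) - 1) / 2 = pw" using dim by (simp add: pw_def of_nat_diff field_simps)
  finally show ?thesis .
qed

lemma support_outer_ge: "h u + 1 \<le> support_fun K1 u" if u: "norm u = 1"
proof -
  obtain x where x: "x \<in> K" "u \<bullet> x = h u" using support_fun_attained[OF compact] zero_mem by blast
  have "x + u \<in> K1" unfolding outer_parallel_def using x u by (intro set_plus_intro) auto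
  from support_fun_upper[OF compact_outer_parallel[OF compact] this, of u]
  show ?thesis using x u by (simp add: inner_add_right dot_square_norm)
qed

text \<open>\<open>uniform_bound_near_graph\<close> wants a condition that weakens as the constant
  grows, hence the form \<open>1 / b\<close>. Up to height 1 above \<open>h u\<close> the pairs
  belong to the shell, where continuity of \<open>q\<close> is available; hence
  \<open>min \<epsilon> 1\<close>.\<close>

lemma q_lower:
  obtains b \<epsilon> where "b > 0" "\<epsilon> > 0"
    "\<And>t u. norm u = 1 \<Longrightarrow> h u \<le> t \<Longrightarrow> t < h u + \<epsilon> \<Longrightarrow> b \<le> q (t, u)"
proof -
  have bd: "(h u, u) \<in> shell_boundary K" if "u \<in> sphere 0 1" for u
    using that h_bounds(1)[of u] r0 by (auto simp: shell_boundary_def)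
  obtain b \<epsilon> where b: "b > 0" "\<epsilon> > 0" "\<And>t u. u \<in> sphere 0 1 \<Longrightarrow> (t, u) \<in> shell K \<Longrightarrow> \<bar>t - h u\<bar> < \<epsilon> \<Longrightarrow> 1 / b \<le> q (t, u)"
  proof (rule uniform_bound_near_graph[of "sphere 0 1" h "\<lambda>b z. 1 / b \<le> q z" "shell K"])
    show "continuous_on (sphere 0 1) h" by (rule continuous_support)
    show "1 / b' \<le> q z" if "b \<le> b'" "0 < b" "1 / b \<le> q z" for b b' :: real and z
      using that frac_le[of 1 1 b b'] by linarith
    fix u :: 'a assume u: "u \<in> sphere 0 1"
    have q: "q (h u, u) > 0" "(q \<longlongrightarrow> q (h u, u)) (at (h u, u) within shell K)"
      using q_pos_cont[OF bd[OF u]] by (auto simp: continuous_within)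
    have "\<forall>\<^sub>F z in at (h u, u) within shell K. q (h u, u) / 2 < q z"
      using q by (intro order_tendstoD(1)[OF q(2)]) auto
    then have "\<forall>\<^sub>F z in at (h u, u) within shell K. 1 / (2 / q (h u, u)) \<le> q z"
      by eventually_elim auto
    then show "\<exists>b>0. \<forall>\<^sub>F z in at (h u, u) within shell K. 1 / b \<le> q z"
      using q by (intro exI[of _ "2 / q (h u, u)"]) auto
    show "\<exists>b>0. 1 / b \<le> q (h u, u)" using q by (intro exI[of _ "1 / q (h u, u)"]) auto
  qed auto
  show ?thesis
  proof (rule that[of "1 / b" "min \<epsilon> 1"])
    fix t u assume u: "norm (u :: 'a) = 1" "h u \<le> t" "t < h u + min \<epsilon> 1"
    then have "(t, u) \<in> shell K"
      using h_bounds(1)[OF u(1)] r0 support_outer_ge[OF u(1)] by (auto simp: shell_def)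
    then show "1 / b \<le> q (t, u)" using u by (intro b) auto
  qed (use b in auto)
qed

text \<open>By \<open>separating_gap\<close>, all parameters with normal in a cap of radius of order
  sqrt \<tau> about \<open>u0\<close> and with height in a layer of thickness
  \<open>\<tau> * \<beta> / 2\<close> above \<open>h\<close> cut the point off. Truncating at
  \<open>\<tau>0\<close> keeps this layer where \<open>q\<close> is bounded below.\<close>

lemma hit_lower:
  obtains c \<tau>0 where "c > 0" "\<tau>0 > 0"
    "\<And>z. z \<in> space nu \<Longrightarrow> 0 < tau z \<Longrightarrow> c * min (tau z) \<tau>0 powr pw \<le> hit z"
proof -
  interpret P: prob_space P by (rule prob_space_P)
  obtain b \<epsilon> where b: "b > 0" "\<epsilon> > 0" "\<And>t u. norm u = 1 \<Longrightarrow> h u \<le> t \<Longrightarrow> t < h u + \<epsilon> \<Longrightarrow> b \<le> q (t, u)"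
    using q_lower by blast
  obtain c1 where c1: "c1 > 0" "\<And>(u::'a) r. norm u = 1 \<Longrightarrow> 0 < r \<Longrightarrow> r \<le> 1 \<Longrightarrow>
      ennreal (c1 * r ^ (DIM('a) - 1)) \<le> emeasure sphere_measure (sphere_cap u r)"
    using emeasure_sphere_cap_lower[OF dim] by blast
  \<comment> \<open>The two terms serve the quadratic and the linear condition on the tilt in
    \<open>separating_gap\<close>, as \<tau> is at most 1.\<close>
  define \<kappa> where "\<kappa> = min (sqrt (\<beta> / R)) \<beta>"
  have \<kappa>: "0 < \<kappa>" "\<kappa> \<le> \<beta>" "\<kappa>\<^sup>2 \<le> \<beta> / R"
  proof -
    show "0 < \<kappa>" "\<kappa> \<le> \<beta>" using beta R by (auto simp: \<kappa>_def)
    then have "\<kappa>\<^sup>2 \<le> (sqrt (\<beta> / R))\<^sup>2" by (intro power_mono) (auto simp: \<kappa>_def)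
    then show "\<kappa>\<^sup>2 \<le> \<beta> / R" using beta R by simp
  qed
  define c where "c = cq * b * (\<beta> / 2) * c1 * \<kappa> ^ (DIM('a) - 1)"
  have "c * min (tau z) (min 1 \<epsilon>) powr pw \<le> hit z" if z: "z \<in> space nu" "0 < tau z" for z
  proof -
    define \<tau> where "\<tau> = min (tau z) (min 1 \<epsilon>)"
    have \<tau>: "0 < \<tau>" "\<tau> \<le> 1" "\<tau> \<le> \<epsilon>" "\<tau> \<le> tau z" using z b by (auto simp: \<tau>_def)
    define v where "v = fst z"
    have v: "norm v = 1" using z by (auto simp: v_def)
    obtain u0 where u0: "norm u0 = 1" "u0 \<bullet> (\<rho> v *\<^sub>R v) = h u0" using rho_frontier_normal[OF v] .
    define r where "r = \<kappa> * sqrt \<tau>"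
    have r: "0 < r" "r \<le> \<beta>" "r \<le> 1" "r\<^sup>2 \<le> \<beta> * \<tau> / R"
    proof -
      show "0 < r" using \<kappa> \<tau> by (simp add: r_def)
      have "r \<le> \<kappa> * 1" unfolding r_def using \<kappa> \<tau> by (intro mult_left_mono) auto
      then show "r \<le> \<beta>" "r \<le> 1" using \<kappa> beta by auto
      have "r\<^sup>2 = \<kappa>\<^sup>2 * \<tau>" using \<tau> by (simp add: r_def power_mult_distrib)
      also have "\<dots> \<le> \<beta> / R * \<tau>" using \<kappa> \<tau> by (intro mult_right_mono) auto
      finally show "r\<^sup>2 \<le> \<beta> * \<tau> / R" by simp
    qed
    define A where "A = {p \<in> space polar_base. dist u0 (fst p) \<le> r \<and> h (fst p) < snd p \<and> snd p < h (fst p) + \<tau> * \<beta> / 2}"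
    have [measurable]: "A \<in> sets polar_base" unfolding A_def by measurable
    have sub: "A \<subseteq> {p \<in> space P. cuts p z}"
    proof
      fix p assume p: "p \<in> A"
      let ?u = "fst p"
      have u: "norm ?u = 1" "norm (?u - u0) \<le> r"
        using p by (auto simp: A_def space_polar_base dist_norm norm_minus_commute)
      from u(2) have "(norm (?u - u0))\<^sup>2 \<le> r\<^sup>2" by (rule power_mono) simp
      with r(4) have "(norm (?u - u0))\<^sup>2 \<le> \<beta> * \<tau> / R" by linarith
      then have "h ?u + \<tau> * \<beta> / 2 \<le> ?u \<bullet> ((\<rho> v + \<tau>) *\<^sub>R v)"
        using r u \<tau> by (intro separating_gap[OF v _ u0]) auto
      then have lt: "snd p < (\<rho> v + \<tau>) * (?u \<bullet> v)" using p by (simp add: A_def)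
      moreover have "0 < snd p" using p h_bounds(1)[OF u(1)] r0 by (auto simp: A_def)
      \<comment> \<open>So far only the point at truncated distance \<tau> is cut off. As
        \<open>?u\<close> has positive inner product with \<open>v\<close>, so is \<open>z\<close>,
        which lies at least as far out on the same ray.\<close>
      ultimately have "0 < (\<rho> v + \<tau>) * (?u \<bullet> v)" by linarith
      then have "0 < ?u \<bullet> v" using rho_bounds(1)[OF v] r0 \<tau> by (simp add: zero_less_mult_iff)
      then have "(\<rho> v + \<tau>) * (?u \<bullet> v) \<le> snd z * (?u \<bullet> v)"
        using \<tau>(4) by (intro mult_right_mono) (auto simp: tau_def v_def)
      then show "p \<in> {p \<in> space P. cuts p z}"
        using lt p by (auto simp: cuts_def v_def A_def space_polar_base)
    qed
    have inner: "(\<integral>\<^sup>+t\<in>{0..}. ennreal (cq * b) * indicator A (u, t) \<partial>lborel) =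
        ennreal (cq * b * (\<tau> * \<beta> / 2)) * indicator (sphere_cap u0 r) u" if u: "u \<in> space sphere_measure" for u
    proof (cases "u \<in> cball u0 r")
      case True
      have "(\<integral>\<^sup>+t\<in>{0..}. ennreal (cq * b) * indicator A (u, t) \<partial>lborel) =
          (\<integral>\<^sup>+t. ennreal (cq * b) * indicator {h u<..<h u + \<tau> * \<beta> / 2} t \<partial>lborel)"
        using True u h_bounds(1)[of u] r0
        by (intro nn_integral_cong) (auto simp: A_def space_polar_base split: split_indicator)
      also have "\<dots> = ennreal (cq * b) * ennreal (\<tau> * \<beta> / 2)"
        using \<tau> beta by (subst nn_integral_cmult_indicator) auto
      finally show ?thesis using True u cq_pos b by (simp add: sphere_cap_def flip: ennreal_mult')
    qed (auto simp: A_def sphere_cap_def)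
    have "ennreal (c * \<tau> powr pw) = ennreal (cq * b * (\<tau> * \<beta> / 2)) * ennreal (c1 * r ^ (DIM('a) - 1))"
    proof -
      have eq: "c * \<tau> powr pw = cq * b * (\<tau> * \<beta> / 2) * (c1 * r ^ (DIM('a) - 1))"
        unfolding times_sqrt_power[OF \<tau>(1), symmetric] c_def r_def power_mult_distrib by simp
      show ?thesis unfolding eq using cq_pos b(1) \<tau>(1) beta(1) by (intro ennreal_mult') simp
    qed
    also have "\<dots> \<le> ennreal (cq * b * (\<tau> * \<beta> / 2)) * emeasure sphere_measure (sphere_cap u0 r)"
      using r u0 by (intro mult_left_mono c1) auto
    also have "\<dots> = (\<integral>\<^sup>+u. ennreal (cq * b * (\<tau> * \<beta> / 2)) * indicator (sphere_cap u0 r) u \<partial>sphere_measure)"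
      by (rule nn_integral_cmult_indicator[symmetric]) (rule sphere_cap_sets)
    also have "\<dots> = (\<integral>\<^sup>+u. (\<integral>\<^sup>+t\<in>{0..}. ennreal (cq * b) * indicator A (u, t) \<partial>lborel) \<partial>sphere_measure)"
      by (intro nn_integral_cong inner[symmetric])
    also have "\<dots> = (\<integral>\<^sup>+p. ennreal (cq * b) * indicator A p \<partial>polar_base)"
      by (rule nn_integral_polar_base[symmetric]) measurable
    also have "\<dots> \<le> (\<integral>\<^sup>+p. (case p of (u, t) \<Rightarrow> ennreal (cq * q (t, u))) * indicator A p \<partial>polar_base)"
    proof (rule nn_integral_mono)
      fix p :: "'a \<times> real"
      have "b \<le> q (snd p, fst p)" if p: "p \<in> A"
      proof (rule b(3))
        have "\<tau> * \<beta> \<le> \<epsilon> * 1" using \<tau> beta b by (intro mult_mono) auto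
        then show "snd p < h (fst p) + \<epsilon>" using p b(2) by (auto simp: A_def)
      qed (use p in \<open>auto simp: A_def space_polar_base\<close>)
      then show "ennreal (cq * b) * indicator A p \<le> (case p of (u, t) \<Rightarrow> ennreal (cq * q (t, u))) * indicator A p"
        using cq_pos by (auto split: split_indicator simp: case_prod_beta intro!: ennreal_leI)
    qed
    also have "\<dots> = emeasure P A"
      unfolding P_def by (rule emeasure_density[symmetric]) measurable
    also have "\<dots> \<le> emeasure P {p \<in> space P. cuts p z}"
      by (intro emeasure_mono sub) measurable
    also have "\<dots> = ennreal (hit z)" by (simp add: hit_def P.emeasure_eq_measure)
    finally show ?thesis by (simp add: \<tau>_def hit_def)
  qed
  then show ?thesis using cq_pos b \<kappa> beta c1 by (intro that[of c "min 1 \<epsilon>"]) (auto simp: c_def)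
qed

text \<open>Turns positive probability into one concrete hyperplane, to which the deterministic
  estimates apply.\<close>

lemma joint_imp_common_cut:
  assumes "joint z z' \<noteq> 0"
  obtains u t where "(t, u) \<in> shell K" "cuts (u, t) z" "cuts (u, t) z'"
proof (rule ccontr)
  assume "\<not> thesis"
  with that have no: "\<And>t u. (t, u) \<in> shell K \<Longrightarrow> \<not> (cuts (u, t) z \<and> cuts (u, t) z')" by blast
  have "AE p in P. \<not> (cuts p z \<and> cuts p z')"
    using AE_P_shell by eventually_elim (use no in force)
  from emeasure_eq_0_AE[OF this] show False using assms by (simp add: joint_def measure_def)
qed

text \<open>Near the boundary \<open>lam\<close> is bounded, so there \<open>nu\<close> is dominated
  by a multiple of the product of sphere measure and Lebesgue measure in \<open>tau\<close>. General
  \<open>V\<close> and \<open>G\<close> let this serve for the inner integral over a cap and for the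
  outer one over the whole sphere.\<close>

lemma nu_shell_le:
  obtains \<Lambda> \<epsilon> where "\<Lambda> > 0" "\<epsilon> > 0"
    "\<And>V G. V \<in> sets borel \<Longrightarrow> G \<in> borel_measurable borel \<Longrightarrow>
      (\<integral>\<^sup>+z. indicator V (fst z) * (indicator {0<..<\<epsilon>} (tau z) * G (tau z)) \<partial>nu) \<le>
        ennreal \<Lambda> * emeasure sphere_measure (V \<inter> sphere 0 1) * (\<integral>\<^sup>+x\<in>{0<..<\<epsilon>}. G x \<partial>lborel)"
proof -
  obtain b \<epsilon> where b: "b > 0" "\<epsilon> > 0" "\<And>t u. u \<in> sphere 0 1 \<Longrightarrow> (t, u) \<in> UNIV \<times> sphere 0 1 \<Longrightarrow> \<bar>t - \<rho> u\<bar> < \<epsilon> \<Longrightarrow> lam (t, u) \<le> b"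
  proof (rule uniform_bound_near_graph[of "sphere 0 1" \<rho> "\<lambda>b z. lam z \<le> b" "UNIV \<times> sphere 0 1"])
    show "continuous_on (sphere 0 1) \<rho>" by (rule continuous_rho)
    fix u :: 'a assume u: "u \<in> sphere 0 1"
    have l: "(lam \<longlongrightarrow> lam (\<rho> u, u)) (at (\<rho> u, u) within UNIV \<times> sphere 0 1)"
      using lam_cont[OF u] by (simp add: continuous_within)
    have "\<forall>\<^sub>F z in at (\<rho> u, u) within UNIV \<times> sphere 0 1. lam z < lam (\<rho> u, u) + 1"
      by (intro order_tendstoD(2)[OF l]) auto
    then have "\<forall>\<^sub>F z in at (\<rho> u, u) within UNIV \<times> sphere 0 1. lam z \<le> lam (\<rho> u, u) + 1"
      by eventually_elim auto
    then show "\<exists>b>0. \<forall>\<^sub>F z in at (\<rho> u, u) within UNIV \<times> sphere 0 1. lam z \<le> b"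
      using lam_nonneg[OF u, of "\<rho> u"] by (intro exI[of _ "lam (\<rho> u, u) + 1"]) auto
    show "\<exists>b>0. lam (\<rho> u, u) \<le> b"
      using lam_nonneg[OF u, of "\<rho> u"] by (intro exI[of _ "lam (\<rho> u, u) + 1"]) auto
  qed auto
  define e where "e = min \<epsilon> 1"
  \<comment> \<open>In the layer the distance from the origin is at most \<open>R1 + 1\<close>,
    because \<open>e \<le> 1\<close>.\<close>
  define \<Lambda> where "\<Lambda> = (R1 + 1) ^ (DIM('a) - 1) * b"
  have e: "0 < e" "e \<le> \<epsilon>" "e \<le> 1" using b by (auto simp: e_def)
  have \<Lambda>: "\<Lambda> > 0" using r0 r0_le_R1 b by (simp add: \<Lambda>_def)
  show ?thesis
  proof (rule that[OF \<Lambda> e(1)])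
    fix V :: "'a set" and G :: "real \<Rightarrow> ennreal"
    assume [measurable]: "V \<in> sets borel" "G \<in> borel_measurable borel"
    let ?f = "\<lambda>z. indicator V (fst z) * (indicator {0<..<e} (tau z) * G (tau z))"
    have VS: "V \<inter> sphere 0 1 \<in> sets sphere_measure"
      unfolding sets_sphere_measure sets_restrict_space by (intro image_eqI[of _ _ V]) auto
    have "(\<integral>\<^sup>+z. ?f z \<partial>nu) = (\<integral>\<^sup>+z. (case z of (v, s) \<Rightarrow> ennreal (indicator K1 (s *\<^sub>R v) * (s ^ (DIM('a) - 1) * lam (s, v)))) * ?f z \<partial>polar_base)"
      unfolding nu_def by (rule nn_integral_density) measurable
    also have "\<dots> \<le> (\<integral>\<^sup>+z. ennreal \<Lambda> * ?f z \<partial>polar_base)"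
    proof (rule nn_integral_mono)
      fix z :: "'a \<times> real" assume z: "z \<in> space polar_base"
      obtain v s where vs: "z = (v, s)" "norm v = 1" "0 \<le> s" using z by (auto simp: space_polar_base)
      have "ennreal (indicator K1 (s *\<^sub>R v) * (s ^ (DIM('a) - 1) * lam (s, v))) \<le> ennreal \<Lambda>"
        if t: "0 < tau z" "tau z < e"
      proof (rule ennreal_leI)
        have l: "0 \<le> lam (s, v)" "lam (s, v) \<le> b"
          using lam_nonneg[of v s] b(3)[of v s] vs t e by (auto simp: tau_def)
        have "s ^ (DIM('a) - 1) * lam (s, v) \<le> \<Lambda>"
          unfolding \<Lambda>_def using vs t e rho_bounds(2)[OF vs(2)] l
          by (intro mult_mono power_mono) (auto simp: tau_def)
        then show "indicator K1 (s *\<^sub>R v) * (s ^ (DIM('a) - 1) * lam (s, v)) \<le> \<Lambda>"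
          using \<Lambda> by (auto split: split_indicator)
      qed
      then show "(case z of (v, s) \<Rightarrow> ennreal (indicator K1 (s *\<^sub>R v) * (s ^ (DIM('a) - 1) * lam (s, v)))) * ?f z \<le> ennreal \<Lambda> * ?f z"
        unfolding vs(1) by (auto split: split_indicator intro: mult_right_mono)
    qed
    also have "\<dots> = ennreal \<Lambda> * (\<integral>\<^sup>+z. ?f z \<partial>polar_base)"
      by (rule nn_integral_cmult) measurable
    finally have nu_le: "(\<integral>\<^sup>+z. ?f z \<partial>nu) \<le> ennreal \<Lambda> * (\<integral>\<^sup>+z. ?f z \<partial>polar_base)" .
    have "(\<integral>\<^sup>+z. ?f z \<partial>polar_base) = (\<integral>\<^sup>+u. (\<integral>\<^sup>+t\<in>{0..}. ?f (u, t) \<partial>lborel) \<partial>sphere_measure)"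
      by (rule nn_integral_polar_base) measurable
    also have "\<dots> \<le> (\<integral>\<^sup>+u. (\<integral>\<^sup>+x\<in>{0<..<e}. G x \<partial>lborel) * indicator (V \<inter> sphere 0 1) u \<partial>sphere_measure)"
    proof (rule nn_integral_mono)
      fix u :: 'a assume u: "u \<in> space sphere_measure"
      show "(\<integral>\<^sup>+t\<in>{0..}. ?f (u, t) \<partial>lborel) \<le> (\<integral>\<^sup>+x\<in>{0<..<e}. G x \<partial>lborel) * indicator (V \<inter> sphere 0 1) u"
      proof (cases "u \<in> V")
        case True
        \<comment> \<open>Dropping the restriction to nonnegative \<open>t\<close> leaves a pure
          translation by \<open>\<rho> u\<close>.\<close>
        have "(\<integral>\<^sup>+t\<in>{0..}. ?f (u, t) \<partial>lborel) \<le> (\<integral>\<^sup>+t. G (t - \<rho> u) * indicator {0<..<e} (t - \<rho> u) \<partial>lborel)"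
          by (intro nn_integral_mono) (auto simp: tau_def split: split_indicator)
        also have "\<dots> = (\<integral>\<^sup>+x\<in>{0<..<e}. G x \<partial>lborel)"
          by (subst nn_integral_real_affine[of "\<lambda>x. G x * indicator {0<..<e} x" 1 "- \<rho> u"]) simp_all
        finally show ?thesis using True u by simp
      qed simp
    qed
    also have "\<dots> = (\<integral>\<^sup>+x\<in>{0<..<e}. G x \<partial>lborel) * emeasure sphere_measure (V \<inter> sphere 0 1)"
      using VS by (rule nn_integral_cmult_indicator)
    finally have "ennreal \<Lambda> * (\<integral>\<^sup>+z. ?f z \<partial>polar_base) \<le>
        ennreal \<Lambda> * ((\<integral>\<^sup>+x\<in>{0<..<e}. G x \<partial>lborel) * emeasure sphere_measure (V \<inter> sphere 0 1))"
      by (intro mult_left_mono) auto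
    from order_trans[OF nu_le this]
    show "(\<integral>\<^sup>+z. ?f z \<partial>nu) \<le> ennreal \<Lambda> * emeasure sphere_measure (V \<inter> sphere 0 1) * (\<integral>\<^sup>+x\<in>{0<..<e}. G x \<partial>lborel)"
      by (simp only: mult_ac)
  qed
qed
end

section \<open>The variance estimate\<close>

text \<open>For the points beyond the layer. The target exponent 1 + 1/p is at most 2, so a
  quadratic lower bound for exp is enough.\<close>

lemma exp_minus_le_powr:
  assumes c: "c > 0" and a: "a \<le> 2" and n: "n \<ge> 1"
  shows "exp (- real n * c) \<le> 4 / c\<^sup>2 * real n powr (- a)"
proof -
  have "real n * c / 2 \<le> exp (real n * c / 2)"
    using exp_ge_add_one_self[of "real n * c / 2"] by linarith
  then have "(real n * c / 2)\<^sup>2 \<le> (exp (real n * c / 2))\<^sup>2"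
    using c by (intro power_mono) auto
  also have "\<dots> = exp (real n * c)" by (simp flip: exp_double)
  finally have "1 \<le> exp (real n * c) * (4 / (c\<^sup>2 * (real n)\<^sup>2))"
    using c n by (simp add: field_simps power2_eq_square)
  then have "exp (- real n * c) * 1 \<le> exp (- real n * c) * (exp (real n * c) * (4 / (c\<^sup>2 * (real n)\<^sup>2)))"
    by (intro mult_left_mono) auto
  also have "\<dots> = 4 / c\<^sup>2 * real n powr (- 2)"
    using n by (simp add: powr_minus_divide powr_numeral flip: exp_add mult.assoc)
  also have "\<dots> \<le> 4 / c\<^sup>2 * real n powr (- a)"
    using a n by (intro mult_left_mono powr_mono) auto
  finally show ?thesis by simp
qed

context circumscribed_model
begin

lemma tau_pos_if_cut:
  assumes z: "z \<in> space nu" and tu: "(t, u) \<in> shell K" "cuts (u, t) z"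
  shows "0 < tau z"
proof (rule ccontr)
  assume "\<not> 0 < tau z"
  then have "snd z *\<^sub>R fst z \<in> K"
    using z rho_iff[of "fst z" "snd z"] by (auto simp: tau_def)
  from support_fun_upper[OF compact this, of u] show False
    using tu by (auto simp: shell_def cuts_def)
qed

lemma hit_bounds: "0 \<le> hit z" "hit z \<le> 1"
  by (simp_all add: hit_def prob_space.prob_le_1[OF prob_space_P])

lemma joint_bounds: "0 \<le> joint z z'" "joint z z' \<le> hit z" "joint z z' = joint z' z"
proof -
  interpret P: prob_space P by (rule prob_space_P)
  have "{p \<in> space P. cuts p z} \<in> sets P" by measurable
  then show "joint z z' \<le> hit z" unfolding joint_def hit_def
    by (intro P.finite_measure_mono) auto
  show "joint z z' = joint z' z" unfolding joint_def by (simp only: conj_commute)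
qed (simp add: joint_def)

definition closeness where "closeness = 8 * sqrt (2 * R * R1 / r0) / r0"

lemma closeness_pos: "closeness > 0"
  using r0 R r0_le_R1 by (simp add: closeness_def)

section \<open>A majorant for the double integral\<close>

text \<open>Bounds the integrand for pairs in which \<open>z\<close> is at least as far out as
  \<open>z'\<close>. The exponential depends on \<open>z\<close> alone; \<open>z'\<close> enters
  only through where the kernel vanishes. Closeness of directions is demanded only up to
  \<open>\<tau>1\<close>, the range of \<open>common_separation_close\<close>.\<close>

definition overlap_kernel where
  "overlap_kernel c \<tau>1 n z z' =
     (if 0 < tau z' \<and> tau z' \<le> tau z \<and>
         (tau z \<le> \<tau>1 \<longrightarrow> dist (fst z) (fst z') \<le> closeness * sqrt (tau z))
      then ennreal (3 * exp (- real n * (c / 2 * min (tau z) \<tau>1 powr pw))) else 0)"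

lemma overlap_kernel_meas:
  "case_prod (overlap_kernel c \<tau>1 n) \<in> borel_measurable (polar_base \<Otimes>\<^sub>M polar_base)"
  unfolding overlap_kernel_def case_prod_beta by measurable

text \<open>Of the maximum only \<open>hit z\<close> for the farther point \<open>z\<close> is kept,
  which is allowed even if it is the smaller one. With \<open>joint z z' \<le> hit z\<close>,
  \<open>times_power_one_minus_le\<close> applies. Adding the kernel with its arguments exchanged
  covers both orders.\<close>

lemma integrand_le_overlap_kernel:
  assumes c: "c > 0" and \<tau>1: "\<tau>1 > 0" "\<tau>1 \<le> r0"
    and hit: "\<And>z. z \<in> space nu \<Longrightarrow> 0 < tau z \<Longrightarrow> c * min (tau z) \<tau>1 powr pw \<le> hit z"
    and n: "n \<ge> 1" and z: "z \<in> space nu" "z' \<in> space nu"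
  shows "ennreal (real n * joint z z' * (1 - max (hit z) (hit z')) ^ (n - 1)) \<le>
    overlap_kernel c \<tau>1 n z z' + overlap_kernel c \<tau>1 n z' z"
proof -
  have ordered: "ennreal (real n * joint z z' * (1 - max (hit z) (hit z')) ^ (n - 1)) \<le> overlap_kernel c \<tau>1 n z z'"
    if le: "tau z' \<le> tau z" and z: "z \<in> space nu" "z' \<in> space nu" and nz: "joint z z' \<noteq> 0" for z z'
  proof -
    obtain u t where tu: "(t, u) \<in> shell K" "cuts (u, t) z" "cuts (u, t) z'"
      using joint_imp_common_cut[OF nz] .
    have pos: "0 < tau z'" "0 < tau z" using tau_pos_if_cut[OF z(2) tu(1,3)] le by auto
    have close: "dist (fst z) (fst z') \<le> closeness * sqrt (tau z)" if "tau z \<le> \<tau>1"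
    proof -
      have "h u \<le> t" "norm u = 1" using tu(1) by (auto simp: shell_def)
      then show ?thesis unfolding closeness_def dist_norm
        using z pos le that \<tau>1 tu(2,3)
        by (intro common_separation_close[of _ _ "tau z'" _ u]) (auto simp: tau_def cuts_def)
    qed
    have "real n * joint z z' * (1 - max (hit z) (hit z')) ^ (n - 1) \<le> real n * hit z * (1 - hit z) ^ (n - 1)"
      using hit_bounds[of z] hit_bounds[of z'] joint_bounds[of z z']
      by (intro mult_mono power_mono mult_nonneg_nonneg zero_le_power) auto
    also have "\<dots> \<le> 3 * exp (- real n * (hit z / 2))"
      using hit_bounds[of z] n by (intro times_power_one_minus_le) auto
    also have "\<dots> \<le> 3 * exp (- real n * (c / 2 * min (tau z) \<tau>1 powr pw))"
      using hit[OF z(1) pos(2)] by (simp add: mult_left_mono)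
    finally show ?thesis using le pos close by (auto simp: overlap_kernel_def intro: ennreal_leI)
  qed
  show ?thesis
  proof (cases "joint z z' = 0")
    case False
    show ?thesis
    proof (cases "tau z' \<le> tau z")
      case True
      from ordered[OF True z False] show ?thesis by (rule order_trans) simp
    next
      case F: False
      then have "tau z \<le> tau z'" by simp
      have nz: "joint z' z \<noteq> 0" using False joint_bounds(3)[of z z'] by (simp only: not_False_eq_True)
      have "ennreal (real n * joint z z' * (1 - max (hit z) (hit z')) ^ (n - 1)) \<le> overlap_kernel c \<tau>1 n z' z"
        using ordered[OF \<open>tau z \<le> tau z'\<close> z(2,1) nz]
        by (simp only: joint_bounds(3)[of z' z] max.commute[of "hit z'"])
      also have "\<dots> \<le> overlap_kernel c \<tau>1 n z z' + overlap_kernel c \<tau>1 n z' z" by simp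
      finally show ?thesis .
    qed
  qed simp
qed

text \<open>\<open>\<tau>1\<close> stays free below \<open>\<tau>2\<close>, since it must also meet
  the constraints of \<open>hit_lower\<close> and \<open>common_separation_close\<close>.\<close>

lemma overlap_kernel_integral_le:
  assumes "c > 0"
  obtains \<tau>2 where "\<tau>2 > 0" "\<And>\<tau>1. 0 < \<tau>1 \<Longrightarrow> \<tau>1 < \<tau>2 \<Longrightarrow> \<exists>C>0. \<forall>n\<ge>1.
    (\<integral>\<^sup>+z. \<integral>\<^sup>+z'. overlap_kernel c \<tau>1 n z z' \<partial>nu \<partial>nu) \<le> ennreal (C * real n powr (- (1 + 1 / pw)))"
proof -
  interpret nu: finite_measure nu by (rule finite_measure_nu)
  interpret S: finite_measure "sphere_measure :: 'a measure" by (rule finite_measure_sphere_measure[OF dim])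
  obtain \<Lambda> \<epsilon> where \<Lambda>: "\<Lambda> > 0" and \<epsilon>: "\<epsilon> > 0" and shell: "\<And>V G. V \<in> sets borel \<Longrightarrow> G \<in> borel_measurable borel \<Longrightarrow>
      (\<integral>\<^sup>+z. indicator V (fst z) * (indicator {0<..<\<epsilon>} (tau z) * G (tau z)) \<partial>nu) \<le>
        ennreal \<Lambda> * emeasure sphere_measure (V \<inter> sphere 0 1) * (\<integral>\<^sup>+x\<in>{0<..<\<epsilon>}. G x \<partial>lborel)"
    using nu_shell_le by blast
  obtain C1 where C1: "C1 > 0" "\<And>(u::'a) r. norm u = 1 \<Longrightarrow> 0 < r \<Longrightarrow>
      emeasure sphere_measure (sphere_cap u r) \<le> ennreal (C1 * r ^ (DIM('a) - 1))"
    using emeasure_sphere_cap_upper[OF dim] by blast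
  obtain A where A: "A > 0" "\<And>n. n > 0 \<Longrightarrow>
    (\<integral>\<^sup>+x\<in>{0<..}. ennreal (x powr pw * exp (- n * (c / 2) * x powr pw)) \<partial>lborel) \<le> ennreal (A * n powr (- (1 + 1 / pw)))"
    using nn_integral_powr_exp_scaling[OF pw, of "c / 2"] assms by auto
  show ?thesis
  proof (rule that[OF \<epsilon>])
    fix \<tau>1 :: real assume \<tau>1: "0 < \<tau>1" "\<tau>1 < \<epsilon>"
    define B where "B = 3 * (\<Lambda> * C1 * closeness ^ (DIM('a) - 1))"
    define N where "N = measure nu (space nu)"
    define s where "s = measure sphere_measure (sphere (0::'a) 1)"
    define c' where "c' = c / 2 * \<tau>1 powr pw"
    \<comment> \<open>The first summand is the layer, the second the points beyond it. The 1 makes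
      \<open>C\<close> positive, \<open>s\<close> and \<open>N\<close> being known only to be
      nonnegative.\<close>
    define C where "C = B * \<Lambda> * s * A + 3 * N\<^sup>2 * (4 / c'\<^sup>2) + 1"
    have pos: "B > 0" "N \<ge> 0" "s \<ge> 0" "c' > 0"
      using \<Lambda> C1 closeness_pos assms \<tau>1 by (auto simp: B_def N_def s_def c'_def)
    have "C > 0" using pos \<Lambda> A by (auto simp: C_def intro!: add_nonneg_pos add_nonneg_nonneg)
    moreover have "(\<integral>\<^sup>+z. \<integral>\<^sup>+z'. overlap_kernel c \<tau>1 n z z' \<partial>nu \<partial>nu) \<le> ennreal (C * real n powr (- (1 + 1 / pw)))"
      if n: "n \<ge> 1" for n :: nat
    proof -
      define g where "g = (\<lambda>x. x powr pw * exp (- real n * (c / 2) * x powr pw))"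
      have g0: "g x \<ge> 0" for x by (simp add: g_def)
      have [measurable]: "g \<in> borel_measurable borel" unfolding g_def by measurable
      let ?far = "ennreal (3 * N * exp (- real n * c'))"
      \<comment> \<open>The indicator of \<open>UNIV\<close> brings the bound into the form that
        \<open>shell\<close> integrates.\<close>
      have inner: "(\<integral>\<^sup>+z'. overlap_kernel c \<tau>1 n z z' \<partial>nu) \<le>
          ennreal B * (indicator UNIV (fst z) * (indicator {0<..<\<epsilon>} (tau z) * ennreal (g (tau z)))) + ?far"
        if z: "z \<in> space nu" for z
      proof -
        consider "tau z \<le> 0" | "0 < tau z" "tau z \<le> \<tau>1" | "\<tau>1 < tau z" by linarith
        then show ?thesis
        proof cases
          case 1
          then have "(\<integral>\<^sup>+z'. overlap_kernel c \<tau>1 n z z' \<partial>nu) = (\<integral>\<^sup>+z'. 0 \<partial>nu)"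
            by (intro nn_integral_cong) (auto simp: overlap_kernel_def)
          then show ?thesis by simp
        next
          case 2
          let ?x = "tau z"
          let ?V = "cball (fst z) (closeness * sqrt ?x)"
          have [measurable]: "(\<lambda>w. indicator ?V (fst w) :: ennreal) \<in> borel_measurable polar_base"
            by (rule measurable_compose[OF fst_polar_base borel_measurable_indicator[OF borel_closed[OF closed_cball]]])
          \<comment> \<open>For fixed \<open>z\<close> the kernel lives on a cap of radius of order
            sqrt(\<open>?x\<close>) times heights in (0, \<open>?x\<close>], a set of measure
            O(\<open>?x powr pw\<close>).\<close>
          have "(\<integral>\<^sup>+z'. overlap_kernel c \<tau>1 n z z' \<partial>nu) \<le>
              (\<integral>\<^sup>+z'. ennreal (3 * exp (- real n * (c / 2 * ?x powr pw))) *
                (indicator ?V (fst z') * (indicator {0<..<\<epsilon>} (tau z') * indicator {..?x} (tau z'))) \<partial>nu)"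
            using 2 \<tau>1 by (intro nn_integral_mono) (auto simp: overlap_kernel_def split: split_indicator)
          also have "\<dots> = ennreal (3 * exp (- real n * (c / 2 * ?x powr pw))) *
              (\<integral>\<^sup>+z'. indicator ?V (fst z') * (indicator {0<..<\<epsilon>} (tau z') * indicator {..?x} (tau z')) \<partial>nu)"
            by (rule nn_integral_cmult) measurable
          also have "\<dots> \<le> ennreal (3 * exp (- real n * (c / 2 * ?x powr pw))) *
              (ennreal \<Lambda> * ennreal (C1 * (closeness * sqrt ?x) ^ (DIM('a) - 1)) * ennreal ?x)"
          proof (rule mult_left_mono)
            have "(\<integral>\<^sup>+z'. indicator ?V (fst z') * (indicator {0<..<\<epsilon>} (tau z') * indicator {..?x} (tau z')) \<partial>nu) \<le>
              ennreal \<Lambda> * emeasure sphere_measure (?V \<inter> sphere 0 1) * (\<integral>\<^sup>+x\<in>{0<..<\<epsilon>}. indicator {..?x} x \<partial>lborel)"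
              by (rule shell) auto
            also have "(\<integral>\<^sup>+x\<in>{0<..<\<epsilon>}. indicator {..?x} x \<partial>lborel) \<le> (\<integral>\<^sup>+x. indicator {0..?x} x \<partial>lborel)"
              by (intro nn_integral_mono) (auto split: split_indicator)
            also have "(\<integral>\<^sup>+x. indicator {0..?x} x \<partial>lborel) = ennreal ?x" using 2 by simp
            also have "emeasure sphere_measure (?V \<inter> sphere 0 1) \<le> ennreal (C1 * (closeness * sqrt ?x) ^ (DIM('a) - 1))"
              using C1(2)[of "fst z" "closeness * sqrt ?x"] z 2 closeness_pos
              by (auto simp: sphere_cap_def Int_commute)
            finally show "(\<integral>\<^sup>+z'. indicator ?V (fst z') * (indicator {0<..<\<epsilon>} (tau z') * indicator {..?x} (tau z')) \<partial>nu) \<le>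
              ennreal \<Lambda> * ennreal (C1 * (closeness * sqrt ?x) ^ (DIM('a) - 1)) * ennreal ?x"
              by (simp add: mult_left_mono mult_right_mono)
          qed simp
          also have "\<dots> = ennreal (B * g ?x)"
          proof -
            have "B * g ?x = 3 * exp (- real n * (c / 2 * ?x powr pw)) *
                (\<Lambda> * (C1 * (closeness * sqrt ?x) ^ (DIM('a) - 1)) * ?x)"
              unfolding g_def B_def times_sqrt_power[OF 2(1), symmetric] power_mult_distrib by (simp add: mult_ac)
            then show ?thesis using 2 \<Lambda> C1 closeness_pos by (simp add: ennreal_mult)
          qed
          also have "\<dots> = ennreal B * (indicator UNIV (fst z) * (indicator {0<..<\<epsilon>} (tau z) * ennreal (g (tau z))))"
            using 2 \<tau>1 pos g0 by (simp add: ennreal_mult)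
          finally show ?thesis by (rule order_trans) simp
        next
          case 3
          then have "(\<integral>\<^sup>+z'. overlap_kernel c \<tau>1 n z z' \<partial>nu) \<le> (\<integral>\<^sup>+z'. ennreal (3 * exp (- real n * c')) \<partial>nu)"
            by (intro nn_integral_mono) (auto simp: overlap_kernel_def c'_def)
          also have "\<dots> = ?far"
            by (simp add: nu.emeasure_eq_measure N_def mult_ac flip: ennreal_mult)
          finally show ?thesis by (rule order_trans) simp
        qed
      qed
      have "(\<integral>\<^sup>+z. \<integral>\<^sup>+z'. overlap_kernel c \<tau>1 n z z' \<partial>nu \<partial>nu) \<le>
          (\<integral>\<^sup>+z. ennreal B * (indicator UNIV (fst z) * (indicator {0<..<\<epsilon>} (tau z) * ennreal (g (tau z)))) + ?far \<partial>nu)"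
        by (intro nn_integral_mono inner)
      also have "\<dots> = ennreal B * (\<integral>\<^sup>+z. indicator UNIV (fst z) * (indicator {0<..<\<epsilon>} (tau z) * ennreal (g (tau z))) \<partial>nu) +
          ?far * ennreal N"
        by (subst nn_integral_add) (measurable, simp add: nn_integral_cmult nu.emeasure_eq_measure N_def)
      also have "\<dots> \<le> ennreal B * (ennreal \<Lambda> * ennreal s * ennreal (A * real n powr (- (1 + 1 / pw)))) + ?far * ennreal N"
      proof (intro add_right_mono mult_left_mono)
        have "(\<integral>\<^sup>+z. indicator UNIV (fst z) * (indicator {0<..<\<epsilon>} (tau z) * ennreal (g (tau z))) \<partial>nu) \<le>
            ennreal \<Lambda> * emeasure sphere_measure (UNIV \<inter> sphere (0::'a) 1) * (\<integral>\<^sup>+x\<in>{0<..<\<epsilon>}. ennreal (g x) \<partial>lborel)"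
          by (rule shell) auto
        also have "(\<integral>\<^sup>+x\<in>{0<..<\<epsilon>}. ennreal (g x) \<partial>lborel) \<le> (\<integral>\<^sup>+x\<in>{0<..}. ennreal (g x) \<partial>lborel)"
          by (intro nn_integral_mono) (auto split: split_indicator)
        also have "\<dots> \<le> ennreal (A * real n powr (- (1 + 1 / pw)))"
          unfolding g_def using n by (intro A) auto
        finally show "(\<integral>\<^sup>+z. indicator UNIV (fst z) * (indicator {0<..<\<epsilon>} (tau z) * ennreal (g (tau z))) \<partial>nu) \<le>
            ennreal \<Lambda> * ennreal s * ennreal (A * real n powr (- (1 + 1 / pw)))"
          by (simp add: s_def S.emeasure_eq_measure mult_left_mono)
      qed simp
      also have "\<dots> = ennreal (B * \<Lambda> * s * A * real n powr (- (1 + 1 / pw)) + 3 * N\<^sup>2 * exp (- real n * c'))"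
      proof -
        have "ennreal B * (ennreal \<Lambda> * ennreal s * ennreal x) + ?far * ennreal N =
            ennreal (B * (\<Lambda> * s * x) + 3 * N * exp (- real n * c') * N)" if "x \<ge> 0" for x
          using pos \<Lambda> that by (simp add: ennreal_mult ennreal_plus)
        moreover have "A * real n powr (- (1 + 1 / pw)) \<ge> 0" using A by simp
        moreover have "B * (\<Lambda> * s * (A * real n powr (- (1 + 1 / pw)))) + 3 * N * exp (- real n * c') * N =
            B * \<Lambda> * s * A * real n powr (- (1 + 1 / pw)) + 3 * N\<^sup>2 * exp (- real n * c')"
          by (simp add: power2_eq_square)
        ultimately show ?thesis by (simp only:)
      qed
      also have "\<dots> \<le> ennreal (C * real n powr (- (1 + 1 / pw)))"
      proof (rule ennreal_leI)
        have "exp (- real n * c') \<le> 4 / c'\<^sup>2 * real n powr (- (1 + 1 / pw))"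
          using pos pw n by (intro exp_minus_le_powr) (auto simp: divide_le_eq)
        then have "3 * N\<^sup>2 * exp (- real n * c') \<le> 3 * N\<^sup>2 * (4 / c'\<^sup>2 * real n powr (- (1 + 1 / pw)))"
          by (intro mult_left_mono) auto
        then show "B * \<Lambda> * s * A * real n powr (- (1 + 1 / pw)) + 3 * N\<^sup>2 * exp (- real n * c') \<le> C * real n powr (- (1 + 1 / pw))"
          unfolding C_def distrib_right
          using powr_ge_zero[of "real n" "- (1 + 1 / pw)"] by (simp add: mult_ac add_increasing2)
      qed
      finally show ?thesis .
    qed
    ultimately show "\<exists>C>0. \<forall>n\<ge>1. (\<integral>\<^sup>+z. \<integral>\<^sup>+z'. overlap_kernel c \<tau>1 n z z' \<partial>nu \<partial>nu) \<le> ennreal (C * real n powr (- (1 + 1 / pw)))"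
      by blast
  qed
qed


section \<open>From parameters back to hyperplanes\<close>

abbreviation functional where
  "functional n H \<equiv> enn2real (weighted_volume lam (random_polyhedron K n H \<inter> K1))"

definition uncut where
  "uncut n \<omega> = measure nu {z \<in> space nu. \<forall>i<n. \<not> cuts (\<omega> i) z}"

lemma functional_eq_uncut:
  assumes \<omega>: "\<And>i. i < n \<Longrightarrow> (snd (\<omega> i), fst (\<omega> i)) \<in> shell K"
    and H: "\<And>i. i < n \<Longrightarrow> H i = hyperplane (fst (\<omega> i)) (snd (\<omega> i))"
  shows "functional n H = uncut n \<omega>"
proof -
  interpret nu: finite_measure nu by (rule finite_measure_nu)
  define M where "M = (\<Inter>i<n. {y. fst (\<omega> i) \<bullet> y \<le> snd (\<omega> i)}) \<inter> K1"
  have "random_polyhedron K n H \<inter> K1 = M"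
    unfolding random_polyhedron_def M_def using halfspace_containing_shell[OF \<omega>] H by auto
  moreover have "weighted_volume lam M = emeasure nu {z \<in> space nu. snd z *\<^sub>R fst z \<in> M}"
  proof (rule weighted_volume_eq)
    show "convex M" unfolding M_def
      by (intro convex_Int convex_INT convex_halfspace_le convex_outer_parallel convex)
    show "compact M" unfolding M_def
      by (intro closed_Int_compact closed_INT ballI closed_halfspace_le compact_outer_parallel compact)
    show "0 \<in> M" using zero_mem subset_outer_parallel[of K] \<omega> by (auto simp: M_def shell_def)
  qed (simp add: M_def)
  moreover have "emeasure nu {z \<in> space nu. snd z *\<^sub>R fst z \<in> M} = emeasure nu {z \<in> space nu. \<forall>i<n. \<not> cuts (\<omega> i) z}"
  proof (rule emeasure_eq_AE)
    show "AE z in nu. z \<in> {z \<in> space nu. snd z *\<^sub>R fst z \<in> M} \<longleftrightarrow> z \<in> {z \<in> space nu. \<forall>i<n. \<not> cuts (\<omega> i) z}"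
      using AE_nu_K1 by eventually_elim (auto simp: M_def cuts_def not_less)
    have [measurable]: "M \<in> sets borel" unfolding M_def
      by (intro borel_closed closed_Int closed_INT ballI closed_halfspace_le compact_imp_closed compact_outer_parallel compact)
    show "{z \<in> space nu. snd z *\<^sub>R fst z \<in> M} \<in> sets nu" by measurable
    show "{z \<in> space nu. \<forall>i<n. \<not> cuts (\<omega> i) z} \<in> sets nu"
      unfolding cuts_def by measurable
  qed
  ultimately show ?thesis by (simp add: uncut_def measure_def)
qed

lemma variance_uncut_le:
  shows "uncut n \<in> borel_measurable (Pi\<^sub>M {..<n} (\<lambda>_. P))"
    and "ennreal (prob_space.variance (Pi\<^sub>M {..<n} (\<lambda>_. P)) (uncut n)) \<le>
      (\<integral>\<^sup>+z. \<integral>\<^sup>+z'. ennreal (real n * joint z z' * (1 - max (hit z) (hit z')) ^ (n - 1)) \<partial>nu \<partial>nu)"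
proof -
  define B where "B = {x \<in> space (P \<Otimes>\<^sub>M nu). cuts (fst x) (snd x)}"
  have B: "B \<in> sets (P \<Otimes>\<^sub>M nu)" unfolding B_def cuts_def by measurable
  have un: "uncut n \<omega> = measure nu {z \<in> space nu. \<forall>i<n. (\<omega> i, z) \<notin> B}" if "\<omega> \<in> space (Pi\<^sub>M {..<n} (\<lambda>_. P))" for \<omega>
    unfolding uncut_def using that
    by (intro arg_cong[of _ _ "measure nu"]) (auto simp: B_def space_pair_measure space_PiM PiE_iff)
  have hj: "measure P {p \<in> space P. (p, z) \<in> B} = hit z"
    "measure P {p \<in> space P. (p, z) \<in> B \<and> (p, z') \<in> B} = joint z z'" if "z \<in> space nu" "z' \<in> space nu" for z z'
    unfolding hit_def joint_def using that
    by (auto intro!: arg_cong[of _ _ "measure P"] simp: B_def space_pair_measure)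
  note V = variance_measure_not_hit_le[OF prob_space_P finite_measure_nu B, of n]
  show "uncut n \<in> borel_measurable (Pi\<^sub>M {..<n} (\<lambda>_. P))"
    using V(1) by (subst measurable_cong[OF un]) 
  have "prob_space.variance (Pi\<^sub>M {..<n} (\<lambda>_. P)) (uncut n) =
      prob_space.variance (Pi\<^sub>M {..<n} (\<lambda>_. P)) (\<lambda>\<omega>. measure nu {z \<in> space nu. \<forall>i<n. (\<omega> i, z) \<notin> B})"
    using un by (auto intro!: Bochner_Integration.integral_cong cong: Bochner_Integration.integral_cong)
  also have "ennreal \<dots> \<le> (\<integral>\<^sup>+z. \<integral>\<^sup>+z'. ennreal (real n * joint z z' * (1 - max (hit z) (hit z')) ^ (n - 1)) \<partial>nu \<partial>nu)"
    by (rule order_trans[OF V(2)]) (intro nn_integral_mono; simp only: hj order_refl)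
  finally show "ennreal (prob_space.variance (Pi\<^sub>M {..<n} (\<lambda>_. P)) (uncut n)) \<le>
      (\<integral>\<^sup>+z. \<integral>\<^sup>+z'. ennreal (real n * joint z z' * (1 - max (hit z) (hit z')) ^ (n - 1)) \<partial>nu \<partial>nu)" .
qed

lemma variance_uncut_powr:
  obtains C where "C > 0" "\<And>n. n \<ge> 1 \<Longrightarrow>
    prob_space.variance (Pi\<^sub>M {..<n} (\<lambda>_. P)) (uncut n) \<le> C * real n powr (- (1 + 1 / pw))"
proof -
  interpret nu: finite_measure nu by (rule finite_measure_nu)
  interpret nn: pair_sigma_finite nu nu
    by (intro pair_sigma_finite.intro nu.sigma_finite_measure_axioms)
  obtain c \<tau>0 where c: "c > 0" "\<tau>0 > 0"
    "\<And>z. z \<in> space nu \<Longrightarrow> 0 < tau z \<Longrightarrow> c * min (tau z) \<tau>0 powr pw \<le> hit z"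
    using hit_lower by blast
  obtain \<tau>2 where \<tau>2: "\<tau>2 > 0" "\<And>\<tau>1. 0 < \<tau>1 \<Longrightarrow> \<tau>1 < \<tau>2 \<Longrightarrow> \<exists>C>0. \<forall>n\<ge>1.
    (\<integral>\<^sup>+z. \<integral>\<^sup>+z'. overlap_kernel c \<tau>1 n z z' \<partial>nu \<partial>nu) \<le> ennreal (C * real n powr (- (1 + 1 / pw)))"
    using overlap_kernel_integral_le[OF c(1)] by blast
  \<comment> \<open>Below \<open>\<tau>0\<close> for the hitting bound, below \<open>r0\<close> for
    the closeness of directions, strictly below \<open>\<tau>2\<close> for the integral.\<close>
  define \<tau>1 where "\<tau>1 = min (min \<tau>0 r0) (\<tau>2 / 2)"
  have \<tau>1: "0 < \<tau>1" "\<tau>1 \<le> r0" "\<tau>1 \<le> \<tau>0" "\<tau>1 < \<tau>2" using c \<tau>2 r0 by (auto simp: \<tau>1_def)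
  have hit1: "c * min (tau z) \<tau>1 powr pw \<le> hit z" if "z \<in> space nu" "0 < tau z" for z
  proof -
    have "c * min (tau z) \<tau>1 powr pw \<le> c * min (tau z) \<tau>0 powr pw"
      using c \<tau>1 that pw by (intro mult_left_mono powr_mono2) auto
    then show ?thesis using c(3)[OF that] by simp
  qed
  obtain C where C: "C > 0" "\<And>n. n \<ge> 1 \<Longrightarrow>
    (\<integral>\<^sup>+z. \<integral>\<^sup>+z'. overlap_kernel c \<tau>1 n z z' \<partial>nu \<partial>nu) \<le> ennreal (C * real n powr (- (1 + 1 / pw)))"
    using \<tau>2(2)[OF \<tau>1(1,4)] by blast
  have "prob_space.variance (Pi\<^sub>M {..<n} (\<lambda>_. P)) (uncut n) \<le> 2 * C * real n powr (- (1 + 1 / pw))"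
    if n: "n \<ge> 1" for n
  proof -
    have km[measurable]: "case_prod (overlap_kernel c \<tau>1 n) \<in> borel_measurable (nu \<Otimes>\<^sub>M nu)"
      using overlap_kernel_meas[of c \<tau>1 n] by measurable
    have "ennreal (prob_space.variance (Pi\<^sub>M {..<n} (\<lambda>_. P)) (uncut n)) \<le>
        (\<integral>\<^sup>+z. \<integral>\<^sup>+z'. overlap_kernel c \<tau>1 n z z' + overlap_kernel c \<tau>1 n z' z \<partial>nu \<partial>nu)"
      by (rule order_trans[OF variance_uncut_le(2)])
        (intro nn_integral_mono integrand_le_overlap_kernel[OF c(1) \<tau>1(1,2) hit1 n])
    also have "\<dots> = (\<integral>\<^sup>+z. (\<integral>\<^sup>+z'. overlap_kernel c \<tau>1 n z z' \<partial>nu) + (\<integral>\<^sup>+z'. overlap_kernel c \<tau>1 n z' z \<partial>nu) \<partial>nu)"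
      by (intro nn_integral_cong nn_integral_add) measurable
    also have "\<dots> = (\<integral>\<^sup>+z. \<integral>\<^sup>+z'. overlap_kernel c \<tau>1 n z z' \<partial>nu \<partial>nu) + (\<integral>\<^sup>+z. \<integral>\<^sup>+z'. overlap_kernel c \<tau>1 n z' z \<partial>nu \<partial>nu)"
      by (intro nn_integral_add) measurable
    \<comment> \<open>The two orders contribute equally, by Tonelli.\<close>
    also have "(\<integral>\<^sup>+z. \<integral>\<^sup>+z'. overlap_kernel c \<tau>1 n z' z \<partial>nu \<partial>nu) = (\<integral>\<^sup>+z. \<integral>\<^sup>+z'. overlap_kernel c \<tau>1 n z z' \<partial>nu \<partial>nu)"
      by (rule nn.Fubini') measurable
    also have "\<dots> + \<dots> \<le> ennreal (C * real n powr (- (1 + 1 / pw))) + ennreal (C * real n powr (- (1 + 1 / pw)))"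
      by (intro add_mono C n)
    also have "\<dots> = ennreal (2 * C * real n powr (- (1 + 1 / pw)))"
      using C by (simp flip: ennreal_plus)
    finally show ?thesis using C by (simp add: ennreal_le_iff)
  qed
  then show ?thesis using C by (intro that[of "2 * C"]) auto
qed

text \<open>If the functional were not measurable, its variance would be \<open>0\<close>: the junk value of the expectation is
  \<open>0\<close>, and the square of a nonnegative nonmeasurable function is again nonmeasurable. Hence all
  measurability questions can be settled on the space of parameters \<open>(u, t)\<close>.\<close>

lemma hyperplane_variance_le:
  "hyperplane_variance q n (functional n) \<le> prob_space.variance (Pi\<^sub>M {..<n} (\<lambda>_. P)) (uncut n)"
proof -
  let ?H = "hyperplane_measure q" and ?f = "\<lambda>(u, t). hyperplane u t :: 'a set"
  let ?PH = "Pi\<^sub>M {..<n} (\<lambda>_. ?H)" and ?PP = "Pi\<^sub>M {..<n} (\<lambda>_. P)"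
  have m: "?f \<in> measurable P ?H"
    unfolding hyperplane_measure_eq using measurable_hyperplane_P by simp
  have H: "?H = distr P ?H ?f"
    by (subst hyperplane_measure_eq) (intro distr_cong, simp_all add: hyperplane_measure_eq)
  have pH: "prob_space ?H"
    unfolding hyperplane_measure_eq by (rule prob_space.prob_space_distr[OF prob_space_P measurable_hyperplane_P])
  interpret PH: prob_space ?PH by (intro prob_space_PiM pH)
  interpret PP: prob_space ?PP by (intro prob_space_PiM prob_space_P)
  have var_eq: "hyperplane_variance q n (functional n) = PH.variance (functional n)"
    by (simp add: hyperplane_variance_def)
  show ?thesis
  proof (cases "functional n \<in> borel_measurable ?PH")
    case False
    then have "PH.expectation (functional n) = 0"
      by (intro not_integrable_integral_eq) (auto dest: borel_measurable_integrable)
    moreover have "(\<lambda>x. (functional n x)\<^sup>2) \<notin> borel_measurable ?PH"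
    proof
      assume "(\<lambda>x. (functional n x)\<^sup>2) \<in> borel_measurable ?PH"
      then have "(\<lambda>x. sqrt ((functional n x)\<^sup>2)) \<in> borel_measurable ?PH" by measurable
      with False show False by simp
    qed
    then have "PH.expectation (\<lambda>x. (functional n x)\<^sup>2) = 0"
      by (intro not_integrable_integral_eq) (auto dest: borel_measurable_integrable)
    ultimately show ?thesis unfolding var_eq by (auto intro!: Bochner_Integration.integral_nonneg)
  next
    case True
    let ?T = "compose {..<n} ?f"
    have PH_eq: "?PH = distr ?PP ?PH ?T"
    proof -
      have "distr ?PP ?PH ?T = Pi\<^sub>M {..<n} (\<lambda>_. distr P ?H ?f)"
        by (rule distr_PiM_finite_prob_space') (use m pH prob_space_P in auto)
      then show ?thesis using H by simp
    qed
    have T: "?T \<in> measurable ?PP ?PH"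
      unfolding compose_def using m by measurable
    have "AE \<omega> in ?PP. \<forall>i\<in>{..<n}. (snd (\<omega> i), fst (\<omega> i)) \<in> shell K"
      by (intro AE_finite_allI AE_PiM_component prob_space_P AE_P_shell) auto
    then have ae: "AE \<omega> in ?PP. functional n (?T \<omega>) = uncut n \<omega>"
      by eventually_elim (intro functional_eq_uncut, auto simp: compose_def case_prod_beta)
    \<comment> \<open>General \<open>g\<close> because it is used twice: for the mean, then for the
      squared deviation from the common mean.\<close>
    have transfer: "PH.expectation (\<lambda>x. g (functional n x)) = PP.expectation (\<lambda>\<omega>. g (uncut n \<omega>))"
      if [measurable]: "g \<in> borel_measurable borel" for g :: "real \<Rightarrow> real"
    proof -
      note [measurable] = True T variance_uncut_le(1)
      have "PH.expectation (\<lambda>x. g (functional n x)) = (\<integral>x. g (functional n x) \<partial>distr ?PP ?PH ?T)"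
        using PH_eq by simp
      also have "\<dots> = PP.expectation (\<lambda>\<omega>. g (functional n (?T \<omega>)))"
        by (intro integral_distr T) measurable
      also have "\<dots> = PP.expectation (\<lambda>\<omega>. g (uncut n \<omega>))"
      proof (rule integral_cong_AE)
        show "AE \<omega> in ?PP. g (functional n (?T \<omega>)) = g (uncut n \<omega>)"
          using ae by eventually_elim (simp only:)
        show "(\<lambda>\<omega>. g (functional n (?T \<omega>))) \<in> borel_measurable ?PP"
          by (rule measurable_compose[OF T]) measurable
      qed measurable
      finally show ?thesis .
    qed
    have "PH.expectation (functional n) = PP.expectation (uncut n)"
      using transfer[of "\<lambda>x. x"] by simp
    then show ?thesis unfolding var_eq
      using transfer[of "\<lambda>x. (x - PP.expectation (uncut n))\<^sup>2"] by simp
  qed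
qed

end

theorem theorem4p2:
  fixes K :: "'a::euclidean_space set"
    and q lam :: "real \<times> 'a \<Rightarrow> real"
  assumes dim: "DIM('a) \<ge> 2"
    and K_body: "convex_body K"
    and K_origin: "0 \<in> interior K"
    and K_slides: "\<exists>c r. r > 0 \<and> slides_freely_in K (cball c r)"
    and q_meas: "q \<in> borel_measurable (restrict_space borel ({0..} \<times> sphere 0 1))"
    and q_nonneg: "\<And>t u. t \<ge> 0 \<Longrightarrow> u \<in> sphere 0 1 \<Longrightarrow> q (t, u) \<ge> 0"
    and q_loc_int: "locally_integrable_density q"
    and q_concentrated:
      "AE (u, t) in sphere_measure \<Otimes>\<^sub>M restrict_space lborel {0..}. (t, u) \<notin> shell K \<longrightarrow> q (t, u) = 0"
    and q_pos_cont:
      "\<And>t u. (t, u) \<in> shell_boundary K \<Longrightarrow> q (t, u) > 0 \<and> continuous (at (t, u) within shell K) q"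
    and q_prob: "emeasure (hyperplane_measure q) (admissible_hyperplanes K) = 1"
    and lam_meas: "lam \<in> borel_measurable (restrict_space borel (UNIV \<times> sphere 0 1))"
    and lam_nonneg: "\<And>t u. u \<in> sphere 0 1 \<Longrightarrow> lam (t, u) \<ge> 0"
    and lam_loc_int: "locally_integrable_weight lam"
    and lam_cont:
      "\<And>u. u \<in> sphere 0 1 \<Longrightarrow> continuous (at (radial_fun K u, u) within UNIV \<times> sphere 0 1) lam"
  shows "\<exists>c>0. \<forall>n\<ge>1.
    hyperplane_variance q n (\<lambda>H. enn2real (weighted_volume lam (random_polyhedron K n H \<inter> outer_parallel K)))
      \<le> c * real n powr (- ((real DIM('a) + 3) / (real DIM('a) + 1)))"
proof -
  have K: "convex K" "compact K" using K_body by (auto simp: convex_body_def)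
  obtain r0 where r0: "r0 > 0" "cball 0 r0 \<subseteq> K" using K_origin by (auto simp: mem_interior_cball)
  obtain R1 where R1: "K \<subseteq> cball 0 R1" 
    using compact_imp_bounded[OF K(2)] by (auto simp: bounded_iff subset_iff)
  obtain p R where R: "R > 0" "slides_freely_in K (cball p R)" using K_slides by blast
  have slide: "\<exists>x\<in>K. K \<subseteq> cball (x - R *\<^sub>R u) R" if u: "norm u = 1" for u
  proof -
    \<comment> \<open>The boundary point of the ball with outer normal \<open>u\<close>. If the
      translation by \<open>v\<close> carries \<open>x\<close> there, undoing it moves the centre
      \<open>p\<close> to \<open>x - R *\<^sub>R u\<close>.\<close>
    have "p + R *\<^sub>R u \<in> frontier (cball p R)" using R u by (simp add: frontier_cball dist_norm)
    then obtain v where v: "p + R *\<^sub>R u \<in> (+) v ` K" "(+) v ` K \<subseteq> cball p R"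
      using R(2) unfolding slides_freely_in_def by blast
    then obtain x where x: "x \<in> K" "p + R *\<^sub>R u = v + x" by auto
    have "y \<in> cball (x - R *\<^sub>R u) R" if "y \<in> K" for y
    proof -
      have "x - R *\<^sub>R u - y = p - (v + y)" using x(2) by (simp add: algebra_simps)
      moreover have "v + y \<in> cball p R" using v(2) that by blast
      ultimately show ?thesis by (simp only: mem_cball dist_norm)
    qed
    then show ?thesis using x(1) by blast
  qed
  have "convex_body (outer_parallel K)" "0 \<in> interior (outer_parallel K)"
    using K K_origin interior_mono[OF subset_outer_parallel[of K]]
    by (auto simp: convex_body_def convex_outer_parallel compact_outer_parallel)
  then have lam_fin: "weighted_volume lam (outer_parallel K) < \<infinity>"
    using lam_loc_int unfolding locally_integrable_weight_def by blast
  interpret circumscribed_model K r0 R1 R q lam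
    by unfold_locales (fact K r0 R1 R(1) slide dim q_meas q_concentrated q_pos_cont q_prob
        lam_meas lam_nonneg lam_fin lam_cont)+
  obtain C where C: "C > 0" "\<And>n. n \<ge> 1 \<Longrightarrow>
    prob_space.variance (Pi\<^sub>M {..<n} (\<lambda>_. P)) (uncut n) \<le> C * real n powr (- (1 + 1 / pw))"
    using variance_uncut_powr by blast
  have "1 + 1 / pw = (real DIM('a) + 3) / (real DIM('a) + 1)"
    by (simp add: pw_def field_simps)
  then have "hyperplane_variance q n (functional n) \<le> C * real n powr (- ((real DIM('a) + 3) / (real DIM('a) + 1)))"
    if "n \<ge> 1" for n
    using order_trans[OF hyperplane_variance_le C(2)[OF that]] by (simp only:)
  then show ?thesis using C(1) by blast
qed
end
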